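(* $\mathrm{MC}(/)$ is $\mathrm{NL}$-hard under logarithmic-space many-one reductions.
   Context: Natural numbers include $0$. For $A,B\subseteq\mathbb N$: $A\cup B$, $A\cap B$ are the usual operations, $\overline{A}=\mathbb N\setminus A$, $A+B=\{a+b: a\in A, b\in B\}$, $A\times B=\{a\cdot b: a\in A, b\in B\}$, and $A/B=\{c\in\mathbb N:\exists a\in A\ \exists b\in B\setminus\{0\}: a=c\cdot b\}$ (exact integer division without remainder or rounding). For $\emptyset\ne\mathcal O\subseteq\{\cup,\cap,\overline{\phantom{c}},+,\times,/\}$, an $\mathcal O$-circuit $C=(V,E,g_C,\alpha)$ is a finite acyclic directed multigraph with gate set $V\subseteq\mathbb N$, every gate having indegree $0$, $1$ or $2$, a designated output gate $g_C\in V$, and a labeling $\alpha$: gates of indegree $0$ (input gates) are labeled by natural numbers, gates of indegree $1$ are labeled $\overline{\phantom{c}}$ (allowed only if $\overline{\phantom{c}}\in\mathcal O$), and gates of indegree $2$ are labeled by an operation in $\mathcal O\setminus\{\overline{\phantom{c}}\}$. The result set $I(g)\subseteq\mathbb N$ is defined inductively: $I(g)=\{\alpha(g)\}$ for an input gate; $I(g)=\mathbb N\setminus I(p)$ for a complement gate with predecessor $p$; $I(g)=I(g_1)\,\sigma\,I(g_2)$ for a gate labeled $\sigma$ with predecessors $g_1\le g_2$ (a double edge from one gate gives $g_1=g_2$). $I(C)=I(g_C)$. A circuit is encoded as a bit string listing its gates in reverse topological order, each gate as the triple (gate name, label, list of predecessors), with all numbers (including input labels) in binary; $|C|$ denotes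 the length of this encoding. The membership problem is $\mathrm{MC}(\mathcal O)=\{(C,b): C \text{ is an } \mathcal O\text{-circuit},\ b\in\mathbb N,\ b\in I(C)\}$, with $b$ given in binary; $\mathrm{MC}(\sigma_1,\dots,\sigma_n)$ abbreviates $\mathrm{MC}(\{\sigma_1,\dots,\sigma_n\})$. *)

theory Defs
  imports Complex_Main
begin

definition nplus :: "nat set \<Rightarrow> nat set \<Rightarrow> nat set" where
  "nplus A B = {a + b | a b. a \<in> A \<and> b \<in> B}"

definition ntimes :: "nat set \<Rightarrow> nat set \<Rightarrow> nat set" where
  "ntimes A B = {a * b | a b. a \<in> A \<and> b \<in> B}"

definition ndiv :: "nat set \<Rightarrow> nat set \<Rightarrow> nat set" where
  "ndiv A B = {c. \<exists>a\<in>A. \<exists>b\<in>B - {0}. a = c * b}"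

datatype op = OUnion | OInter | OCompl | OPlus | OTimes | ODiv

datatype label = LInput nat | LOp op

text \<open>A gate: (gate name, label, list of predecessors).  A circuit is a list of
  gates in reverse topological order (every predecessor of a gate is listed
  after it) together with the name of the output gate.\<close>
type_synonym gate = "nat \<times> label \<times> nat list"

definition gname :: "gate \<Rightarrow> nat" where "gname g = fst g"
definition glabel :: "gate \<Rightarrow> label" where "glabel g = fst (snd g)"
definition gpreds :: "gate \<Rightarrow> nat list" where "gpreds g = snd (snd g)"

definition shape_ok :: "op set \<Rightarrow> label \<Rightarrow> nat list \<Rightarrow> bool" where
  "shape_ok Ops lab ps \<longleftrightarrow>
     (ps = [] \<and> (\<exists>n. lab = LInput n))
   \<or> (length ps = 1 \<and> lab = LOp OCompl \<and> OCompl \<in> Ops)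
   \<or> (length ps = 2 \<and> ps ! 0 \<le> ps ! 1 \<and> (\<exists>\<sigma>. lab = LOp \<sigma> \<and> \<sigma> \<in> Ops \<and> \<sigma> \<noteq> OCompl))"

fun valid_gates :: "op set \<Rightarrow> gate list \<Rightarrow> bool" where
  "valid_gates Ops [] = True"
| "valid_gates Ops (g # gs) \<longleftrightarrow>
     gname g \<notin> gname ` set gs \<and> set (gpreds g) \<subseteq> gname ` set gs
     \<and> shape_ok Ops (glabel g) (gpreds g) \<and> valid_gates Ops gs"

definition is_circuit :: "op set \<Rightarrow> gate list \<Rightarrow> nat \<Rightarrow> bool" where
  "is_circuit Ops gs out \<longleftrightarrow> valid_gates Ops gs \<and> out \<in> gname ` set gs"

fun apply_op :: "op \<Rightarrow> nat set \<Rightarrow> nat set \<Rightarrow> nat set" where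
  "apply_op OUnion A B = A \<union> B"
| "apply_op OInter A B = A \<inter> B"
| "apply_op OCompl A B = UNIV - A"
| "apply_op OPlus A B = nplus A B"
| "apply_op OTimes A B = ntimes A B"
| "apply_op ODiv A B = ndiv A B"

definition gate_val :: "gate \<Rightarrow> (nat \<Rightarrow> nat set) \<Rightarrow> nat set" where
  "gate_val g I =
     (case glabel g of
        LInput n \<Rightarrow> {n}
      | LOp OCompl \<Rightarrow> UNIV - I (gpreds g ! 0)
      | LOp \<sigma> \<Rightarrow> apply_op \<sigma> (I (gpreds g ! 0)) (I (gpreds g ! 1)))"

fun sem :: "gate list \<Rightarrow> nat \<Rightarrow> nat set" where
  "sem [] = (\<lambda>_. {})"
| "sem (g # gs) = (let I = sem gs in I(gname g := gate_val g I))"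

fun bin :: "nat \<Rightarrow> bool list" where
  "bin n = (if n < 2 then [n = 1] else bin (n div 2) @ [n mod 2 = 1])"

datatype tok = T0 | T1 | TSep | TEnd | TOut | TIn
  | TUnion | TInter | TCompl | TPlus | TTimes | TDiv

fun tok_code :: "tok \<Rightarrow> bool list" where
  "tok_code T0 = [False,False,False,False]"
| "tok_code T1 = [False,False,False,True]"
| "tok_code TSep = [False,False,True,False]"
| "tok_code TEnd = [False,False,True,True]"
| "tok_code TOut = [False,True,False,False]"
| "tok_code TIn = [False,True,False,True]"
| "tok_code TUnion = [False,True,True,False]"
| "tok_code TInter = [False,True,True,True]"
| "tok_code TCompl = [True,False,False,False]"
| "tok_code TPlus = [True,False,False,True]"
| "tok_code TTimes = [True,False,True,False]"
| "tok_code TDiv = [True,False,True,True]"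

definition num_toks :: "nat \<Rightarrow> tok list" where
  "num_toks n = map (\<lambda>b. if b then T1 else T0) (bin n)"

fun op_tok :: "op \<Rightarrow> tok" where
  "op_tok OUnion = TUnion" | "op_tok OInter = TInter" | "op_tok OCompl = TCompl"
| "op_tok OPlus = TPlus" | "op_tok OTimes = TTimes" | "op_tok ODiv = TDiv"

fun label_toks :: "label \<Rightarrow> tok list" where
  "label_toks (LInput n) = TIn # num_toks n"
| "label_toks (LOp \<sigma>) = [op_tok \<sigma>]"

definition gate_toks :: "gate \<Rightarrow> tok list" where
  "gate_toks g = num_toks (gname g) @ [TSep] @ label_toks (glabel g) @ [TSep]
     @ concat (map (\<lambda>p. num_toks p @ [TSep]) (gpreds g)) @ [TEnd]"

definition encode_instance :: "gate list \<Rightarrow> nat \<Rightarrow> nat \<Rightarrow> bool list" where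
  "encode_instance gs out b =
     concat (map tok_code
       (concat (map gate_toks gs) @ [TOut] @ num_toks out @ [TOut] @ num_toks b))"

definition MC :: "op set \<Rightarrow> bool list set" where
  "MC Ops = {encode_instance gs out b | gs out b.
             is_circuit Ops gs out \<and> b \<in> sem gs out}"

section \<open>Turing machines with a read-only input tape, one work tape and a
  write-only output tape\<close>

datatype dir = Lft | Stay | Rgt

record ('a, 'b) tm =
  tm_start :: nat
  tm_accept :: "nat set"
  tm_delta :: "nat \<Rightarrow> 'a option \<Rightarrow> nat \<Rightarrow> (nat \<times> nat \<times> dir \<times> dir \<times> 'b option) set"

text \<open>Finitely many states and work symbols (0 is the blank).\<close>
definition wf_tm :: "('a, 'b) tm \<Rightarrow> bool" where
  "wf_tm M \<longleftrightarrow> (\<exists>Q \<Gamma>. finite Q \<and> finite \<Gamma> \<and> tm_start M \<in> Q \<and> 0 \<in> \<Gamma> \<and>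
     (\<forall>q\<in>Q. \<forall>a s. s \<in> \<Gamma> \<longrightarrow> finite (tm_delta M q a s) \<and>
        (\<forall>(q', s', di, dw, ot) \<in> tm_delta M q a s. q' \<in> Q \<and> s' \<in> \<Gamma>)))"

definition deterministic :: "('a, 'b) tm \<Rightarrow> bool" where
  "deterministic M \<longleftrightarrow> (\<forall>q a s x y. x \<in> tm_delta M q a s \<longrightarrow> y \<in> tm_delta M q a s \<longrightarrow> x = y)"

record 'b conf =
  c_state :: nat
  c_ipos :: nat
  c_tape :: "nat \<Rightarrow> nat"
  c_wpos :: nat
  c_out :: "'b list"

text \<open>Input tape: position 0 and length w + 1 hold end markers (None).\<close>
definition read_input :: "'a list \<Rightarrow> nat \<Rightarrow> 'a option" where
  "read_input w i = (if 1 \<le> i \<and> i \<le> length w then Some (w ! (i - 1)) else None)"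

fun move :: "dir \<Rightarrow> nat \<Rightarrow> nat" where
  "move Lft i = i - 1" | "move Stay i = i" | "move Rgt i = i + 1"

definition step :: "('a, 'b) tm \<Rightarrow> 'a list \<Rightarrow> 'b conf \<Rightarrow> 'b conf \<Rightarrow> bool" where
  "step M w c c' \<longleftrightarrow> (\<exists>q' s' di dw ot.
     (q', s', di, dw, ot) \<in> tm_delta M (c_state c) (read_input w (c_ipos c)) (c_tape c (c_wpos c))
     \<and> c' = \<lparr> c_state = q',
              c_ipos = min (length w + 1) (move di (c_ipos c)),
              c_tape = (c_tape c)(c_wpos c := s'),
              c_wpos = move dw (c_wpos c),
              c_out = c_out c @ (case ot of None \<Rightarrow> [] | Some x \<Rightarrow> [x]) \<rparr>)"

definition init_conf :: "('a, 'b) tm \<Rightarrow> 'b conf" where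
  "init_conf M = \<lparr> c_state = tm_start M, c_ipos = 0, c_tape = (\<lambda>_. 0), c_wpos = 0, c_out = [] \<rparr>"

definition reachable :: "('a, 'b) tm \<Rightarrow> 'a list \<Rightarrow> 'b conf \<Rightarrow> bool" where
  "reachable M w c \<longleftrightarrow> (step M w)\<^sup>*\<^sup>* (init_conf M) c"

definition halted :: "('a, 'b) tm \<Rightarrow> 'a list \<Rightarrow> 'b conf \<Rightarrow> bool" where
  "halted M w c \<longleftrightarrow> \<not> (\<exists>c'. step M w c c')"

definition log_space_bounded :: "('a, 'b) tm \<Rightarrow> nat \<Rightarrow> bool" where
  "log_space_bounded M k \<longleftrightarrow> (\<forall>w c. reachable M w c \<longrightarrow>
     real (c_wpos c) \<le> real k * log 2 (real (length w) + 2))"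

definition accepts :: "('a, 'b) tm \<Rightarrow> 'a list \<Rightarrow> bool" where
  "accepts M w \<longleftrightarrow> (\<exists>c. reachable M w c \<and> c_state c \<in> tm_accept M)"

definition NL :: "'a list set set" where
  "NL = {L. \<exists>(M :: ('a, unit) tm) k. wf_tm M \<and> log_space_bounded M k \<and>
             (\<forall>w. w \<in> L \<longleftrightarrow> accepts M w)}"

definition computes :: "('a, 'b) tm \<Rightarrow> ('a list \<Rightarrow> 'b list) \<Rightarrow> bool" where
  "computes M f \<longleftrightarrow> (\<forall>w. \<exists>c. reachable M w c \<and> halted M w c \<and> c_out c = f w)"

definition logspace_computable :: "('a list \<Rightarrow> 'b list) \<Rightarrow> bool" where
  "logspace_computable f \<longleftrightarrow> (\<exists>(M :: ('a, 'b) tm) k. wf_tm M \<and> deterministic M \<and>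
      log_space_bounded M k \<and> computes M f)"

definition logspace_reducible :: "'a list set \<Rightarrow> 'b list set \<Rightarrow> bool" where
  "logspace_reducible L L' \<longleftrightarrow>
     (\<exists>f. logspace_computable f \<and> (\<forall>w. w \<in> L \<longleftrightarrow> f w \<in> L'))"

end

theory Submission
  imports Defs
begin

text \<open>
  On subsets of \<open>{0,1}\<close>, where 1 stands for true, division of sets is conjunction. A circuit of division
  gates can therefore express that \<^emph>\<open>no\<close> path of a layered graph ends in a bad node, so that the
  complement of reachability reduces to the membership problem. To reduce reachability itself we use
  inductive counting (Immerman and Szelepcsenyi): for a machine \<open>M\<close> and an input \<open>w\<close> we consider the
  graph of a nondeterministic counting procedure whose accepting state can be reached iff \<^emph>\<open>no\<close>
  accepting configuration of \<open>M\<close> can be reached. Its nodes consist of a control state and eight numbers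
  that range over (codes of) configurations; the circuit has one gate for every node and every value of
  a clock.

  The circuit is printed by a program for registers that hold polynomially bounded numbers. The digits
  of all registers lie side by side on the work tape, one cell for every position, and an elementary
  operation is a sweep of a finite automaton over the tape. Configurations of \<open>M\<close> are represented by
  the input position and two stacks, which are numbers as well, so that stepping \<open>M\<close> amounts to pushing
  and popping digits.
\<close>

section \<open>Binary numbers and the encoding of instances\<close>

text \<open>Division only conjoins and no gate negates, so only statements about all walks can be
  evaluated; the complementation has to happen on the side of the machine. The input format causes a
  second difficulty: a gate precedes its predecessors in the list, and their names must be
  increasing. Therefore the clock is the most significant part of the number of a node, so that
  counting upwards yields a legal list, and a name starts with a code of the control state, numbered
  such that the outcome of the choice \<open>False\<close> never exceeds that of
  \<open>True\<close>. A leading 1 turns any such string into a canonical numeral. The circuit sees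
  only walks of one exact length. Accepting states loop, and the clock has \<open>N ^ 48\<close>
  values, more than the at most \<open>2 * length ctrls * N ^ 24\<close> edges between nodes that
  the procedure can reach. Here \<open>N = B ^ l\<close> where \<open>l\<close> is a fixed multiple
  of the binary length of the input length, so \<open>N\<close> is polynomial in the input length
  and the tape logarithmic.\<close>

declare bin.simps [simp del]

definition bval :: "bool list \<Rightarrow> nat" where
  "bval bs = foldl (\<lambda>a b. 2 * a + of_bool b) 0 bs"

lemma bval_simps [simp]: "bval [] = 0" "bval (bs @ [b]) = 2 * bval bs + of_bool b"
  by (simp_all add: bval_def)

lemma bval_bin [simp]: "bval (bin n) = n"
proof (induction n rule: bin.induct)
  case (1 n)
  show ?case
  proof (cases "n < 2")
    case True
    then show ?thesis by (auto simp: bval_def less_2_cases_iff bin.simps[of n])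
  next
    case False
    then have "bin n = bin (n div 2) @ [n mod 2 = 1]" by (simp add: bin.simps[of n])
    moreover have "2 * (n div 2) + of_bool (n mod 2 = 1) = n"
      using mult_div_mod_eq[of 2 n] by (cases "n mod 2 = 1") (auto simp: not_mod_2_eq_1_eq_0)
    ultimately show ?thesis using 1[OF False] by (simp only: bval_simps)
  qed
qed

lemma bin_inject: "bin m = bin n \<longleftrightarrow> m = n"
  by (metis bval_bin)

lemma bval_Cons: "bval (b # bs) = of_bool b * 2 ^ length bs + bval bs"
proof (induction bs rule: rev_induct)
  case Nil
  then show ?case by (simp add: bval_def)
next
  case (snoc x xs)
  then show ?case using bval_simps(2)[of "b # xs" x] by (simp add: algebra_simps)
qed

lemma bval_less: "bval bs < 2 ^ length bs"
proof (induction bs)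
  case (Cons b bs)
  then show ?case by (simp add: bval_Cons of_bool_def)
qed simp

text \<open>Gate names are bit strings with leading 1. As such strings are canonical numerals, the
  program can print a name bit by bit without computing \<open>bin\<close>.\<close>

lemma bin_bval_True: "bin (bval (True # bs)) = True # bs"
proof (induction bs rule: rev_induct)
  case Nil
  then show ?case by (simp add: bval_Cons bin.simps)
next
  case (snoc x xs)
  have pos: "bval (True # xs) \<ge> 1" by (simp add: bval_Cons Suc_le_eq)
  have e: "bval (True # xs @ [x]) = 2 * bval (True # xs) + of_bool x"
    using bval_simps(2)[of "True # xs" x] by simp
  then have "\<not> bval (True # xs @ [x]) < 2" using pos by simp
  then have "bin (bval (True # xs @ [x])) =
     bin (bval (True # xs @ [x]) div 2) @ [bval (True # xs @ [x]) mod 2 = 1]"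
    by (subst bin.simps) simp
  moreover have "bval (True # xs @ [x]) div 2 = bval (True # xs)"
    "(bval (True # xs @ [x]) mod 2 = 1) = x" unfolding e by (cases x; simp)+
  ultimately show ?case using snoc by simp
qed

lemma bval_append: "bval (xs @ ys) = bval xs * 2 ^ length ys + bval ys"
  by (induction xs) (simp_all add: bval_Cons algebra_simps power_add)

lemma bval_inject: "length xs = length ys \<Longrightarrow> bval xs = bval ys \<longleftrightarrow> xs = ys"
proof (induction xs ys rule: list_induct2)
  case (Cons x xs y ys)
  then show ?case using bval_less[of xs] bval_less[of ys]
    by (cases x; cases y; simp add: bval_Cons)
qed simp

section \<open>Unique readability of encoded instances\<close>

lemma tok_code_inject: "tok_code x = tok_code y \<Longrightarrow> x = y"
  by (cases x; cases y; simp)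

lemma tok_code_length: "length (tok_code x) = 4"
  by (cases x) auto

lemma concat_tok_code_inject:
  "concat (map tok_code xs) = concat (map tok_code ys) \<Longrightarrow> xs = ys"
proof (induction xs arbitrary: ys)
  case Nil
  then show ?case by (cases ys) (auto dest: arg_cong[of _ _ length] simp: tok_code_length)
next
  case (Cons x xs)
  then obtain y ys' where ys: "ys = y # ys'"
    by (cases ys) (auto dest: arg_cong[of _ _ length] simp: tok_code_length)
  then have "tok_code x = tok_code y \<and> concat (map tok_code xs) = concat (map tok_code ys')"
    using Cons.prems by (simp add: append_eq_append_conv tok_code_length)
  then show ?case using Cons.IH tok_code_inject ys by blast
qed

lemma delimited_inject:
  assumes "set ds \<subseteq> D" "set es \<subseteq> D" "x \<notin> D" "y \<notin> D" "ds @ x # xs = es @ y # ys"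
  shows "ds = es \<and> x = y \<and> xs = ys"
  using assms
proof (induction ds arbitrary: es)
  case Nil
  then show ?case by (cases es) auto
next
  case (Cons d ds)
  then show ?case by (cases es) auto
qed

lemma num_toks_set: "set (num_toks n) \<subseteq> {T0, T1}"
  by (auto simp: num_toks_def)

lemma num_toks_inject: "num_toks m = num_toks n \<longleftrightarrow> m = n"
proof -
  have "inj (\<lambda>b. if b then T1 else T0)" by (auto simp: inj_on_def)
  then show ?thesis unfolding num_toks_def using bin_inject by (metis map_injective)
qed

lemma num_toks_nonempty: "num_toks n \<noteq> []"
  by (simp add: num_toks_def bin.simps[of n])

lemma num_toks_parse:
  assumes "num_toks m @ x # xs = num_toks n @ y # ys" "x \<notin> {T0,T1}" "y \<notin> {T0,T1}"
  shows "m = n \<and> x = y \<and> xs = ys"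
  using delimited_inject[OF num_toks_set num_toks_set assms(2,3,1)] num_toks_inject by blast

text \<open>Unique readability passes from items to lists: each item determines its own end, and the
  terminator \<open>t\<close> cannot be mistaken for the start of another item.\<close>

lemma list_parse:
  assumes E: "\<And>x y r r'. E x @ r = E y @ r' \<Longrightarrow> x = y \<and> r = r'"
    and t: "\<And>x. E x \<noteq> [] \<and> hd (E x) \<noteq> t"
    and eq: "concat (map E xs) @ t # r = concat (map E ys) @ t # r'"
  shows "xs = ys \<and> r = r'"
  using eq
proof (induction xs arbitrary: ys)
  case Nil
  show ?case
  proof (cases ys)
    case (Cons y ys')
    then have "t # r = E y @ (concat (map E ys') @ t # r')" using Nil by simp
    then have False using t[of y] by (metis hd_append2 list.sel(1))
    then show ?thesis ..
  qed (use Nil in auto)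
next
  case (Cons x xs)
  show ?case
  proof (cases ys)
    case Nil
    then have "t # r' = E x @ (concat (map E xs) @ t # r)" using Cons.prems by simp
    then have False using t[of x] by (metis hd_append2 list.sel(1))
    then show ?thesis ..
  next
    case (Cons y ys')
    then have "E x @ (concat (map E xs) @ t # r) = E y @ (concat (map E ys') @ t # r')"
      using Cons.prems by simp
    then show ?thesis using E Cons.IH Cons by blast
  qed
qed

lemma op_tok_not: "op_tok \<sigma> \<notin> {T0, T1, TSep, TEnd, TOut, TIn}"
  by (cases \<sigma>) auto

lemma op_tok_inject: "op_tok \<sigma> = op_tok \<tau> \<Longrightarrow> \<sigma> = \<tau>"
  by (cases \<sigma>; cases \<tau>; simp)

lemma label_toks_parse:
  "label_toks l @ TSep # r = label_toks l' @ TSep # r' \<Longrightarrow> l = l' \<and> r = r'"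
proof (induction l)
  case (LInput n)
  then show ?case
  proof (cases l')
    case (LInput m)
    then show ?thesis using num_toks_parse[of n TSep r m TSep r'] \<open>label_toks (LInput n) @ _ = _\<close> by simp
  next
    case (LOp \<sigma>)
    then show ?thesis using op_tok_not[of \<sigma>] \<open>label_toks (LInput n) @ _ = _\<close> by auto
  qed
next
  case (LOp \<tau>)
  then show ?case
  proof (cases l')
    case (LInput m)
    then show ?thesis using op_tok_not[of \<tau>] \<open>label_toks (LOp \<tau>) @ _ = _\<close> by auto
  next
    case (LOp \<sigma>)
    then show ?thesis using op_tok_inject[of \<tau> \<sigma>] \<open>label_toks (LOp \<tau>) @ _ = _\<close> by simp
  qed
qed

lemma preds_parse:
  assumes "concat (map (\<lambda>p. num_toks p @ [TSep]) ps) @ TEnd # r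
    = concat (map (\<lambda>p. num_toks p @ [TSep]) qs) @ TEnd # r'"
  shows "ps = qs \<and> r = r'"
proof (rule list_parse[OF _ _ assms])
  fix x y r r' assume "(num_toks x @ [TSep]) @ r = (num_toks y @ [TSep]) @ r'"
  then show "x = y \<and> r = r'" using num_toks_parse[of x TSep r y TSep r'] by simp
next
  fix x show "num_toks x @ [TSep] \<noteq> [] \<and> hd (num_toks x @ [TSep]) \<noteq> TEnd"
    using num_toks_nonempty[of x] num_toks_set[of x] hd_in_set by fastforce
qed

lemma gate_toks_parse:
  assumes "gate_toks g @ r = gate_toks h @ r'"
  shows "g = h \<and> r = r'"
proof -
  let ?P = "\<lambda>g r. concat (map (\<lambda>p. num_toks p @ [TSep]) (gpreds g)) @ TEnd # r"
  have "num_toks (gname g) @ TSep # (label_toks (glabel g) @ TSep # ?P g r) =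
        num_toks (gname h) @ TSep # (label_toks (glabel h) @ TSep # ?P h r')"
    using assms by (simp add: gate_toks_def)
  then have "gname g = gname h" "label_toks (glabel g) @ TSep # ?P g r = label_toks (glabel h) @ TSep # ?P h r'"
    using num_toks_parse by blast+
  moreover from this(2) have "glabel g = glabel h" "?P g r = ?P h r'" using label_toks_parse by blast+
  moreover from this(2) have "gpreds g = gpreds h" "r = r'" using preds_parse by blast+
  ultimately show ?thesis by (simp add: gname_def glabel_def gpreds_def prod_eq_iff)
qed

text \<open>\<open>MC\<close> is a set of bit strings. To infer from membership of a string that a
  particular circuit produces a number, the circuit has to be recovered from the string.\<close>

lemma encode_instance_inject:
  assumes "encode_instance gs out b = encode_instance gs' out' b'"
  shows "gs = gs' \<and> out = out' \<and> b = b'"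
proof -
  have "concat (map gate_toks gs) @ TOut # (num_toks out @ TOut # num_toks b)
     = concat (map gate_toks gs') @ TOut # (num_toks out' @ TOut # num_toks b')"
    using concat_tok_code_inject assms unfolding encode_instance_def by fastforce
  then have "gs = gs' \<and> num_toks out @ TOut # num_toks b = num_toks out' @ TOut # num_toks b'"
  proof (rule list_parse[rotated 2])
    show "g = h \<and> r = r'" if "gate_toks g @ r = gate_toks h @ r'" for g h r r'
      using gate_toks_parse that by blast
    show "gate_toks g \<noteq> [] \<and> hd (gate_toks g) \<noteq> TOut" for g
      using num_toks_nonempty[of "gname g"] num_toks_set[of "gname g"] hd_in_set
      by (fastforce simp: gate_toks_def)
  qed
  then show ?thesis using num_toks_parse[of out TOut "num_toks b" out' TOut "num_toks b'"]
    num_toks_inject by auto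
qed

section \<open>Division gates as conjunctions\<close>

text \<open>Without 0 the set of divisors is \<open>{1}\<close> or empty, so the quotient is
  \<open>A\<close> or empty. Truth means that 1 is an element; falsity has several representatives,
  among them \<open>{0}\<close> and the empty set.\<close>

lemma ndiv_01:
  assumes "A \<subseteq> {0, 1}" "B \<subseteq> {0, 1}"
  shows "ndiv A B \<subseteq> {0, 1}" "1 \<in> ndiv A B \<longleftrightarrow> 1 \<in> A \<and> 1 \<in> B"
proof -
  have *: "ndiv A B = (if 1 \<in> B then A else {})"
  proof -
    have "B - {0} = (if 1 \<in> B then {1} else {})" using assms by auto
    then show ?thesis unfolding ndiv_def by auto
  qed
  show "ndiv A B \<subseteq> {0, 1}" "1 \<in> ndiv A B \<longleftrightarrow> 1 \<in> A \<and> 1 \<in> B" unfolding * using assms by auto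
qed

text \<open>A graph in which each inner node has two successors, which become the predecessors of
  its division gate; they may coincide, giving a double edge.\<close>

locale and_gates =
  fixes nm :: "'n \<Rightarrow> nat" and leaf bad :: "'n \<Rightarrow> bool" and f0 f1 :: "'n \<Rightarrow> 'n"
begin

definition mk_gate :: "'n \<Rightarrow> gate" where
  "mk_gate n = (if leaf n then (nm n, LInput (if bad n then 0 else 1), [])
     else (nm n, LOp ODiv, [nm (f0 n), nm (f1 n)]))"

fun topo :: "'n list \<Rightarrow> bool" where
  "topo [] = True"
| "topo (n # ns) \<longleftrightarrow> topo ns \<and> nm n \<notin> nm ` set ns \<and>
     (leaf n \<or> f0 n \<in> set ns \<and> f1 n \<in> set ns \<and> nm (f0 n) \<le> nm (f1 n))"

lemma gname_mk_gate [simp]: "gname (mk_gate n) = nm n"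
  by (simp add: mk_gate_def gname_def)

lemma valid_gates_topo: "topo ns \<Longrightarrow> valid_gates {ODiv} (map mk_gate ns)"
proof (induction ns)
  case (Cons n ns)
  have "set (gpreds (mk_gate n)) \<subseteq> nm ` set ns" "shape_ok {ODiv} (glabel (mk_gate n)) (gpreds (mk_gate n))"
    using Cons.prems by (auto simp: mk_gate_def gpreds_def glabel_def shape_ok_def)
  moreover have "gname ` set (map mk_gate ns) = nm ` set ns" by (simp add: image_image)
  ultimately show ?case using Cons by simp
qed simp

text \<open>Any predicate that obeys the recursion of conjunctions is the one computed: the
  predecessors of a gate stand later in the list, so the induction hypothesis covers both.\<close>

lemma sem_topo:
  assumes "topo ns" "n \<in> set ns"
    and "\<And>n. n \<in> set ns \<Longrightarrow> good n \<longleftrightarrow> (if leaf n then \<not> bad n else good (f0 n) \<and> good (f1 n))"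
  shows "sem (map mk_gate ns) (nm n) \<subseteq> {0,1} \<and> (1 \<in> sem (map mk_gate ns) (nm n) \<longleftrightarrow> good n)"
  using assms
proof (induction ns arbitrary: n)
  case (Cons m ns)
  let ?I = "sem (map mk_gate ns)"
  have IH: "?I (nm n) \<subseteq> {0,1} \<and> (1 \<in> ?I (nm n) \<longleftrightarrow> good n)" if "n \<in> set ns" for n
    using Cons.prems Cons.IH that by simp
  show ?case
  proof (cases "n = m")
    case False
    then have n: "n \<in> set ns" using Cons.prems by simp
    then have "nm n \<noteq> nm m" using Cons.prems(1) by (auto simp: image_iff)
    then show ?thesis using IH[OF n] by (simp add: Let_def)
  next
    case True
    have e: "sem (map mk_gate (m # ns)) (nm n) = gate_val (mk_gate m) ?I"
      using True by (simp add: Let_def)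
    have g: "good m \<longleftrightarrow> (if leaf m then \<not> bad m else good (f0 m) \<and> good (f1 m))"
      using Cons.prems(3)[of m] by simp
    show ?thesis
    proof (cases "leaf m")
      case leaf: True
      then show ?thesis unfolding e using g True by (simp add: gate_val_def mk_gate_def glabel_def)
    next
      case nl: False
      then have "f0 m \<in> set ns" "f1 m \<in> set ns" using Cons.prems(1) by auto
      moreover have "gate_val (mk_gate m) ?I = ndiv (?I (nm (f0 m))) (?I (nm (f1 m)))"
        using nl by (simp add: gate_val_def mk_gate_def glabel_def gpreds_def)
      ultimately show ?thesis unfolding e using ndiv_01 IH g nl True by simp
    qed
  qed
qed simp

end

section \<open>Inductive counting\<close>

text \<open>\<open>VD\<close> is the current distance \<open>d\<close> and \<open>VC\<close> the number of vertices at distance at most \<open>d\<close>. The vertices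
  \<open>VV\<close> are tested one after the other for distance at most \<open>d + 1\<close>, and \<open>VE\<close> counts those that pass. A test
  scans all vertices \<open>VU\<close>; for \<open>VM\<close> of them a walk from the start of length at most \<open>d\<close> has been guessed,
  where \<open>VX\<close> and \<open>VL\<close> are the end and the length of the walk being guessed.\<close>
datatype var = VD | VC | VV | VE | VU | VM | VX | VL

text \<open>\<open>CB\<close> decides whether a walk to \<open>VU\<close> is guessed,
  \<open>CW f i\<close> whether its next edge has number \<open>i\<close> or a larger one,
  \<open>CS\<close> takes the edge, \<open>CC\<close> checks that the walk ended in
  \<open>VU\<close>, \<open>CD\<close> advances \<open>VU\<close>, \<open>CE\<close> compares
  \<open>VM\<close> with \<open>VC\<close>, and \<open>CF\<close> advances \<open>VV\<close> or else
  the distance. The flag \<open>f\<close> records whether some vertex found so far shows that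
  \<open>VV\<close> is in the next level.\<close>

datatype ctrl = CI | CA | CB bool | CW bool nat | CS bool nat | CC bool | CD bool | CE bool | CF | CAcc | CDead

locale counting =
  fixes W r :: nat and sc :: "nat \<Rightarrow> nat \<Rightarrow> nat" and s0 :: nat and accv :: "nat \<Rightarrow> bool"
begin

text \<open>The first argument of \<open>istep\<close> is the nondeterministic choice.\<close>
fun istep :: "bool \<Rightarrow> ctrl \<times> (var \<Rightarrow> nat) \<Rightarrow> ctrl \<times> (var \<Rightarrow> nat)" where
  "istep b (CI, \<eta>) = (CA, \<eta>(VC := (\<eta> VC + 1) mod W))"
| "istep b (CA, \<eta>) = (CB False, \<eta>(VU := 0, VM := 0))"
| "istep b (CB f, \<eta>) = (if b then (CW f 0, \<eta>(VX := s0, VL := 0)) else (CD f, \<eta>))"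
| "istep b (CW f i, \<eta>) = (if i < r then (if b then (CW f (i + 1), \<eta>) else (CS f i, \<eta>)) else (CC f, \<eta>))"
| "istep b (CS f i, \<eta>) = (if \<eta> VL = \<eta> VD then (CDead, \<eta>)
     else (CW f 0, \<eta>(VX := sc i (\<eta> VX), VL := (\<eta> VL + 1) mod W)))"
| "istep b (CC f, \<eta>) = (if \<eta> VX = \<eta> VU
     then (CD (f \<or> \<eta> VU = \<eta> VV \<or> (\<exists>i<r. sc i (\<eta> VU) = \<eta> VV)), \<eta>(VM := (\<eta> VM + 1) mod W, VX := 0))
     else (CDead, \<eta>))"
| "istep b (CD f, \<eta>) = (if \<eta> VU + 1 = W then (CE f, \<eta>(VU := 0)) else (CB f, \<eta>(VU := \<eta> VU + 1)))"
| "istep b (CE f, \<eta>) = (if \<eta> VM \<noteq> \<eta> VC then (CDead, \<eta>)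
     else if f then (if accv (\<eta> VV) then (CDead, \<eta>(VX := 0)) else (CF, \<eta>(VE := (\<eta> VE + 1) mod W, VX := 0)))
     else (CF, \<eta>))"
| "istep b (CF, \<eta>) = (if \<eta> VV + 1 = W
     then (if \<eta> VD + 1 = W then (CAcc, \<eta>(VV := 0, VD := 0))
       else (CA, \<eta>(VV := 0, VD := \<eta> VD + 1, VC := \<eta> VE, VE := 0)))
     else (CA, \<eta>(VV := \<eta> VV + 1)))"
| "istep b (CAcc, \<eta>) = (CAcc, \<eta>)"
| "istep b (CDead, \<eta>) = (CDead, \<eta>)"

fun lev :: "nat \<Rightarrow> nat set" where
  "lev 0 = {s0}"
| "lev (Suc d) = lev d \<union> {sc i x | i x. i < r \<and> x \<in> lev d}"

definition irel :: "(ctrl \<times> (var \<Rightarrow> nat)) rel" where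
  "irel = {(n, istep b n) | n b. True}"

lemma irel_step: "(istep b n, m) \<in> irel\<^sup>* \<Longrightarrow> (n, m) \<in> irel\<^sup>*"
  by (rule converse_rtrancl_into_rtrancl[of n "istep b n"]) (unfold irel_def, blast, assumption)

text \<open>The form in which \<open>CC\<close> tests membership in the next level, looking forward
  from a vertex of the present one.\<close>

lemma lev_Suc_iff: "v \<in> lev (Suc d) \<longleftrightarrow> (\<exists>u\<in>lev d. u = v \<or> (\<exists>i<r. sc i u = v))"
proof
  assume "v \<in> lev (Suc d)"
  then consider "v \<in> lev d" | i x where "i < r" "x \<in> lev d" "v = sc i x" by auto
  then show "\<exists>u\<in>lev d. u = v \<or> (\<exists>i<r. sc i u = v)" by cases blast+
qed auto

lemma lev_mono: "d \<le> e \<Longrightarrow> lev d \<subseteq> lev e"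
  by (induction rule: dec_induct) auto

end

text \<open>As 0 is no code, each level is a subset of \<open>{1..<W}\<close>; hence its cardinality
  is below \<open>W\<close> too and fits into a variable.\<close>

locale counting_ok = counting +
  assumes lev_pos: "\<And>d x. x \<in> lev d \<Longrightarrow> 0 < x" and lev_less: "\<And>d x. x \<in> lev d \<Longrightarrow> x < W"
begin

lemma finite_lev: "finite (lev d)"
  using lev_less by (meson finite_lessThan finite_subset lessThan_iff subsetI)

lemma card_lev: "card (lev d) < W"
proof -
  have "lev d \<subseteq> {1..<W}" using lev_pos lev_less by fastforce
  then have "card (lev d) \<le> W - 1" using card_mono[of "{1..<W}" "lev d"] by simp
  moreover have "0 < W" using lev_less[of s0 0] by simp
  ultimately show ?thesis by simp
qed

lemma W_pos: "0 < W" using card_lev[of 0] by simp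

lemma card_lev_sub: "card {x \<in> lev d. P x} < W"
  using card_mono[OF finite_lev[of d], of "{x \<in> lev d. P x}"] card_lev[of d] by auto

text \<open>If all of the first \<open>W\<close> levels grew properly, the last one would have more
  than \<open>W\<close> elements; and a level that does not grow is final. So distance
  \<open>W\<close> captures reachability.\<close>

lemma lev_stable: "lev d \<subseteq> lev W"
proof -
  have "\<exists>d<W. lev (Suc d) = lev d"
  proof (rule ccontr)
    assume n: "\<not> ?thesis"
    have "d \<le> W \<Longrightarrow> d < card (lev d)" for d
    proof (induction d)
      case (Suc d)
      then have "lev (Suc d) \<noteq> lev d" using n by (auto simp del: lev.simps)
      then have "lev d \<subset> lev (Suc d)" using lev_mono[of d "Suc d"] by (simp del: lev.simps add: psubset_eq)
      then show ?case using psubset_card_mono[OF finite_lev[of "Suc d"], of "lev d"] Suc by linarith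
    qed simp
    then show False using card_lev[of W] by (meson less_asym order_refl)
  qed
  then obtain e where e: "e < W" "lev (Suc e) = lev e" by blast
  have "lev (e + k) = lev e" for k
  proof (induction k)
    case (Suc k)
    then show ?case using e(2) by simp
  qed simp
  then show ?thesis using lev_mono[of d "e + d"] lev_mono[of e W] e(1) by simp
qed

text \<open>The part of the invariant common to all control states: \<open>VC\<close> counts the level \<open>VD\<close>,
  \<open>VE\<close> counts the elements of the next level that satisfy \<open>P\<close> (those scanned so far).\<close>
definition base :: "(var \<Rightarrow> nat) \<Rightarrow> (nat \<Rightarrow> bool) \<Rightarrow> bool" where
  "base \<eta> P \<longleftrightarrow> \<eta> VD < W \<and> \<eta> VC = card (lev (\<eta> VD)) \<and> \<eta> VV < W \<and>
     \<eta> VE = card {x \<in> lev (Suc (\<eta> VD)). P x} \<and> (\<forall>x\<in>lev (Suc (\<eta> VD)). P x \<longrightarrow> \<not> accv x)"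

text \<open>\<open>VM\<close> elements of the level \<open>VD\<close> satisfying \<open>P\<close> have been found; \<open>f\<close> tells whether one of
  them witnesses that \<open>VV\<close> is in the next level.\<close>
definition found :: "(var \<Rightarrow> nat) \<Rightarrow> bool \<Rightarrow> (nat \<Rightarrow> bool) \<Rightarrow> bool" where
  "found \<eta> f P \<longleftrightarrow> (\<exists>S. S \<subseteq> lev (\<eta> VD) \<and> (\<forall>u\<in>S. P u) \<and> card S = \<eta> VM \<and>
     (f \<longleftrightarrow> (\<exists>u\<in>S. u = \<eta> VV \<or> (\<exists>i<r. sc i u = \<eta> VV))))"

text \<open>Nothing is claimed at \<open>CDead\<close>: a wrong guess loses the run but never yields
  a wrong verdict.\<close>

fun inv :: "ctrl \<times> (var \<Rightarrow> nat) \<Rightarrow> bool" where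
  "inv (CI, \<eta>) \<longleftrightarrow> \<eta> = (\<lambda>_. 0)"
| "inv (CA, \<eta>) \<longleftrightarrow> base \<eta> (\<lambda>x. x < \<eta> VV)"
| "inv (CB f, \<eta>) \<longleftrightarrow> base \<eta> (\<lambda>x. x < \<eta> VV) \<and> found \<eta> f (\<lambda>u. u < \<eta> VU) \<and> \<eta> VU < W"
| "inv (CW f i, \<eta>) \<longleftrightarrow> base \<eta> (\<lambda>x. x < \<eta> VV) \<and> found \<eta> f (\<lambda>u. u < \<eta> VU) \<and> \<eta> VU < W \<and>
     \<eta> VL \<le> \<eta> VD \<and> \<eta> VX \<in> lev (\<eta> VL)"
| "inv (CS f i, \<eta>) \<longleftrightarrow> base \<eta> (\<lambda>x. x < \<eta> VV) \<and> found \<eta> f (\<lambda>u. u < \<eta> VU) \<and> \<eta> VU < W \<and>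
     \<eta> VL \<le> \<eta> VD \<and> \<eta> VX \<in> lev (\<eta> VL) \<and> i < r"
| "inv (CC f, \<eta>) \<longleftrightarrow> base \<eta> (\<lambda>x. x < \<eta> VV) \<and> found \<eta> f (\<lambda>u. u < \<eta> VU) \<and> \<eta> VU < W \<and>
     \<eta> VL \<le> \<eta> VD \<and> \<eta> VX \<in> lev (\<eta> VL)"
| "inv (CD f, \<eta>) \<longleftrightarrow> base \<eta> (\<lambda>x. x < \<eta> VV) \<and> found \<eta> f (\<lambda>u. u \<le> \<eta> VU) \<and> \<eta> VU < W"
| "inv (CE f, \<eta>) \<longleftrightarrow> base \<eta> (\<lambda>x. x < \<eta> VV) \<and> found \<eta> f (\<lambda>u. True)"
| "inv (CF, \<eta>) \<longleftrightarrow> base \<eta> (\<lambda>x. x \<le> \<eta> VV)"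
| "inv (CAcc, \<eta>) \<longleftrightarrow> (\<forall>x\<in>lev W. \<not> accv x)"
| "inv (CDead, \<eta>) \<longleftrightarrow> True"

section \<open>Soundness of the counting procedure\<close>

lemma found_mono: "found \<eta> f P \<Longrightarrow> (\<And>u. u \<in> lev (\<eta> VD) \<Longrightarrow> P u \<Longrightarrow> Q u) \<Longrightarrow> found \<eta> f Q"
  unfolding found_def by blast

lemma found_cong: "\<eta> VD = \<eta>' VD \<Longrightarrow> \<eta> VM = \<eta>' VM \<Longrightarrow> \<eta> VV = \<eta>' VV \<Longrightarrow> found \<eta> f P = found \<eta>' f P"
  unfolding found_def by simp

lemma base_cong: "\<eta> VD = \<eta>' VD \<Longrightarrow> \<eta> VC = \<eta>' VC \<Longrightarrow> \<eta> VV = \<eta>' VV \<Longrightarrow> \<eta> VE = \<eta>' VE \<Longrightarrow> base \<eta> P = base \<eta>' P"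
  unfolding base_def by simp

lemma lev_Suc_split:
  assumes "v \<in> lev (Suc d)"
  shows "card {x \<in> lev (Suc d). x \<le> v} = Suc (card {x \<in> lev (Suc d). x < v})"
proof -
  have "{x \<in> lev (Suc d). x \<le> v} = insert v {x \<in> lev (Suc d). x < v}" using assms by auto
  then show ?thesis using finite_lev[of "Suc d"] by (simp del: lev.simps)
qed

lemma lev_Suc_split': "v \<notin> lev (Suc d) \<Longrightarrow> {x \<in> lev (Suc d). x \<le> v} = {x \<in> lev (Suc d). x < v}"
  by (auto simp del: lev.simps simp: order_le_less)

lemma inv_istep:
  assumes "inv (p, \<eta>)"
  shows "inv (istep b (p, \<eta>))"
proof (cases p)
  case CI
  then have \<eta>: "\<eta> = (\<lambda>_. 0)" using assms by simp
  \<comment> \<open>Ensures that \<open>1 mod W\<close> is 1, the size of level 0.\<close>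
  have "1 < W" using lev_pos[of s0 0] lev_less[of s0 0] by simp
  then show ?thesis using CI \<eta> by (simp add: base_def)
next
  case CA
  then show ?thesis using assms W_pos by (auto simp: base_def found_def)
next
  case (CB f)
  have "found \<eta> f (\<lambda>u. u < \<eta> VU) \<Longrightarrow> found \<eta> f (\<lambda>u. u \<le> \<eta> VU)" by (erule found_mono) simp
  then show ?thesis using CB assms
    by (auto simp: base_cong[of "\<eta>(VX := s0, VL := 0)" \<eta>] found_cong[of "\<eta>(VX := s0, VL := 0)" \<eta>])
next
  case (CW f i)
  then show ?thesis using assms by auto
next
  case (CS f i)
  show ?thesis
  proof (cases "\<eta> VL = \<eta> VD")
    case False
    then have "\<eta> VL + 1 \<le> \<eta> VD" "\<eta> VD < W" using assms CS by (auto simp: base_def)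
    moreover have "sc i (\<eta> VX) \<in> lev (Suc (\<eta> VL))" using assms CS by auto
    ultimately show ?thesis using assms CS False
      by (auto simp: base_cong[of "\<eta>(VX := _, VL := _)" \<eta>] found_cong[of "\<eta>(VX := _, VL := _)" \<eta>] simp del: lev.simps)
  qed (use CS in simp)
next
  case (CC f)
  show ?thesis
  proof (cases "\<eta> VX = \<eta> VU")
    case True
    let ?f = "f \<or> \<eta> VU = \<eta> VV \<or> (\<exists>i<r. sc i (\<eta> VU) = \<eta> VV)"
    let ?\<eta> = "\<eta>(VM := (\<eta> VM + 1) mod W, VX := 0)"
    have u: "\<eta> VU \<in> lev (\<eta> VD)" using assms CC True lev_mono[of "\<eta> VL" "\<eta> VD"] by auto
    obtain S where S: "S \<subseteq> lev (\<eta> VD)" "\<forall>u\<in>S. u < \<eta> VU" "card S = \<eta> VM"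
      "f \<longleftrightarrow> (\<exists>u\<in>S. u = \<eta> VV \<or> (\<exists>i<r. sc i u = \<eta> VV))" using assms CC by (auto simp: found_def)
    have fin: "finite S" using S(1) finite_lev finite_subset by blast
    have sub: "insert (\<eta> VU) S \<subseteq> lev (\<eta> VD)" using u S by auto
    \<comment> \<open>The scan proceeds upwards in \<open>VU\<close>, so no vertex is counted twice
      and \<open>VM\<close> is the size of a set.\<close>
    have "\<eta> VU \<notin> S" using S(2) by blast
    then have c: "card (insert (\<eta> VU) S) = \<eta> VM + 1" using S(3) fin by simp
    then have "\<eta> VM + 1 < W" using card_mono[OF finite_lev sub] card_lev[of "\<eta> VD"] by linarith
    then have "found ?\<eta> ?f (\<lambda>u. u \<le> ?\<eta> VU)"
      unfolding found_def
    proof (intro exI[of _ "insert (\<eta> VU) S"] conjI)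
      show "insert (\<eta> VU) S \<subseteq> lev (?\<eta> VD)" using sub by simp
      show "\<forall>u\<in>insert (\<eta> VU) S. u \<le> ?\<eta> VU" using S(2) by auto
      show "card (insert (\<eta> VU) S) = ?\<eta> VM" using c \<open>\<eta> VM + 1 < W\<close> by simp
      show "?f \<longleftrightarrow> (\<exists>u\<in>insert (\<eta> VU) S. u = ?\<eta> VV \<or> (\<exists>i<r. sc i u = ?\<eta> VV))"
        using S(4) by auto
    qed
    moreover have "base ?\<eta> (\<lambda>x. x < ?\<eta> VV) = base \<eta> (\<lambda>x. x < \<eta> VV)" unfolding base_def by simp
    ultimately show ?thesis using CC assms True by auto
  qed (use CC in simp)
next
  case (CD f)
  show ?thesis
  proof (cases "\<eta> VU + 1 = W")
    case True
    have "found \<eta> f (\<lambda>u. True)" using CD assms by (auto intro: found_mono)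
    then show ?thesis using CD assms True
      by (auto simp: base_cong[of "\<eta>(VU := _)" \<eta>] found_cong[of "\<eta>(VU := _)" \<eta>])
  next
    case False
    have "found \<eta> f (\<lambda>u. u < \<eta> VU + 1)" using CD assms by (auto intro: found_mono)
    then show ?thesis using CD assms False
      by (auto simp: base_cong[of "\<eta>(VU := _)" \<eta>] found_cong[of "\<eta>(VU := _)" \<eta>])
  qed
next
  case (CE f)
  show ?thesis
  proof (cases "\<eta> VM = \<eta> VC")
    case True
    let ?d = "\<eta> VD" and ?v = "\<eta> VV"
    have b: "base \<eta> (\<lambda>x. x < ?v)" using assms CE by simp
    obtain S where S: "S \<subseteq> lev ?d" "card S = \<eta> VM"
      "f \<longleftrightarrow> (\<exists>u\<in>S. u = ?v \<or> (\<exists>i<r. sc i u = ?v))" using assms CE by (auto simp: found_def)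
    \<comment> \<open>The heart of inductive counting: a subset of the level that has as many
      elements as the level is the whole level, so the absence of a witness proves
      non-membership.\<close>
    have "S = lev ?d" using card_subset_eq[OF finite_lev S(1)] S(2) True b by (simp add: base_def)
    then have f: "f \<longleftrightarrow> ?v \<in> lev (Suc ?d)" using S(3) by (simp only: lev_Suc_iff)
    show ?thesis
    proof (cases f)
      case f1: True
      have "card {x \<in> lev (Suc ?d). x \<le> ?v} < W" using card_lev_sub .
      then have "(\<eta> VE + 1) mod W = card {x \<in> lev (Suc ?d). x \<le> ?v}"
        using lev_Suc_split[of ?v ?d] f f1 b by (simp add: base_def del: lev.simps)
      moreover have "\<forall>x\<in>lev (Suc ?d). x \<le> ?v \<longrightarrow> \<not> accv x" if "\<not> accv ?v"
        using b that by (auto simp: base_def order_le_less simp del: lev.simps)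
      ultimately show ?thesis using CE True f1 b by (simp add: base_def del: lev.simps)
    next
      case f2: False
      then have "{x \<in> lev (Suc ?d). x \<le> ?v} = {x \<in> lev (Suc ?d). x < ?v}"
        using f lev_Suc_split' by blast
      moreover have "\<forall>x\<in>lev (Suc ?d). x \<le> ?v \<longrightarrow> \<not> accv x"
        using b f f2 by (auto simp: base_def order_le_less simp del: lev.simps)
      ultimately show ?thesis using CE True f2 b by (simp add: base_def del: lev.simps)
    qed
  qed (use CE in simp)
next
  case CF
  have b: "base \<eta> (\<lambda>x. x \<le> \<eta> VV)" using assms CF by simp
  show ?thesis
  proof (cases "\<eta> VV + 1 = W")
    case True
    \<comment> \<open>All vertices are below \<open>W\<close>; at the last \<open>VV\<close> the
      scanned part is the entire next level, so that \<open>VE\<close> may become the new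
      \<open>VC\<close>.\<close>
    have all: "x \<le> \<eta> VV" if "x \<in> lev (Suc (\<eta> VD))" for x using lev_less[OF that] True by linarith
    then have "{x \<in> lev (Suc (\<eta> VD)). x \<le> \<eta> VV} = lev (Suc (\<eta> VD))" by blast
    then have e: "\<eta> VE = card (lev (Suc (\<eta> VD)))" "\<forall>x\<in>lev (Suc (\<eta> VD)). \<not> accv x"
      using b all by (auto simp: base_def simp del: lev.simps)
    show ?thesis
    proof (cases "\<eta> VD + 1 = W")
      case d: True
      then have "\<forall>x\<in>lev W. \<not> accv x" using e(2) by (simp del: lev.simps)
      then show ?thesis using CF True d by simp
    next
      case False
      then show ?thesis using CF True e b by (auto simp: base_def simp del: lev.simps)
    qed
  next
    case False
    have "base (\<eta>(VV := \<eta> VV + 1)) (\<lambda>x. x < \<eta> VV + 1)"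
      using b False by (auto simp: base_def less_Suc_eq_le simp del: lev.simps)
    then show ?thesis using CF False by simp
  qed
qed (use assms in auto)

lemma acc_sound:
  assumes "((CI, \<lambda>_. 0), (CAcc, \<eta>)) \<in> irel\<^sup>*"
  shows "\<forall>x\<in>lev d. \<not> accv x"
proof -
  have "inv m" if "((CI, \<lambda>_. 0), m) \<in> irel\<^sup>*" for m
    using that
  proof (induction rule: rtrancl_induct)
    case (step y z)
    then obtain b where "z = istep b y" by (auto simp: irel_def)
    then show ?case using inv_istep[of "fst y" "snd y" b] step by simp
  qed simp
  from this[OF assms] show ?thesis using lev_stable[of d] by auto
qed

section \<open>Completeness of the counting procedure\<close>

lemma walk_chain:
  assumes "i \<le> r" "((CW f i, \<eta>), m) \<in> irel\<^sup>*"
  shows "((CW f 0, \<eta>), m) \<in> irel\<^sup>*"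
  using assms
proof (induction i)
  case (Suc i)
  \<comment> \<open>The answer \<open>True\<close> in \<open>CW f i\<close> passes on to edge
    \<open>i + 1\<close>, so the binary choice selects edge \<open>i\<close> by \<open>i\<close>
    such answers.\<close>
  show ?case by (rule Suc.IH) (use Suc.prems irel_step[of True "(CW f i, \<eta>)" m] in auto)
qed simp

text \<open>Levels are cumulative, so a vertex of \<open>lev n\<close> may be the end of a shorter
  walk; hence only some \<open>n' \<le> n\<close> is claimed.\<close>

lemma walk:
  assumes "n \<le> \<eta> VD" "\<eta> VD < W" "x \<in> lev n" "\<eta> VX = s0" "\<eta> VL = 0"
  shows "\<exists>n'\<le>n. ((CW f 0, \<eta>), (CW f 0, \<eta>(VX := x, VL := n'))) \<in> irel\<^sup>*"
  using assms
proof (induction n arbitrary: x)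
  case 0
  then have "\<eta>(VX := x, VL := 0) = \<eta>" by auto
  then show ?case by (metis le_refl rtrancl.rtrancl_refl)
next
  case (Suc n)
  show ?case
  proof (cases "x \<in> lev n")
    case True
    then show ?thesis using Suc.IH[of x] Suc.prems le_Suc_eq by auto
  next
    case False
    then obtain i y where y: "i < r" "y \<in> lev n" "x = sc i y" using Suc.prems by auto
    obtain n' where n': "n' \<le> n" "((CW f 0, \<eta>), (CW f 0, \<eta>(VX := y, VL := n'))) \<in> irel\<^sup>*"
      using Suc.IH[OF _ Suc.prems(2) y(2) Suc.prems(4,5)] Suc.prems(1) by (metis Suc_leD)
    let ?\<eta> = "\<eta>(VX := y, VL := n')"
    have "istep b (CS f i, ?\<eta>) = (CW f 0, \<eta>(VX := x, VL := Suc n'))" for b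
      using y n' Suc.prems by (auto simp: fun_eq_iff)
    then have "((CS f i, ?\<eta>), (CW f 0, \<eta>(VX := x, VL := Suc n'))) \<in> irel\<^sup>*"
      by - (rule irel_step[of True], simp)
    then have "((CW f i, ?\<eta>), (CW f 0, \<eta>(VX := x, VL := Suc n'))) \<in> irel\<^sup>*"
      using y  by - (rule irel_step[of False], simp)
    then have "((CW f 0, ?\<eta>), (CW f 0, \<eta>(VX := x, VL := Suc n'))) \<in> irel\<^sup>*"
      using y  by - (rule walk_chain[of i], auto)
    with n'(2) have "((CW f 0, \<eta>), (CW f 0, \<eta>(VX := x, VL := Suc n'))) \<in> irel\<^sup>*" by (rule rtrancl_trans)
    then show ?thesis using n'(1) by (meson Suc_le_mono)
  qed
qed

definition keep :: "(var \<Rightarrow> nat) \<Rightarrow> (var \<Rightarrow> nat) \<Rightarrow> bool" where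
  "keep \<eta> \<eta>' \<longleftrightarrow> \<eta>' VD = \<eta> VD \<and> \<eta>' VC = \<eta> VC \<and> \<eta>' VV = \<eta> VV \<and> \<eta>' VE = \<eta> VE"

definition wit :: "(var \<Rightarrow> nat) \<Rightarrow> nat \<Rightarrow> bool" where
  "wit \<eta> u \<longleftrightarrow> u \<in> lev (\<eta> VD) \<and> (u = \<eta> VV \<or> (\<exists>i<r. sc i u = \<eta> VV))"

text \<open>The favourable guesses: a walk is attempted exactly for the members of the level. All of
  them are counted then, and the comparison in \<open>CE\<close> will succeed.\<close>

lemma scan_one:
  assumes "\<eta> VD < W" "\<eta> VU < W" "\<eta> VM = card {u \<in> lev (\<eta> VD). u < \<eta> VU}"
    "f \<longleftrightarrow> (\<exists>u<\<eta> VU. wit \<eta> u)"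
  shows "\<exists>\<eta>'. keep \<eta> \<eta>' \<and> \<eta>' VU = \<eta> VU \<and> \<eta>' VM = card {u \<in> lev (\<eta> VD). u \<le> \<eta> VU} \<and>
    ((CB f, \<eta>), (CD (\<exists>u\<le>\<eta> VU. wit \<eta> u), \<eta>')) \<in> irel\<^sup>*"
proof (cases "\<eta> VU \<in> lev (\<eta> VD)")
  case True
  let ?u = "\<eta> VU" and ?d = "\<eta> VD"
  let ?\<eta>1 = "\<eta>(VX := s0, VL := 0)"
  obtain n where n: "n \<le> ?d" "((CW f 0, ?\<eta>1), (CW f 0, ?\<eta>1(VX := ?u, VL := n))) \<in> irel\<^sup>*"
    using walk[of ?d ?\<eta>1 ?u f] assms True by auto
  let ?\<eta>2 = "?\<eta>1(VX := ?u, VL := n)"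
  let ?\<eta>3 = "?\<eta>2(VM := (\<eta> VM + 1) mod W, VX := 0)"
  let ?f = "\<exists>u\<le>?u. wit \<eta> u"
  have "?f \<longleftrightarrow> f \<or> wit \<eta> ?u" using assms(4) by (auto simp: order_le_less)
  then have "istep b (CC f, ?\<eta>2) = (CD ?f, ?\<eta>3)" for b using True by (simp add: wit_def)
  then have "((CC f, ?\<eta>2), (CD ?f, ?\<eta>3)) \<in> irel\<^sup>*" by - (rule irel_step[of True], simp del: istep.simps)
  then have "((CW f r, ?\<eta>2), (CD ?f, ?\<eta>3)) \<in> irel\<^sup>*" by - (rule irel_step[of True], simp)
  then have "((CW f 0, ?\<eta>2), (CD ?f, ?\<eta>3)) \<in> irel\<^sup>*" by - (rule walk_chain[of r], simp)
  with n have "((CW f 0, ?\<eta>1), (CD ?f, ?\<eta>3)) \<in> irel\<^sup>*" by (meson rtrancl_trans)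
  then have p: "((CB f, \<eta>), (CD ?f, ?\<eta>3)) \<in> irel\<^sup>*" by - (rule irel_step[of True], simp)
  have "{u \<in> lev ?d. u \<le> ?u} = insert ?u {u \<in> lev ?d. u < ?u}" using True by auto
  then have "card {u \<in> lev ?d. u \<le> ?u} = Suc (\<eta> VM)" using finite_lev assms(3) by simp
  moreover have "card {u \<in> lev ?d. u \<le> ?u} < W" by (rule card_lev_sub)
  ultimately have "?\<eta>3 VM = card {u \<in> lev ?d. u \<le> ?u}" by simp
  then show ?thesis using p by (intro exI[of _ ?\<eta>3]) (simp add: keep_def)
next
  case False
  then have "{u \<in> lev (\<eta> VD). u \<le> \<eta> VU} = {u \<in> lev (\<eta> VD). u < \<eta> VU}"
    "(\<exists>u\<le>\<eta> VU. wit \<eta> u) = f" using assms by (auto simp: order_le_less wit_def)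
  moreover have "((CB f, \<eta>), (CD f, \<eta>)) \<in> irel\<^sup>*" by (rule irel_step[of False]) simp
  ultimately show ?thesis using assms by (intro exI[of _ \<eta>]) (simp add: keep_def)
qed

lemma scan:
  assumes "\<eta> VD < W" "\<eta> VU < W" "\<eta> VM = card {u \<in> lev (\<eta> VD). u < \<eta> VU}"
    "f \<longleftrightarrow> (\<exists>u<\<eta> VU. wit \<eta> u)"
  shows "\<exists>\<eta>'. keep \<eta> \<eta>' \<and> \<eta>' VM = card (lev (\<eta> VD)) \<and>
    ((CB f, \<eta>), (CE (\<eta> VV \<in> lev (Suc (\<eta> VD))), \<eta>')) \<in> irel\<^sup>*"
  using assms
proof (induction "W - \<eta> VU" arbitrary: \<eta> f)
  case (Suc k)
  obtain \<eta>1 where 1: "keep \<eta> \<eta>1" "\<eta>1 VU = \<eta> VU" "\<eta>1 VM = card {u \<in> lev (\<eta> VD). u \<le> \<eta> VU}"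
    "((CB f, \<eta>), (CD (\<exists>u\<le>\<eta> VU. wit \<eta> u), \<eta>1)) \<in> irel\<^sup>*" using scan_one[OF Suc.prems] by blast
  show ?case
  proof (cases "\<eta> VU + 1 = W")
    case True
    have all: "u \<le> \<eta> VU" if "u \<in> lev (\<eta> VD)" for u using lev_less[OF that] True by linarith
    then have "{u \<in> lev (\<eta> VD). u \<le> \<eta> VU} = lev (\<eta> VD)" by blast
    moreover have "(\<exists>u\<le>\<eta> VU. wit \<eta> u) \<longleftrightarrow> (\<exists>u. wit \<eta> u)" using all by (auto simp: wit_def)
    moreover have "\<dots> \<longleftrightarrow> \<eta> VV \<in> lev (Suc (\<eta> VD))" unfolding lev_Suc_iff wit_def by blast
    moreover have "((CD f', \<eta>1), (CE f', \<eta>1(VU := 0))) \<in> irel\<^sup>*" for f'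
      using True 1  by - (rule irel_step[of True], simp)
    ultimately show ?thesis using 1 by (intro exI[of _ "\<eta>1(VU := 0)"])
      (auto simp: keep_def simp del: lev.simps intro: rtrancl_trans)
  next
    case False
    let ?\<eta>2 = "\<eta>1(VU := \<eta> VU + 1)"
    let ?f = "\<exists>u\<le>\<eta> VU. wit \<eta> u"
    have k: "keep \<eta> ?\<eta>2" using 1 by (simp add: keep_def)
    then have w: "wit ?\<eta>2 = wit \<eta>" by (auto simp: wit_def keep_def fun_eq_iff)
    have "\<exists>\<eta>'. keep ?\<eta>2 \<eta>' \<and> \<eta>' VM = card (lev (?\<eta>2 VD)) \<and>
      ((CB ?f, ?\<eta>2), (CE (?\<eta>2 VV \<in> lev (Suc (?\<eta>2 VD))), \<eta>')) \<in> irel\<^sup>*"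
      by (rule Suc.hyps(1)) (use Suc.hyps(2) Suc.prems False 1 k w in \<open>auto simp: keep_def less_Suc_eq_le\<close>)
    then obtain \<eta>' where 2: "keep ?\<eta>2 \<eta>'" "\<eta>' VM = card (lev (\<eta> VD))"
      "((CB ?f, ?\<eta>2), (CE (\<eta> VV \<in> lev (Suc (\<eta> VD))), \<eta>')) \<in> irel\<^sup>*"
      using k by (auto simp: keep_def simp del: lev.simps)
    have "((CD ?f, \<eta>1), (CE (\<eta> VV \<in> lev (Suc (\<eta> VD))), \<eta>')) \<in> irel\<^sup>*"
      using 2 1 False by - (rule irel_step[of True "(CD ?f, \<eta>1)"], simp del: lev.simps)
    then show ?thesis using 1 2 k by (intro exI[of _ \<eta>'])
      (auto simp: keep_def simp del: lev.simps intro: rtrancl_trans)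
  qed
qed simp

lemma scan_vertex:
  assumes "inv (CA, \<eta>)" "\<And>x d. x \<in> lev d \<Longrightarrow> \<not> accv x"
  shows "\<exists>\<eta>'. inv (CF, \<eta>') \<and> \<eta>' VD = \<eta> VD \<and> \<eta>' VV = \<eta> VV \<and> ((CA, \<eta>), (CF, \<eta>')) \<in> irel\<^sup>*"
proof -
  let ?\<eta>1 = "\<eta>(VU := 0, VM := 0)" and ?f = "\<eta> VV \<in> lev (Suc (\<eta> VD))"
  have b: "base \<eta> (\<lambda>x. x < \<eta> VV)" using assms by simp
  obtain \<eta>2 where 2: "keep ?\<eta>1 \<eta>2" "\<eta>2 VM = card (lev (\<eta> VD))" "((CB False, ?\<eta>1), (CE ?f, \<eta>2)) \<in> irel\<^sup>*"
    using scan[of ?\<eta>1 False] b W_pos by (auto simp: base_def simp del: lev.simps)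
  have p: "((CA, \<eta>), (CE ?f, \<eta>2)) \<in> irel\<^sup>*"
    using 2 by - (rule irel_step[of True "(CA, \<eta>)"], simp del: lev.simps)
  let ?n = "istep True (CE ?f, \<eta>2)"
  have s: "((CE ?f, \<eta>2), ?n) \<in> irel\<^sup>*" by (rule irel_step[of True]) simp
  have i: "inv (CE ?f, \<eta>2)"
  proof -
    have "base \<eta>2 (\<lambda>x. x < \<eta>2 VV)" using b 2(1) by (auto simp: base_def keep_def simp del: lev.simps)
    moreover have "found \<eta>2 ?f (\<lambda>_. True)"
      unfolding found_def
    proof (intro exI[of _ "lev (\<eta> VD)"] conjI)
      show "?f \<longleftrightarrow> (\<exists>u\<in>lev (\<eta> VD). u = \<eta>2 VV \<or> (\<exists>i<r. sc i u = \<eta>2 VV))"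
        using 2(1) by (simp only: keep_def lev_Suc_iff fun_upd_apply) simp
    qed (use 2 in \<open>auto simp: keep_def\<close>)
    ultimately show ?thesis by simp
  qed
  have "inv ?n" using inv_istep[OF i] .
  \<comment> \<open>\<open>CE\<close> does not lead to \<open>CDead\<close> here: the count is
    complete, and no vertex of any level is accepting.\<close>
  moreover have "fst ?n = CF \<and> snd ?n VD = \<eta> VD \<and> snd ?n VV = \<eta> VV"
    using 2 b assms(2)[of "\<eta> VV" "Suc (\<eta> VD)"] by (auto simp: keep_def base_def simp del: lev.simps)
  ultimately show ?thesis using p s by (intro exI[of _ "snd ?n"]) (metis prod.collapse rtrancl_trans)
qed

lemma acc_complete:
  assumes "\<And>x d. x \<in> lev d \<Longrightarrow> \<not> accv x"
  shows "\<exists>\<eta>. ((CI, \<lambda>_. 0), (CAcc, \<eta>)) \<in> irel\<^sup>*"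
proof -
  have loop: "\<exists>\<eta>'. ((CA, \<eta>), (CAcc, \<eta>')) \<in> irel\<^sup>*" if "inv (CA, \<eta>)" for \<eta>
    using that
  \<comment> \<open>A lexicographic measure, distance before vertex: advancing the distance gains
    \<open>W + 1\<close>, while resetting the vertex costs less than \<open>W\<close>.\<close>
  proof (induction "(W - \<eta> VD) * (W + 1) + (W - \<eta> VV)" arbitrary: \<eta> rule: less_induct)
    case less
    obtain \<eta>1 where 1: "inv (CF, \<eta>1)" "\<eta>1 VD = \<eta> VD" "\<eta>1 VV = \<eta> VV" "((CA, \<eta>), (CF, \<eta>1)) \<in> irel\<^sup>*"
      using scan_vertex[of \<eta>] less.prems assms by blast
    let ?n = "istep True (CF, \<eta>1)"
    have i: "inv ?n" using inv_istep[OF 1(1)] .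
    have p: "((CA, \<eta>), ?n) \<in> irel\<^sup>*" using 1(4) irel_step[of True "(CF, \<eta>1)" ?n] by (meson rtrancl.rtrancl_refl rtrancl_trans)
    have lt: "\<eta> VD < W" "\<eta> VV < W" using less.prems by (auto simp: base_def)
    show ?case
    proof (cases "fst ?n = CAcc")
      case True
      then show ?thesis using p by (metis prod.collapse)
    next
      case False
      then have n: "?n = (CA, snd ?n)" by auto
      have "(W - snd ?n VD) * (W + 1) + (W - snd ?n VV) < (W - \<eta> VD) * (W + 1) + (W - \<eta> VV)"
      proof (cases "\<eta> VV + 1 = W")
        case True
        then have "snd ?n VD = \<eta> VD + 1" "snd ?n VV = 0" using False 1 by (auto split: if_splits)
        moreover have "W - \<eta> VD = Suc (W - (\<eta> VD + 1))" using lt by simp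
        ultimately show ?thesis using lt by simp
      next
        case False
        then have "snd ?n VD = \<eta> VD" "snd ?n VV = \<eta> VV + 1" using 1 by auto
        then show ?thesis using lt by simp
      qed
      then obtain \<eta>' where "((CA, snd ?n), (CAcc, \<eta>')) \<in> irel\<^sup>*" using less.hyps[of "snd ?n"] i n by metis
      then show ?thesis using p n by (metis rtrancl_trans)
    qed
  qed
  let ?n = "istep True (CI, \<lambda>_. 0)"
  have "inv ?n" by (rule inv_istep) simp
  then obtain \<eta> where "(?n, (CAcc, \<eta>)) \<in> irel\<^sup>*" using loop[of "snd ?n"] by auto
  then show ?thesis using irel_step by blast
qed

theorem acc_reachable_iff:
  "(\<exists>\<eta>. ((CI, \<lambda>_. 0), (CAcc, \<eta>)) \<in> irel\<^sup>*) \<longleftrightarrow> (\<forall>d. \<forall>x\<in>lev d. \<not> accv x)"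
  using acc_sound acc_complete by blast

end

section \<open>Simulating machines with arbitrary states and symbols\<close>

type_synonym ('q,'s,'b) gconf = "'q \<times> nat \<times> (nat \<Rightarrow> 's) \<times> nat \<times> 'b list"

text \<open>A step may write a whole list of output symbols, in contrast to the machines of the
  model, and determinism is built into the type.\<close>

fun gstep :: "('q \<Rightarrow> 'a option \<Rightarrow> 's \<Rightarrow> ('q \<times> 's \<times> dir \<times> dir \<times> 'b list) option) \<Rightarrow> 'a list \<Rightarrow>
    ('q,'s,'b) gconf \<Rightarrow> ('q,'s,'b) gconf option" where
  "gstep D w (q,i,t,p,out) = (case D q (read_input w i) (t p) of None \<Rightarrow> None
     | Some (q',s',di,dw,bs) \<Rightarrow>
         Some (q', min (length w + 1) (move di i), t(p := s'), move dw p, out @ bs))"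

fun gpos :: "('q,'s,'b) gconf \<Rightarrow> nat" where "gpos (q,i,t,p,out) = p"
fun gout :: "('q,'s,'b) gconf \<Rightarrow> 'b list" where "gout (q,i,t,p,out) = out"

definition bounded_step where
  "bounded_step D w b c c' \<longleftrightarrow> gstep D w c = Some c' \<and> gpos c \<le> b \<and> gpos c' \<le> b"

text \<open>By determinism all reachable configurations lie on the single halting run, so the space
  bound needs to be checked along this run only.\<close>

lemma deterministic_reachable_bounded:
  assumes det: "deterministic M"
    and path: "(\<lambda>c c'. step M w c c' \<and> P c)\<^sup>*\<^sup>* c0 c" and P: "P c" and h: "halted M w c"
    and reach: "(step M w)\<^sup>*\<^sup>* c0 d"
  shows "P d"
proof -
  have uniq: "step M w x y \<Longrightarrow> step M w x z \<Longrightarrow> y = z" for x y z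
    using det unfolding step_def deterministic_def by (metis Pair_inject)
  from path reach show ?thesis
  proof (induction rule: converse_rtranclp_induct)
    case base
    then show ?case using h P unfolding halted_def
      by (metis converse_rtranclpE)
  next
    case (step x y)
    from step.prems step.hyps(1) show ?case
    proof (cases rule: converse_rtranclpE)
      case base
      then show ?thesis using step.hyps by simp
    next
      case (step z)
      then show ?thesis using uniq step.IH \<open>step M w x y \<and> P x\<close> by metis
    qed
  qed
qed

text \<open>States and symbols are numbered injectively. The part of an output list not yet written
  is kept in the state and emitted symbol by symbol while both heads stay.\<close>

lemma logspace_computable_by_machine:
  fixes D :: "'q \<Rightarrow> 'a::finite option \<Rightarrow> 's \<Rightarrow> ('q \<times> 's \<times> dir \<times> dir \<times> 'b list) option"
  assumes finQ: "finite QS" and finS: "finite SS" and q0: "q0 \<in> QS" and bl: "bl \<in> SS"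
    and closed: "\<And>q a s q' s' di dw bs. q \<in> QS \<Longrightarrow> s \<in> SS \<Longrightarrow> D q a s = Some (q',s',di,dw,bs) \<Longrightarrow>
      q' \<in> QS \<and> s' \<in> SS"
    and run: "\<And>w. \<exists>b c. real b \<le> real k * log 2 (real (length w) + 2) \<and>
       (bounded_step D w b)\<^sup>*\<^sup>* (q0,0,\<lambda>_. bl,0,[]) c \<and> gstep D w c = None \<and> gout c = f w"
  shows "logspace_computable f"
proof -
  define Outs where "Outs = (\<lambda>(q,a,s). case D q a s of None \<Rightarrow> [] | Some (_,_,_,_,bs) \<Rightarrow> bs) ` (QS \<times> UNIV \<times> SS)"
  \<comment> \<open>The possible pending outputs: all suffixes of lists that some step
    writes.\<close>
  define PS where "PS = insert [] (\<Union>bs\<in>Outs. (\<lambda>n. drop n bs) ` {..length bs})"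
  have "finite Outs" unfolding Outs_def using finQ finS by simp
  then have finP: "finite PS" unfolding PS_def by simp
  have tlP: "xs \<in> PS" if "x # xs \<in> PS" for x xs
  proof -
    from that obtain bs n where b: "bs \<in> Outs" "n \<le> length bs" "x # xs = drop n bs" unfolding PS_def by auto
    then have "xs = drop (Suc n) bs" "Suc n \<le> length bs"
      by (metis drop_Suc list.sel(3) tl_drop, metis drop_all not_less_eq_eq b(3) list.distinct(1))
    then show ?thesis using b(1) unfolding PS_def by auto
  qed
  have outP: "bs \<in> PS" if "q \<in> QS" "s \<in> SS" "D q a s = Some (q',s',di,dw,bs)" for q a s q' s' di dw bs
  proof -
    have "bs \<in> Outs" unfolding Outs_def by (rule image_eqI[of _ _ "(q,a,s)"]) (use that in auto)
    then show ?thesis unfolding PS_def by (auto intro!: bexI[of _ bs] image_eqI[of _ _ 0])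
  qed
  obtain eq :: "'q \<times> 'b list \<Rightarrow> nat" where eq: "inj_on eq (QS \<times> PS)"
    using finite_imp_inj_to_nat_seg[of "QS \<times> PS"] finQ finP by auto
  obtain es0 :: "'s \<Rightarrow> nat" where es0: "inj_on es0 SS"
    using finite_imp_inj_to_nat_seg[of SS] finS by auto
  \<comment> \<open>The blank must become 0, the blank of the model; the shift of the other codes
    keeps the numbering injective.\<close>
  define es where "es s = (if s = bl then 0 else Suc (es0 s))" for s
  have es: "inj_on es SS" using es0 unfolding es_def inj_on_def by auto
  have es_bl: "es bl = 0" by (simp add: es_def)
  define delta where "delta n a m = (if n \<in> eq ` (QS \<times> PS) \<and> m \<in> es ` SS then
     (case inv_into (QS \<times> PS) eq n of (q, pd) \<Rightarrow>
       (case pd of x # xs \<Rightarrow> {(eq (q,xs), m, Stay, Stay, Some x)}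
        | [] \<Rightarrow> (case D q a (inv_into SS es m) of None \<Rightarrow> {}
           | Some (q',s',di,dw,bs) \<Rightarrow> {(eq (q',bs), es s', di, dw, None)}))) else {})" for n a m
  define M where "M = \<lparr>tm_start = eq (q0,[]), tm_accept = {}, tm_delta = delta\<rparr>"
  have nilP: "[] \<in> PS" by (simp add: PS_def)
  have d_pend: "delta (eq (q,x#xs)) a (es s) = {(eq (q,xs), es s, Stay, Stay, Some x)}"
    if "q \<in> QS" "x # xs \<in> PS" "s \<in> SS" for q x xs a s
    using that eq es unfolding delta_def by simp
  have d_none: "delta (eq (q,[])) a (es s) = {}"
    if "q \<in> QS" "s \<in> SS" "D q a s = None" for q a s
    using that eq es nilP unfolding delta_def by simp
  have d_some: "delta (eq (q,[])) a (es s) = {(eq (q',bs), es s', di, dw, None)}"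
    if "q \<in> QS" "s \<in> SS" "D q a s = Some (q',s',di,dw,bs)" for q a s q' s' di dw bs
    using that eq es nilP unfolding delta_def by simp
  have det: "deterministic M"
    unfolding deterministic_def M_def delta_def by (auto split: prod.splits list.splits option.splits if_splits)
  have dcases: "\<exists>q pd s. q \<in> QS \<and> pd \<in> PS \<and> s \<in> SS \<and> n = eq (q,pd) \<and> m = es s"
    if "delta n a m \<noteq> {}" for n a m using that unfolding delta_def by (auto split: if_splits)
  have wf: "wf_tm M"
    unfolding wf_tm_def
  proof (intro exI conjI ballI allI impI)
    show "finite (eq ` (QS \<times> PS))" "finite (es ` SS)" using finQ finP finS by auto
    show "tm_start M \<in> eq ` (QS \<times> PS)" using q0 nilP by (simp add: M_def)
    show "0 \<in> es ` SS" using bl es_bl by (metis imageI)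
  next
    fix n a m
    show "finite (tm_delta M n a m)" unfolding M_def delta_def
      by (auto split: prod.splits list.splits option.splits)
    fix z assume z: "z \<in> tm_delta M n a m"
    then have "delta n a m \<noteq> {}" by (auto simp: M_def)
    then obtain q pd s where *: "q \<in> QS" "pd \<in> PS" "s \<in> SS" "n = eq (q,pd)" "m = es s" using dcases by blast
    show "case z of (q', s', di, dw, ot) \<Rightarrow> q' \<in> eq ` (QS \<times> PS) \<and> s' \<in> es ` SS"
    proof (cases pd)
      case Nil
      show ?thesis
      proof (cases "D q a s")
        case None
        then show ?thesis using z * Nil d_none by (simp add: M_def)
      next
        case (Some r)
        obtain q' s' di dw bs where r: "r = (q',s',di,dw,bs)" by (cases r)
        show ?thesis using z * Nil d_some[OF *(1,3) Some[unfolded r]] closed[OF *(1,3) Some[unfolded r]]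
          outP[OF *(1,3) Some[unfolded r]] by (auto simp: M_def)
      qed
    next
      case (Cons x xs)
      then show ?thesis using z * d_pend tlP by (auto simp: M_def)
    qed
  qed
  define cv :: "('q,'s,'b) gconf \<Rightarrow> 'b list \<Rightarrow> 'b conf" where "cv c pd =
     (case c of (q,i,t,p,out) \<Rightarrow> \<lparr>c_state = eq (q,pd), c_ipos = i, c_tape = (\<lambda>j. es (t j)), c_wpos = p, c_out = out\<rparr>)" for c pd
  define ok :: "'a list \<Rightarrow> ('q,'s,'b) gconf \<Rightarrow> bool" where "ok w c = (case c of (q,i,t,p,out) \<Rightarrow> q \<in> QS \<and> (\<forall>j. t j \<in> SS) \<and> i \<le> length w + 1)" for w c
  have emit: "(\<lambda>x y. step M w x y \<and> c_wpos x \<le> b)\<^sup>*\<^sup>* (cv (q,i,t,p,out) pd) (cv (q,i,t,p,out @ pd) [])"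
    if "ok w (q,i,t,p,out)" "pd \<in> PS" "p \<le> b" for w q i t p out pd b
    using that
  proof (induction pd arbitrary: out)
    case (Cons x xs)
    have "step M w (cv (q,i,t,p,out) (x#xs)) (cv (q,i,t,p,out @ [x]) xs)"
      unfolding step_def using Cons.prems d_pend[of q x xs "t p" "read_input w i"]
      by (auto simp: cv_def M_def ok_def)
    moreover have "(\<lambda>x y. step M w x y \<and> c_wpos x \<le> b)\<^sup>*\<^sup>* (cv (q,i,t,p,out @ [x]) xs) (cv (q,i,t,p,(out @ [x]) @ xs) [])"
      using Cons.prems tlP by (intro Cons.IH) (auto simp: ok_def)
    ultimately show ?case using Cons.prems
      by (intro converse_rtranclp_into_rtranclp[of _ "cv (q,i,t,p,out) (x#xs)"]) (auto simp: cv_def)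
  qed (auto simp: cv_def)
  have one: "ok w c' \<and> (\<lambda>x y. step M w x y \<and> c_wpos x \<le> b)\<^sup>*\<^sup>* (cv c []) (cv c' [])"
    if ctrl_ok: "ok w c" and g: "bounded_step D w b c c'" for w c c' b
  proof -
    obtain q i t p out where c: "c = (q,i,t,p,out)" by (cases c)
    obtain q' s' di dw bs where D: "D q (read_input w i) (t p) = Some (q',s',di,dw,bs)"
      and c': "c' = (q', min (length w + 1) (move di i), t(p := s'), move dw p, out @ bs)"
      using g unfolding bounded_step_def c by (auto split: option.splits)
    have q: "q \<in> QS" "t p \<in> SS" using ctrl_ok by (auto simp: ok_def c)
    have cl: "q' \<in> QS" "s' \<in> SS" "bs \<in> PS" using closed[OF q D] outP[OF q D] by auto
    let ?c = "(q', min (length w + 1) (move di i), t(p := s'), move dw p, out)"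
    have okc': "ok w ?c" using ctrl_ok cl by (auto simp: ok_def c)
    have "step M w (cv c []) (cv ?c bs)"
      unfolding step_def using d_some[OF q D] by (auto simp: cv_def M_def c)
    moreover have "(\<lambda>x y. step M w x y \<and> c_wpos x \<le> b)\<^sup>*\<^sup>* (cv ?c bs) (cv c' [])"
      unfolding c' by (rule emit) (use okc' cl g in \<open>auto simp: bounded_step_def c'\<close>)
    ultimately have "(\<lambda>x y. step M w x y \<and> c_wpos x \<le> b)\<^sup>*\<^sup>* (cv c []) (cv c' [])"
      using g by (intro converse_rtranclp_into_rtranclp[of _ "cv c []"]) (auto simp: bounded_step_def cv_def c)
    then show ?thesis using okc' by (auto simp: ok_def c')
  qed
  have main: "ok w c' \<and> (\<lambda>x y. step M w x y \<and> c_wpos x \<le> b)\<^sup>*\<^sup>* (cv c []) (cv c' [])"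
    if "(bounded_step D w b)\<^sup>*\<^sup>* c c'" "ok w c" for w c c' b
    using that
  proof (induction rule: rtranclp_induct)
    case (step y z)
    then show ?case using one[of w y b z] by (meson rtranclp_trans)
  qed simp
  have init: "cv (q0,0,\<lambda>_. bl,0,[]) [] = init_conf M" by (simp add: cv_def init_conf_def M_def es_bl)
  have fin: "\<exists>b c. real b \<le> real k * log 2 (real (length w) + 2) \<and>
     (\<lambda>x y. step M w x y \<and> c_wpos x \<le> b)\<^sup>*\<^sup>* (init_conf M) c \<and> c_wpos c \<le> b \<and> halted M w c \<and> c_out c = f w" for w
  proof -
    obtain b c where b: "real b \<le> real k * log 2 (real (length w) + 2)"
       and p: "(bounded_step D w b)\<^sup>*\<^sup>* (q0,0,\<lambda>_. bl,0,[]) c" and h: "gstep D w c = None" and o: "gout c = f w"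
      using run[of w] by blast
    have *: "ok w c" "(\<lambda>x y. step M w x y \<and> c_wpos x \<le> b)\<^sup>*\<^sup>* (init_conf M) (cv c [])"
      using main[OF p] init q0 bl by (auto simp: ok_def)
    have "gpos c \<le> b" using p by (cases rule: rtranclp.cases) (auto simp: bounded_step_def)
    moreover have "halted M w (cv c [])"
    proof -
      obtain q i t p out where c: "c = (q,i,t,p,out)" by (cases c)
      then have "D q (read_input w i) (t p) = None" using h by (auto split: option.splits)
      then have "delta (eq (q,[])) (read_input w i) (es (t p)) = {}" using *(1) by (intro d_none) (auto simp: ok_def c)
      then show ?thesis unfolding halted_def step_def by (simp add: cv_def c M_def)
    qed
    ultimately show ?thesis using b * o by (intro exI[of _ b] exI[of _ "cv c []"]) (cases c; auto simp: cv_def)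
  qed
  have "computes M f" unfolding computes_def reachable_def
  proof
    fix w
    obtain b c where "(\<lambda>x y. step M w x y \<and> c_wpos x \<le> b)\<^sup>*\<^sup>* (init_conf M) c" "halted M w c" "c_out c = f w"
      using fin[of w] by blast
    moreover have "(step M w)\<^sup>*\<^sup>* (init_conf M) c"
      using calculation(1) by (rule rtranclp_mono[THEN predicate2D, rotated]) auto
    ultimately show "\<exists>c. (step M w)\<^sup>*\<^sup>* (init_conf M) c \<and> halted M w c \<and> c_out c = f w" by blast
  qed
  moreover have "log_space_bounded M k" unfolding log_space_bounded_def reachable_def
  proof (intro allI impI)
    fix w d assume "(step M w)\<^sup>*\<^sup>* (init_conf M) d"
    obtain b c where b: "real b \<le> real k * log 2 (real (length w) + 2)"
     "(\<lambda>x y. step M w x y \<and> c_wpos x \<le> b)\<^sup>*\<^sup>* (init_conf M) c" "c_wpos c \<le> b" "halted M w c" using fin[of w] by blast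
    have "c_wpos d \<le> b" using deterministic_reachable_bounded[OF det b(2,3,4)] \<open>(step M w)\<^sup>*\<^sup>* (init_conf M) d\<close> by blast
    then show "real (c_wpos d) \<le> real k * log 2 (real (length w) + 2)" using b(1) by linarith
  qed
  ultimately show ?thesis unfolding logspace_computable_def using wf det by blast
qed

section \<open>A programming language for machines in logarithmic space\<close>

type_synonym 'r cell = "'r \<Rightarrow> nat"

text \<open>A sweep passes to the right and may print, may append one cell where it turns, and
  passes back; the state it ends in is the value returned. \<open>Inp\<close> reads the input symbol
  before it moves.\<close>

datatype ('a,'r) oper =
    Sweep nat "nat \<Rightarrow> 'r cell \<Rightarrow> nat \<times> 'r cell \<times> bool list"
      "nat \<Rightarrow> 'r cell option \<times> bool list" "nat \<Rightarrow> 'r cell \<Rightarrow> nat \<times> 'r cell"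
  | Inp "'a option \<Rightarrow> nat" dir

text \<open>Branches are functions of the returned value. Programs are therefore written in
  continuation style, and finite data such as a popped digit live in the control instead of the
  tape.\<close>

datatype ('a,'r) com = Skip | Seq "('a,'r) com" "('a,'r) com"
  | Switch "('a,'r) oper" "nat \<Rightarrow> ('a,'r) com" | While "('a,'r) oper" "('a,'r) com"

type_synonym 'r cstate = "'r cell list \<times> nat \<times> bool list"

fun sweep_right :: "(nat \<Rightarrow> 'r cell \<Rightarrow> nat \<times> 'r cell \<times> bool list) \<Rightarrow> nat \<Rightarrow> 'r cell list \<Rightarrow> nat \<times> 'r cell list \<times> bool list" where
  "sweep_right g q [] = (q, [], [])"
| "sweep_right g q (x # xs) = (case g q x of (q1,x1,o1) \<Rightarrow> case sweep_right g q1 xs of (q2,xs2,o2) \<Rightarrow> (q2, x1 # xs2, o1 @ o2))"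

fun sweep_left :: "(nat \<Rightarrow> 'r cell \<Rightarrow> nat \<times> 'r cell) \<Rightarrow> nat \<Rightarrow> 'r cell list \<Rightarrow> nat \<times> 'r cell list" where
  "sweep_left g q [] = (q, [])"
| "sweep_left g q (x # xs) = (case sweep_left g q xs of (q1,xs1) \<Rightarrow> case g q1 x of (q2,x2) \<Rightarrow> (q2, x2 # xs1))"

fun op_sem :: "'a list \<Rightarrow> ('a,'r) oper \<Rightarrow> 'r cstate \<Rightarrow> nat \<times> 'r cstate" where
  "op_sem w (Sweep q0 gR tn gL) (xs,i,out) = (case sweep_right gR q0 xs of (q1,xs1,o1) \<Rightarrow>
     case tn q1 of (e,o2) \<Rightarrow> case sweep_left gL q1 xs1 of (q2,xs2) \<Rightarrow>
       (q2, xs2 @ (case e of None \<Rightarrow> [] | Some x \<Rightarrow> [x]), i, out @ o1 @ o2))"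
| "op_sem w (Inp vf d) (xs,i,out) = (vf (read_input w i), xs, min (length w + 1) (move d i), out)"

inductive exec :: "'a list \<Rightarrow> ('a,'r) com \<Rightarrow> 'r cstate \<Rightarrow> 'r cstate \<Rightarrow> bool" for w where
  Skip: "exec w Skip s s"
| Seq: "exec w a s t \<Longrightarrow> exec w b t u \<Longrightarrow> exec w (Seq a b) s u"
| Switch: "op_sem w p s = (v, s1) \<Longrightarrow> exec w (f v) s1 t \<Longrightarrow> exec w (Switch p f) s t"
| WhileF: "op_sem w p s = (0, s1) \<Longrightarrow> exec w (While p c) s s1"
| WhileT: "op_sem w p s = (v, s1) \<Longrightarrow> v \<noteq> 0 \<Longrightarrow> exec w c s1 s2 \<Longrightarrow> exec w (While p c) s2 t \<Longrightarrow>
     exec w (While p c) s t"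

definition cells :: "nat \<Rightarrow> 'r cell set" where "cells B = {x. \<forall>r. x r < B}"

text \<open>Only finitely many states, values and cells occur, although the types of a program are
  infinite; this is what makes the translated machine finite.\<close>

fun okop :: "nat \<Rightarrow> nat \<Rightarrow> ('a,'r) oper \<Rightarrow> bool" where
  "okop S B (Sweep q0 gR tn gL) \<longleftrightarrow> q0 < S \<and>
     (\<forall>q<S. (\<forall>x\<in>cells B. fst (gR q x) < S \<and> fst (snd (gR q x)) \<in> cells B \<and>
        fst (gL q x) < S \<and> snd (gL q x) \<in> cells B) \<and>
        (\<forall>x. fst (tn q) = Some x \<longrightarrow> x \<in> cells B))"
| "okop S B (Inp vf d) \<longleftrightarrow> (\<forall>a. vf a < S)"

primrec okcom :: "nat \<Rightarrow> nat \<Rightarrow> ('a,'r) com \<Rightarrow> bool" where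
  "okcom S B Skip \<longleftrightarrow> True"
| "okcom S B (Seq a b) \<longleftrightarrow> okcom S B a \<and> okcom S B b"
| "okcom S B (Switch p f) \<longleftrightarrow> okop S B p \<and> (\<forall>v<S. okcom S B (f v))"
| "okcom S B (While p c) \<longleftrightarrow> okop S B p \<and> okcom S B c"

text \<open>The continuation stacks that occur while \<open>c\<close> is executed on top of \<open>cs\<close>. There are finitely many,
  so that they can serve as control states of a machine.\<close>
primrec stacks :: "nat \<Rightarrow> ('a,'r) com \<Rightarrow> ('a,'r) com list \<Rightarrow> ('a,'r) com list set" where
  "stacks S Skip cs = {Skip # cs, cs}"
| "stacks S (Seq a b) cs = {Seq a b # cs} \<union> stacks S a (b # cs) \<union> stacks S b cs"
| "stacks S (Switch p f) cs = {Switch p f # cs, cs} \<union> (\<Union>v\<in>{..<S}. stacks S (f v) cs)"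
| "stacks S (While p c) cs = {While p c # cs, cs} \<union> stacks S c (While p c # cs)"

fun top_op :: "('a,'r) com list \<Rightarrow> ('a,'r) oper option" where
  "top_op (Switch p f # cs) = Some p"
| "top_op (While p c # cs) = Some p"
| "top_op _ = None"

fun cont :: "('a,'r) com list \<Rightarrow> nat \<Rightarrow> ('a,'r) com list" where
  "cont (Switch p f # cs) v = f v # cs"
| "cont (While p c # cs) v = (if v = 0 then cs else c # While p c # cs)"
| "cont cs v = cs"

fun silent :: "('a,'r) com list \<Rightarrow> ('a,'r) com list" where
  "silent (Skip # cs) = cs"
| "silent (Seq a b # cs) = a # b # cs"
| "silent cs = cs"

lemma stacks_self: "c # cs \<in> stacks S c cs" by (cases c) auto
lemma stacks_rest: "cs \<in> stacks S c cs" by (induction c arbitrary: cs) auto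
lemma finite_stacks: "finite (stacks S c cs)" by (induction c arbitrary: cs) auto

text \<open>The stack \<open>cs\<close> is exempt, since the behaviour after \<open>c\<close> has
  finished belongs to the surrounding program. For the whole program \<open>cs\<close> is empty,
  where the machine halts.\<close>

lemma stacks_closed:
  "st \<in> stacks S c cs \<Longrightarrow> okcom S B c \<Longrightarrow> st = cs \<or>
     (silent st \<in> stacks S c cs \<and> (\<forall>v<S. cont st v \<in> stacks S c cs)
       \<and> (\<forall>p. top_op st = Some p \<longrightarrow> okop S B p))"
proof (induction c arbitrary: cs)
  case (Seq a b)
  then show ?case using stacks_self[of a "b # cs" S] stacks_self[of b cs S] stacks_rest[of cs S b] by fastforce
next
  case (Switch p f)
  show ?case
  proof (cases "st = cs \<or> st = Switch p f # cs")
    case True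
    then show ?thesis using stacks_self[of "f _" cs S] Switch.prems by fastforce
  next
    case False
    then obtain v where v: "v < S" "st \<in> stacks S (f v) cs" using Switch.prems by auto
    then show ?thesis using Switch.IH[OF _ v(2)] Switch.prems by fastforce
  qed
next
  case (While p c)
  show ?case
  proof (cases "st = cs \<or> st = While p c # cs")
    case True
    then show ?thesis using stacks_self[of c "While p c # cs" S] While.prems by (auto split: if_splits)
  next
    case False
    then have "st \<in> stacks S c (While p c # cs)" using While.prems by auto
    then show ?thesis using While.IH[of "While p c # cs"] While.prems False by auto
  qed
qed auto

section \<open>Translation of programs into machines\<close>

datatype 'r tsym = TB | TL | TC "'r cell"
datatype ('a,'r) tst = TInit | St "('a,'r) com list" | Rt nat "('a,'r) com list" | Lt nat "('a,'r) com list"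

text \<open>Cell 0 holds the end marker \<open>TL\<close>. A sweep turns at the first blank
  \<open>TB\<close>, and at \<open>TL\<close> on the way back its state is handed to the
  continuation.\<close>

fun com_delta :: "('a,'r) com \<Rightarrow> ('a,'r) tst \<Rightarrow> 'a option \<Rightarrow> 'r tsym \<Rightarrow>
    (('a,'r) tst \<times> 'r tsym \<times> dir \<times> dir \<times> bool list) option" where
  "com_delta c TInit a y = Some (St [c], TL, Stay, Stay, [])"
| "com_delta c (St []) a y = None"
| "com_delta c (St st) a y = (case top_op st of
      None \<Rightarrow> Some (St (silent st), y, Stay, Stay, [])
    | Some (Inp vf d) \<Rightarrow> Some (St (cont st (vf a)), y, d, Stay, [])
    | Some (Sweep q0 gR tn gL) \<Rightarrow> Some (Rt q0 st, y, Stay, Rgt, []))"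
| "com_delta c (Rt q st) a y = (case top_op st of Some (Sweep q0 gR tn gL) \<Rightarrow>
     (case y of TC x \<Rightarrow> (case gR q x of (q',x',bs) \<Rightarrow> Some (Rt q' st, TC x', Stay, Rgt, bs))
      | TB \<Rightarrow> Some (Lt q st, case fst (tn q) of None \<Rightarrow> TB | Some x \<Rightarrow> TC x, Stay, Lft, snd (tn q))
      | TL \<Rightarrow> None) | _ \<Rightarrow> None)"
| "com_delta c (Lt q st) a y = (case top_op st of Some (Sweep q0 gR tn gL) \<Rightarrow>
     (case y of TC x \<Rightarrow> (case gL q x of (q',x') \<Rightarrow> Some (Lt q' st, TC x', Stay, Lft, []))
      | TL \<Rightarrow> Some (St (cont st q), TL, Stay, Stay, [])
      | TB \<Rightarrow> None) | _ \<Rightarrow> None)"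

definition mstates :: "nat \<Rightarrow> ('a,'r) com \<Rightarrow> ('a,'r) tst set" where
  "mstates S c = insert TInit (St ` stacks S c [] \<union> (\<lambda>(q,st). Rt q st) ` ({..<S} \<times> (stacks S c [] - {[]}))
     \<union> (\<lambda>(q,st). Lt q st) ` ({..<S} \<times> (stacks S c [] - {[]})))"

definition msyms :: "nat \<Rightarrow> 'r tsym set" where "msyms B = {TB, TL} \<union> TC ` cells B"

lemma finite_cells: "finite (cells B :: 'r::finite cell set)"
proof -
  have "(cells B :: 'r cell set) = {x. \<forall>r. (r \<in> UNIV \<longrightarrow> x r \<in> {..<B}) \<and> (r \<notin> UNIV \<longrightarrow> x r = 0)}"
    by (auto simp: cells_def)
  then show ?thesis using finite_set_of_finite_funs[of "UNIV :: 'r set" "{..<B}" 0] by simp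
qed

lemma com_delta_closed:
  assumes ok: "okcom S B c" and q: "q \<in> mstates S c" and y: "y \<in> msyms B"
    and D: "com_delta c q a y = Some (q',y',di,dw,bs)"
  shows "q' \<in> mstates S c \<and> y' \<in> msyms B"
proof -
  have cl: "silent st \<in> stacks S c []" "\<And>v. v < S \<Longrightarrow> cont st v \<in> stacks S c []"
    "\<And>p. top_op st = Some p \<Longrightarrow> okop S B p"
    if "st \<in> stacks S c []" "st \<noteq> []" for st using stacks_closed[OF that(1) ok] that(2) by auto
  show ?thesis
  proof (cases q)
    case TInit
    then show ?thesis using D stacks_self[of c "[]" S] by (auto simp: mstates_def msyms_def)
  next
    case (St st)
    then have st: "st \<in> stacks S c []" using q by (auto simp: mstates_def)
    show ?thesis
    proof (cases st)
      case Nil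
      then show ?thesis using D St by simp
    next
      case (Cons d ds)
      then show ?thesis using D St st cl[of st] y
        by (auto simp: mstates_def split: option.splits oper.splits)
    qed
  next
    case (Rt p st)
    then have st: "st \<in> stacks S c []" "st \<noteq> []" "p < S" using q by (auto simp: mstates_def)
    obtain q0 gR tn gL where t: "top_op st = Some (Sweep q0 gR tn gL)"
      using D Rt by (auto split: option.splits oper.splits)
    have o: "okop S B (Sweep q0 gR tn gL :: ('a,'b) oper)" using cl(3)[OF st(1,2) t] .
    show ?thesis
    proof (cases y)
      case (TC x)
      then have x: "x \<in> cells B" using y by (auto simp: msyms_def)
      obtain q1 x1 b1 where g: "gR p x = (q1,x1,b1)" by (cases "gR p x")
      have "q1 < S" "x1 \<in> cells B" using o x st(3) g by fastforce+
      then show ?thesis using D Rt t TC g st by (auto simp: mstates_def msyms_def)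
    qed (use D Rt t o st in \<open>auto simp: mstates_def msyms_def split: option.splits\<close>)
  next
    case (Lt p st)
    then have st: "st \<in> stacks S c []" "st \<noteq> []" "p < S" using q by (auto simp: mstates_def)
    obtain q0 gR tn gL where t: "top_op st = Some (Sweep q0 gR tn gL)"
      using D Lt by (auto split: option.splits oper.splits)
    have o: "okop S B (Sweep q0 gR tn gL :: ('a,'b) oper)" using cl(3)[OF st(1,2) t] .
    show ?thesis
    proof (cases y)
      case (TC x)
      then have x: "x \<in> cells B" using y by (auto simp: msyms_def)
      obtain q1 x1 where g: "gL p x = (q1,x1)" by (cases "gL p x")
      have "q1 < S" "x1 \<in> cells B" using o x st(3) g by fastforce+
      then show ?thesis using D Lt t TC g st by (auto simp: mstates_def msyms_def)
    qed (use D Lt t o st cl in \<open>auto simp: mstates_def msyms_def split: option.splits\<close>)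
  qed
qed

section \<open>Simulation of programs by the translated machine\<close>

definition tape :: "'r cell list \<Rightarrow> nat \<Rightarrow> 'r tsym" where
  "tape xs j = (if j = 0 then TL else if j \<le> length xs then TC (xs ! (j - 1)) else TB)"

lemma sweep_right_length: "length (fst (snd (sweep_right g q xs))) = length xs"
  by (induction xs arbitrary: q) (simp_all add: case_prod_unfold)
lemma sweep_left_length: "length (snd (sweep_left g q xs)) = length xs"
  by (induction xs) (simp_all add: case_prod_unfold)

lemma tape_upd: "(tape (ys @ x # xs))(Suc (length ys) := TC x') = tape (ys @ x' # xs)"
  by (auto simp: tape_def fun_eq_iff nth_append nth_Cons split: nat.splits)
lemma tape_mid: "tape (ys @ x # xs) (Suc (length ys)) = TC x"
  by (simp add: tape_def)
lemma tape_end: "tape xs (Suc (length xs)) = TB"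
  by (simp add: tape_def)
lemma tape_ext: "(tape xs)(Suc (length xs) := TC x) = tape (xs @ [x])"
  by (auto simp: tape_def fun_eq_iff nth_append)

lemma bounded_stepI: "gstep D w c = Some c' \<Longrightarrow> gpos c \<le> b \<Longrightarrow> gpos c' \<le> b \<Longrightarrow> (bounded_step D w b)\<^sup>*\<^sup>* c' c'' \<Longrightarrow>
  (bounded_step D w b)\<^sup>*\<^sup>* c c''"
  by (rule converse_rtranclp_into_rtranclp) (auto simp: bounded_step_def)

lemma right_pass:
  assumes "top_op st = Some (Sweep q0 gR tn gL)" "i \<le> length w + 1" "Suc (length ys + length xs) \<le> b"
    and "sweep_right gR q xs = (q1,xs1,o1)"
  shows "(bounded_step (com_delta c) w b)\<^sup>*\<^sup>* (Rt q st, i, tape (ys @ xs), Suc (length ys), out)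
     (Rt q1 st, i, tape (ys @ xs1), Suc (length ys + length xs), out @ o1)"
  using assms
proof (induction xs arbitrary: q ys out xs1 o1)
  case (Cons x xs)
  obtain q' x' bs where g: "gR q x = (q',x',bs)" by (cases "gR q x")
  obtain xs2 o2 where s: "sweep_right gR q' xs = (q1, xs2, o2)" "xs1 = x' # xs2" "o1 = bs @ o2"
    using Cons.prems(4) g by (auto split: prod.splits)
  have "(bounded_step (com_delta c) w b)\<^sup>*\<^sup>* (Rt q' st, i, tape ((ys @ [x']) @ xs), Suc (length (ys @ [x'])), out @ bs)
     (Rt q1 st, i, tape ((ys @ [x']) @ xs2), Suc (length (ys @ [x']) + length xs), (out @ bs) @ o2)"
    by (rule Cons.IH) (use Cons.prems s in auto)
  then show ?case
    by - (rule bounded_stepI[where c' = "(Rt q' st, i, tape ((ys @ [x']) @ xs), Suc (length (ys @ [x'])), out @ bs)"],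
      use Cons.prems g s in \<open>auto simp: tape_mid tape_upd\<close>)
qed auto

lemma left_pass:
  assumes "top_op st = Some (Sweep q0 gR tn gL)" "i \<le> length w + 1" "length ys \<le> b"
    and "sweep_left gL q ys = (q1,ys1)"
  shows "(bounded_step (com_delta c) w b)\<^sup>*\<^sup>* (Lt q st, i, tape (ys @ xs), length ys, out)
     (Lt q1 st, i, tape (ys1 @ xs), 0, out)"
  using assms
proof (induction ys arbitrary: q q1 ys1 xs rule: rev_induct)
  case (snoc y ys)
  obtain q' y' where g: "gL q y = (q',y')" by (cases "gL q y")
  have app: "sweep_left gL q (ys @ [y]) = (case sweep_left gL q' ys of (a, zs) \<Rightarrow> (a, zs @ [y']))" for ys
    by (induction ys) (auto simp: g split: prod.splits)
  obtain ys2 where s: "sweep_left gL q' ys = (q1, ys2)" "ys1 = ys2 @ [y']"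
    using snoc.prems(4) app by (auto split: prod.splits)
  have "(bounded_step (com_delta c) w b)\<^sup>*\<^sup>* (Lt q' st, i, tape (ys @ y' # xs), length ys, out)
     (Lt q1 st, i, tape (ys2 @ y' # xs), 0, out)"
    by (rule snoc.IH) (use snoc.prems s in auto)
  then show ?case
    by - (rule bounded_stepI[where c' = "(Lt q' st, i, tape (ys @ y' # xs), length ys, out)"],
      use snoc.prems g s in \<open>auto simp: tape_mid tape_upd\<close>)
qed auto

text \<open>Besides the marker and the cells, an operation visits only the blank at position
  \<open>length xs + 1\<close>, where a sweep turns.\<close>

lemma run_op:
  assumes t: "top_op st = Some p" and i: "i \<le> length w + 1" and o: "op_sem w p (xs,i,out) = (v,xs',i',out')"
    and b: "length xs + 1 \<le> b"
  shows "(bounded_step (com_delta c) w b)\<^sup>*\<^sup>* (St st, i, tape xs, 0, out) (St (cont st v), i', tape xs', 0, out')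
     \<and> i' \<le> length w + 1 \<and> length xs \<le> length xs'"
proof (cases p)
  case (Inp vf d)
  obtain e es where st: "st = e # es" using t by (cases st) auto
  show ?thesis
    using o Inp t i b by (auto intro!: r_into_rtranclp simp: bounded_step_def st fun_upd_idem)
next
  case (Sweep q0 gR tn gL)
  obtain e es where st: "st = e # es" using t by (cases st) auto
  obtain q1 xs1 o1 where R: "sweep_right gR q0 xs = (q1,xs1,o1)" by (cases "sweep_right gR q0 xs")
  obtain e o2 where T: "tn q1 = (e,o2)" by (cases "tn q1")
  obtain q2 xs2 where L: "sweep_left gL q1 xs1 = (q2,xs2)" by (cases "sweep_left gL q1 xs1")
  let ?ext = "case e of None \<Rightarrow> [] | Some x \<Rightarrow> [x]"
  have res: "v = q2" "xs' = xs2 @ ?ext" "i' = i" "out' = out @ o1 @ o2"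
    using o R T L Sweep by auto
  have len: "length xs1 = length xs" "length xs2 = length xs"
    using sweep_right_length[of gR q0 xs] sweep_left_length[of gL q1 xs1] R L by auto
  have t': "top_op st = Some (Sweep q0 gR tn gL)" using t Sweep by simp
  have 1: "(bounded_step (com_delta c) w b)\<^sup>*\<^sup>* (Rt q0 st, i, tape xs, 1, out) (Rt q1 st, i, tape xs1, Suc (length xs), out @ o1)"
    using right_pass[OF t' i, of "[]" xs b q0 q1 xs1 o1 c out] b R by simp
  have 2: "(bounded_step (com_delta c) w b)\<^sup>*\<^sup>* (Lt q1 st, i, tape (xs1 @ ?ext), length xs1, out')
      (Lt q2 st, i, tape xs', 0, out')"
    using left_pass[OF t' i, of xs1 b q1 q2 xs2 c ?ext out'] b L len res by simp
  have 3: "(bounded_step (com_delta c) w b)\<^sup>*\<^sup>* (Lt q2 st, i, tape xs', 0, out') (St (cont st v), i', tape xs', 0, out')"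
    by - (rule bounded_stepI[where c' = "(St (cont st v), i', tape xs', 0, out')"],
      use t' res i in \<open>auto simp: tape_def fun_eq_iff\<close>)
  have s1: "gstep (com_delta c) w (St st, i, tape xs, 0, out) = Some (Rt q0 st, i, tape xs, 1, out)"
    using t' st i by (auto simp: fun_upd_idem)
  have s2: "gstep (com_delta c) w (Rt q1 st, i, tape xs1, Suc (length xs), out @ o1) =
     Some (Lt q1 st, i, tape (xs1 @ ?ext), length xs1, out')"
    using t' T i res len tape_end[of xs1] tape_ext[of xs1] by (auto simp: fun_upd_idem split: option.splits)
  have "(bounded_step (com_delta c) w b)\<^sup>*\<^sup>* (Rt q1 st, i, tape xs1, Suc (length xs), out @ o1)
      (Lt q2 st, i, tape xs', 0, out')"
    by (rule bounded_stepI[OF s2 _ _ 2]) (use b len in auto)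
  then have "(bounded_step (com_delta c) w b)\<^sup>*\<^sup>* (Rt q0 st, i, tape xs, 1, out) (St (cont st v), i', tape xs', 0, out')"
    using 1 3 by (meson rtranclp_trans)
  then have "(bounded_step (com_delta c) w b)\<^sup>*\<^sup>* (St st, i, tape xs, 0, out) (St (cont st v), i', tape xs', 0, out')"
    by (rule bounded_stepI[OF s1, rotated 2]) (use b in auto)
  then show ?thesis using res i len by simp
qed

lemma op_sem_length: "op_sem w p (xs,i,out) = (v,xs',i',out') \<Longrightarrow> length xs \<le> length xs'"
  using sweep_right_length sweep_left_length
  by (cases p) (auto simp: case_prod_unfold sweep_right_length sweep_left_length)

text \<open>The tape never shrinks, so its final length bounds the space used by the whole
  run.\<close>

lemma exec_length: "exec w c s t \<Longrightarrow> length (fst s) \<le> length (fst t)"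
proof (induction rule: exec.induct)
  case (Switch p s v s1 f t)
  then show ?case using op_sem_length[of w p "fst s" "fst (snd s)" "snd (snd s)" v "fst s1" "fst (snd s1)" "snd (snd s1)"] by simp
next
  case (WhileF p s s1 c)
  then show ?case using op_sem_length[of w p "fst s" "fst (snd s)" "snd (snd s)" 0 "fst s1" "fst (snd s1)" "snd (snd s1)"] by simp
next
  case (WhileT p s v s1 c s2 t)
  then show ?case using op_sem_length[of w p "fst s" "fst (snd s)" "snd (snd s)" v "fst s1" "fst (snd s1)" "snd (snd s1)"] by simp
qed auto

lemma run_com:
  assumes "exec w d s t" "fst (snd s) \<le> length w + 1" "length (fst t) + 1 \<le> b"
  shows "(bounded_step (com_delta c) w b)\<^sup>*\<^sup>* (St (d # cs), fst (snd s), tape (fst s), 0, snd (snd s))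
     (St cs, fst (snd t), tape (fst t), 0, snd (snd t)) \<and> fst (snd t) \<le> length w + 1"
  using assms
proof (induction arbitrary: cs rule: exec.induct)
  case (Skip s)
  then show ?case by (auto intro!: r_into_rtranclp simp: bounded_step_def fun_upd_idem)
next
  case (Seq a s t d u)
  have l: "length (fst t) \<le> length (fst u)" using exec_length[OF Seq.hyps(2)] .
  have 1: "(bounded_step (com_delta c) w b)\<^sup>*\<^sup>* (St (a # d # cs), fst (snd s), tape (fst s), 0, snd (snd s))
     (St (d # cs), fst (snd t), tape (fst t), 0, snd (snd t)) \<and> fst (snd t) \<le> length w + 1"
    using Seq.IH(1)[of "d # cs"] Seq.prems l by simp
  have 2: "(bounded_step (com_delta c) w b)\<^sup>*\<^sup>* (St (d # cs), fst (snd t), tape (fst t), 0, snd (snd t))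
     (St cs, fst (snd u), tape (fst u), 0, snd (snd u)) \<and> fst (snd u) \<le> length w + 1"
    using Seq.IH(2)[of cs] Seq.prems 1 by simp
  have "(bounded_step (com_delta c) w b)\<^sup>*\<^sup>* (St (a # d # cs), fst (snd s), tape (fst s), 0, snd (snd s))
     (St cs, fst (snd u), tape (fst u), 0, snd (snd u))" using 1 2 by (meson rtranclp_trans)
  then have "(bounded_step (com_delta c) w b)\<^sup>*\<^sup>* (St (Seq a d # cs), fst (snd s), tape (fst s), 0, snd (snd s))
     (St cs, fst (snd u), tape (fst u), 0, snd (snd u))"
    using Seq.prems
    by - (rule bounded_stepI[where c' = "(St (a # d # cs), fst (snd s), tape (fst s), 0, snd (snd s))"],
      auto simp: fun_upd_idem)
  then show ?case using 2 by simp
next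
  case (Switch p s v s1 f t)
  have l: "length (fst s) \<le> length (fst t)" "length (fst s1) \<le> length (fst t)"
    using exec_length[OF Switch.hyps(2)] exec_length[OF exec.Switch[where f = f, OF Switch.hyps(1,2)]] by auto
  have "(bounded_step (com_delta c) w b)\<^sup>*\<^sup>* (St (Switch p f # cs), fst (snd s), tape (fst s), 0, snd (snd s))
    (St (cont (Switch p f # cs) v), fst (snd s1), tape (fst s1), 0, snd (snd s1))
     \<and> fst (snd s1) \<le> length w + 1 \<and> length (fst s) \<le> length (fst s1)"
    by (rule run_op[of _ p]) (use Switch l in auto)
  then show ?case using Switch.IH[of cs] Switch.prems by (auto intro: rtranclp_trans)
next
  case (WhileF p s s1 d)
  have l: "length (fst s) \<le> length (fst s1)"
    using exec_length[OF exec.WhileF[OF WhileF.hyps]] by auto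
  have "(bounded_step (com_delta c) w b)\<^sup>*\<^sup>* (St (While p d # cs), fst (snd s), tape (fst s), 0, snd (snd s))
    (St (cont (While p d # cs) 0), fst (snd s1), tape (fst s1), 0, snd (snd s1))
     \<and> fst (snd s1) \<le> length w + 1 \<and> length (fst s) \<le> length (fst s1)"
    by (rule run_op[of _ p]) (use WhileF l in auto)
  then show ?case by simp
next
  case (WhileT p s v s1 d s2 t)
  have l: "length (fst s) \<le> length (fst t)" "length (fst s2) \<le> length (fst t)"
    using exec_length[OF WhileT.hyps(4)] exec_length[OF exec.WhileT[OF WhileT.hyps]] by auto
  have "(bounded_step (com_delta c) w b)\<^sup>*\<^sup>* (St (While p d # cs), fst (snd s), tape (fst s), 0, snd (snd s))
    (St (cont (While p d # cs) v), fst (snd s1), tape (fst s1), 0, snd (snd s1))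
     \<and> fst (snd s1) \<le> length w + 1 \<and> length (fst s) \<le> length (fst s1)"
    by (rule run_op[of _ p]) (use WhileT l in auto)
  then show ?case using WhileT.IH(1)[of "While p d # cs"] WhileT.IH(2)[of cs] WhileT.prems WhileT.hyps(2) l
    by (auto intro: rtranclp_trans)
qed

text \<open>The summand 1 in the space bound accounts for the blank at which sweeps turn.\<close>

theorem logspace_computable_by_com:
  fixes c :: "('a::finite, 'r::finite) com"
  assumes ok: "okcom S B c"
    and run: "\<And>w. \<exists>xs i. exec w c ([],0,[]) (xs,i,f w) \<and>
      real (length xs) + 1 \<le> real k * log 2 (real (length w) + 2)"
  shows "logspace_computable f"
proof (rule logspace_computable_by_machine[where D = "com_delta c" and QS = "mstates S c" and SS = "msyms B"
      and ?q0.0 = TInit and bl = TB and k = k])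
  show "finite (mstates S c)" by (simp add: mstates_def finite_stacks)
  show "finite (msyms B :: 'r tsym set)" by (simp add: msyms_def finite_cells)
  show "TInit \<in> mstates S c" "TB \<in> msyms B" by (auto simp: mstates_def msyms_def)
next
  fix q a s q' s' di dw bs
  assume "q \<in> mstates S c" "s \<in> msyms B" "com_delta c q a s = Some (q',s',di,dw,bs)"
  then show "q' \<in> mstates S c \<and> s' \<in> msyms B" by (rule com_delta_closed[OF ok])
next
  fix w
  obtain xs i where e: "exec w c ([],0,[]) (xs,i,f w)"
    and l: "real (length xs) + 1 \<le> real k * log 2 (real (length w) + 2)" using run by blast
  let ?b = "length xs + 1"
  have s: "gstep (com_delta c) w (TInit,0,\<lambda>_. TB,0,[]) = Some (St [c], 0, tape [], 0, [])"
    by (auto simp: tape_def fun_eq_iff)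
  have r: "(bounded_step (com_delta c) w ?b)\<^sup>*\<^sup>* (St [c],0,tape [],0,[]) (St [], i, tape xs, 0, f w)"
    using run_com[OF e, of ?b c "[]"] by simp
  have "(bounded_step (com_delta c) w ?b)\<^sup>*\<^sup>* (TInit,0,\<lambda>_. TB,0,[]) (St [], i, tape xs, 0, f w)"
    by (rule bounded_stepI[OF s _ _ r]) auto
  then show "\<exists>b d. real b \<le> real k * log 2 (real (length w) + 2) \<and>
    (bounded_step (com_delta c) w b)\<^sup>*\<^sup>* (TInit,0,\<lambda>_. TB,0,[]) d \<and> gstep (com_delta c) w d = None \<and> gout d = f w"
    using l by (intro exI[of _ ?b] exI[of _ "(St [], i, tape xs, 0, f w)"]) auto
qed

section \<open>Register operations\<close>

text \<open>Cell \<open>i\<close> collects the digits of all registers at place \<open>i\<close>,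
  least significant first, so that carries travel to the right.\<close>

fun tape_of :: "nat \<Rightarrow> nat \<Rightarrow> ('r \<Rightarrow> nat) \<Rightarrow> 'r cell list" where
  "tape_of B 0 \<rho> = []"
| "tape_of B (Suc l) \<rho> = (\<lambda>r. \<rho> r mod B) # tape_of B l (\<lambda>r. \<rho> r div B)"

text \<open>State 1 is the carry; if it survives to the right end, it is returned and signals
  overflow.\<close>

definition g_inc :: "nat \<Rightarrow> 'r \<Rightarrow> nat \<Rightarrow> 'r cell \<Rightarrow> nat \<times> 'r cell \<times> bool list" where
  "g_inc B r q x = (if q = 1 then (if x r = B - 1 then (1, x(r := 0), []) else (0, x(r := x r + 1), []))
     else (0, x, []))"

definition g_dec :: "nat \<Rightarrow> 'r \<Rightarrow> nat \<Rightarrow> 'r cell \<Rightarrow> nat \<times> 'r cell \<times> bool list" where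
  "g_dec B r q x = (if q = 1 then (if x r = 0 then (1, x(r := B - 1), []) else (0, x(r := x r - 1), []))
     else (0, x, []))"

definition g_nz :: "'r \<Rightarrow> nat \<Rightarrow> 'r cell \<Rightarrow> nat \<times> 'r cell \<times> bool list" where
  "g_nz r q x = ((if q = 1 \<or> x r \<noteq> 0 then 1 else 0, x, []))"

definition g_eq :: "('r \<times> 'r) list \<Rightarrow> nat \<Rightarrow> 'r cell \<Rightarrow> nat \<times> 'r cell \<times> bool list" where
  "g_eq ps q x = ((if q = 1 \<and> (\<forall>(a,b)\<in>set ps. x a = x b) then 1 else 0, x, []))"

text \<open>The digits of \<open>r\<close> move up by one place; the state is the digit waiting to
  be written.\<close>

definition g_push :: "'r \<Rightarrow> nat \<Rightarrow> 'r cell \<Rightarrow> nat \<times> 'r cell \<times> bool list" where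
  "g_push r q x = ((x r, x(r := q), []))"

text \<open>Digits move down, so this shift has to run on the way back; the digit that drops out of
  the first cell is the value returned.\<close>

definition g_pop :: "'r \<Rightarrow> nat \<Rightarrow> 'r cell \<Rightarrow> nat \<times> 'r cell" where
  "g_pop r q x = ((x r, x(r := q)))"

definition g_asg :: "('r \<Rightarrow> 'r option) \<Rightarrow> nat \<Rightarrow> 'r cell \<Rightarrow> nat \<times> 'r cell \<times> bool list" where
  "g_asg \<sigma> q x = ((q, \<lambda>r. case \<sigma> r of None \<Rightarrow> 0 | Some s \<Rightarrow> x s, []))"

definition incop :: "nat \<Rightarrow> 'r \<Rightarrow> ('a,'r) oper" where
  "incop B r = Sweep 1 (g_inc B r) (\<lambda>_. (None, [])) Pair"

definition decop :: "nat \<Rightarrow> 'r \<Rightarrow> ('a,'r) oper" where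
  "decop B r = Sweep 1 (g_dec B r) (\<lambda>_. (None, [])) Pair"

definition nzop :: "'r \<Rightarrow> ('a,'r) oper" where
  "nzop r = Sweep 0 (g_nz r) (\<lambda>_. (None, [])) Pair"

definition eqop :: "('r \<times> 'r) list \<Rightarrow> ('a,'r) oper" where
  "eqop ps = Sweep 1 (g_eq ps)
     (\<lambda>_. (None, [])) Pair"

definition asgop :: "('r \<Rightarrow> 'r option) \<Rightarrow> ('a,'r) oper" where
  "asgop \<sigma> = Sweep 0 (g_asg \<sigma>) (\<lambda>_. (None, [])) Pair"

definition pushop :: "'r \<Rightarrow> nat \<Rightarrow> ('a,'r) oper" where
  "pushop r d = Sweep d (g_push r) (\<lambda>_. (None, [])) Pair"

definition popop :: "'r \<Rightarrow> ('a,'r) oper" where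
  "popop r = Sweep 0 (\<lambda>q x. (q, x, [])) (\<lambda>_. (None, [])) (g_pop r)"

definition emitop :: "bool list \<Rightarrow> ('a,'r) oper" where
  "emitop bs = Sweep 0 (\<lambda>q x. (q, x, [])) (\<lambda>_. (None, bs)) Pair"

definition printop :: "('r cell \<Rightarrow> bool list) \<Rightarrow> ('a,'r) oper" where
  "printop g = Sweep 0 (\<lambda>q x. (q, x, g x)) (\<lambda>_. (None, [])) Pair"

definition extop :: "'r cell \<Rightarrow> ('a,'r) oper" where
  "extop x = Sweep 0 (\<lambda>q x. (q, x, [])) (\<lambda>_. (Some x, [])) Pair"

lemma sweep_left_Pair [simp]: "sweep_left Pair q xs = (q, xs)"
  by (induction xs) auto

lemma sweep_right_print [simp]: "sweep_right (\<lambda>q x. (q, x, g x)) q xs = (q, xs, concat (map g xs))"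
  by (induction xs) auto

lemma mod_power_Suc_eq_iff: "a mod B ^ Suc k = b mod B ^ Suc k \<longleftrightarrow>
  a mod B = b mod B \<and> (a div B) mod B ^ k = (b div B) mod B ^ k" for a b B :: nat
proof (cases "B = 0")
  case False
  show ?thesis
  proof
    assume e: "a mod B ^ Suc k = b mod B ^ Suc k"
    then have 1: "a mod B = b mod B" by (metis mod_mod_cancel dvd_triv_left power_Suc)
    then show "a mod B = b mod B \<and> (a div B) mod B ^ k = (b div B) mod B ^ k"
      using e False by (simp add: mod_mult2_eq)
  qed (simp add: mod_mult2_eq)
qed auto

text \<open>The tape determines registers only modulo \<open>B ^ l\<close>; all arithmetic of the
  programs is thus arithmetic modulo \<open>N\<close>.\<close>

lemma tape_of_cong: "(\<And>r. \<rho> r mod B ^ l = \<rho>' r mod B ^ l) \<Longrightarrow> tape_of B l \<rho> = tape_of B l \<rho>'"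
proof (induction l arbitrary: \<rho> \<rho>')
  case (Suc l)
  have "\<rho> r mod B = \<rho>' r mod B \<and> (\<rho> r div B) mod B ^ l = (\<rho>' r div B) mod B ^ l" for r
    using Suc.prems[of r] by (simp only: mod_power_Suc_eq_iff)
  then have "(\<lambda>r. \<rho> r mod B) = (\<lambda>r. \<rho>' r mod B)"
    "tape_of B l (\<lambda>r. \<rho> r div B) = tape_of B l (\<lambda>r. \<rho>' r div B)"
    by (blast, intro Suc.IH, blast)
  then show ?case by (simp only: tape_of.simps)
qed simp

lemma tape_of_length [simp]: "length (tape_of B l \<rho>) = l"
  by (induction l arbitrary: \<rho>) auto

lemma tape_of_0: "tape_of B l (\<lambda>_. 0) = replicate l (\<lambda>_. 0)"
  by (induction l) auto

section \<open>Sweeps as arithmetic on registers\<close>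

locale regs =
  fixes B l :: nat and N :: nat and w :: "'a list"
  assumes B: "2 \<le> B" and N_def: "N = B ^ l"
begin

definition good :: "('r \<Rightarrow> nat) \<Rightarrow> bool" where "good \<rho> \<longleftrightarrow> (\<forall>r. \<rho> r < N)"

text \<open>\<open>t\<close> is a predicate on final states: the programs leave junk in auxiliary registers.\<close>
definition wp :: "('a,'r) com \<Rightarrow> ('r \<Rightarrow> nat) \<Rightarrow> nat \<Rightarrow> bool list \<Rightarrow> ('r cstate \<Rightarrow> bool) \<Rightarrow> bool" where
  "wp c \<rho> i out t \<longleftrightarrow> (\<exists>s. exec w c (tape_of B l \<rho>, i, out) s \<and> t s)"

text \<open>The induction step shared by the sweeps to the right that print nothing: the first cell
  carries remainders modulo \<open>B\<close>, the rest of the tape the quotients.\<close>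

lemma sweep_right_conc_Suc:
  assumes "g q (\<lambda>r. \<rho> r mod B) = (q1, x1, [])"
    and "sweep_right g q1 (tape_of B k (\<lambda>r. \<rho> r div B)) = (v, tape_of B k \<rho>2, [])"
    and "\<And>s. \<rho>' s mod B = x1 s" "\<And>s. \<rho>' s div B = \<rho>2 s"
  shows "sweep_right g q (tape_of B (Suc k) \<rho>) = (v, tape_of B (Suc k) \<rho>', [])"
proof -
  have "(\<lambda>s. \<rho>' s mod B) = x1" "(\<lambda>s. \<rho>' s div B) = \<rho>2" using assms(3,4) by auto
  then show ?thesis using assms(1,2) by simp
qed

lemma sweep_right_inc:
  assumes "q < 2"
  shows "sweep_right (g_inc B r) q (tape_of B k \<rho>) =
    (if q = 1 \<and> (\<rho> r + 1) mod B ^ k = 0 then 1 else 0, tape_of B k (\<rho>(r := \<rho> r + q)), [])"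
  using assms
proof (induction k arbitrary: \<rho> q)
  case (Suc k)
  let ?\<rho> = "\<lambda>r. \<rho> r div B"
  have IH: "sweep_right (g_inc B r) q (tape_of B k ?\<rho>) =
    (if q = 1 \<and> (\<rho> r div B + 1) mod B ^ k = 0 then 1 else 0, tape_of B k (?\<rho>(r := \<rho> r div B + q)), [])" if "q < 2" for q
    using that by (rule Suc.IH)
  have step: "sweep_right (g_inc B r) q (tape_of B (Suc k) \<rho>) = (v, tape_of B (Suc k) \<rho>', [])"
    if "g_inc B r q (\<lambda>r. \<rho> r mod B) = (q1, x1, [])" "q1 < 2"
      "v = (if q1 = 1 \<and> (\<rho> r div B + 1) mod B ^ k = 0 then 1 else 0)"
      "\<And>s. \<rho>' s mod B = x1 s" "\<And>s. \<rho>' s div B = (?\<rho>(r := \<rho> r div B + q1)) s" for q q1 x1 v \<rho>'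
  proof -
    have "sweep_right (g_inc B r) q1 (tape_of B k ?\<rho>) = (v, tape_of B k (?\<rho>(r := \<rho> r div B + q1)), [])"
      unfolding that(3) using that(2) by (rule IH)
    then show ?thesis by (rule sweep_right_conc_Suc[where g = "g_inc B r", OF that(1) _ that(4,5)])
  qed
  consider "q = 0" | "q = 1" "\<rho> r mod B = B - 1" | "q = 1" "\<rho> r mod B \<noteq> B - 1" using Suc.prems by linarith
  then show ?case
  proof cases
    case 1
    show ?thesis
      by (rule step[of _ 0]) (auto simp: g_inc_def 1)
  next
    case 2
    have e: "\<rho> r + 1 = B * (\<rho> r div B + 1)"
      using mult_div_mod_eq[of B "\<rho> r"] 2(2) B by (simp add: algebra_simps)
    have m: "(\<rho> r + 1) mod B = 0" "(\<rho> r + 1) div B = \<rho> r div B + 1"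
      unfolding e using B by simp_all
    have "(\<rho> r + 1) mod B ^ Suc k = 0 \<longleftrightarrow> (\<rho> r div B + 1) mod B ^ k = 0"
      unfolding e power_Suc mult_mod_right[symmetric] using B by simp
    then show ?thesis
      by (intro step[of _ 1])
        (use 2 m in \<open>auto simp: g_inc_def\<close>)
  next
    case 3
    have "\<rho> r mod B + 1 < B" using 3 B mod_less_divisor[of B "\<rho> r"] by linarith
    then have m: "(\<rho> r + 1) mod B = \<rho> r mod B + 1" "(\<rho> r + 1) div B = \<rho> r div B"
      by (simp add: mod_Suc, simp add: div_Suc mod_Suc)
    \<comment> \<open>Without a carry the lowest digit of the sum is positive, hence there is no
      overflow.\<close>
    have "(\<rho> r + 1) mod B ^ Suc k \<noteq> 0"
      using m(1) by (metis add_is_0 dvd_imp_mod_0 dvd_trans mod_0_imp_dvd dvd_triv_left power_Suc one_neq_zero)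
    then show ?thesis
      by (intro step[of _ 0])
        (use 3 m in \<open>auto simp: g_inc_def\<close>)
  qed
qed auto

lemma sweep_right_dec:
  assumes "q < 2" "q = 1 \<Longrightarrow> 0 < \<rho> r"
  shows "\<exists>v. sweep_right (g_dec B r) q (tape_of B k \<rho>) = (v, tape_of B k (\<rho>(r := \<rho> r - q)), [])"
  using assms
proof (induction k arbitrary: \<rho> q)
  case (Suc k)
  let ?\<rho> = "\<lambda>r. \<rho> r div B"
  have IH: "\<exists>v. sweep_right (g_dec B r) q (tape_of B k ?\<rho>) = (v, tape_of B k (?\<rho>(r := \<rho> r div B - q)), [])"
    if "q < 2" "q = 1 \<Longrightarrow> 0 < \<rho> r div B" for q using that by (rule Suc.IH)
  consider "q = 0" | "q = 1" "\<rho> r mod B = 0" | "q = 1" "\<rho> r mod B \<noteq> 0" using Suc.prems by linarith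
  then show ?case
  proof cases
    case 1
    obtain v where v: "sweep_right (g_dec B r) 0 (tape_of B k (\<lambda>r. \<rho> r div B)) =
      (v, tape_of B k ((\<lambda>r. \<rho> r div B)(r := \<rho> r div B - 0)), [])" using IH[of 0] by auto
    show ?thesis
      by (rule exI, rule sweep_right_conc_Suc[where g = "g_dec B r", OF _ v]) (auto simp: g_dec_def 1)
  next
    case 2
    then obtain d where d: "\<rho> r = B * d" by (meson dvdE mod_eq_0_iff_dvd)
    then obtain d' where d': "\<rho> r = B * Suc d'" using Suc.prems(2)[OF 2(1)] by (cases d) auto
    have "\<rho> r - 1 = B * d' + (B - 1)" using d' B by simp
    moreover have "B - 1 < B" using B by simp
    ultimately have m: "(\<rho> r - 1) mod B = B - 1" "(\<rho> r - 1) div B = d'"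
      by (simp_all only: mod_mult_self4 div_mult_self4 mod_less div_less)
    have n: "\<rho> r div B = Suc d'" using d' B by simp
    obtain v where v: "sweep_right (g_dec B r) 1 (tape_of B k (\<lambda>r. \<rho> r div B)) =
      (v, tape_of B k ((\<lambda>r. \<rho> r div B)(r := \<rho> r div B - 1)), [])" using IH[of 1] n by auto
    show ?thesis
      by (rule exI, rule sweep_right_conc_Suc[where g = "g_dec B r", OF _ v]) (use 2 m n in \<open>auto simp: g_dec_def\<close>)
  next
    case 3
    obtain m where m: "\<rho> r mod B = Suc m" using 3 by (cases "\<rho> r mod B") auto
    have "\<rho> r - 1 = B * (\<rho> r div B) + m" using mult_div_mod_eq[of B "\<rho> r"] m by linarith
    moreover have "m < B" using m B mod_less_divisor[of B "\<rho> r"] by simp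
    ultimately have e: "(\<rho> r - 1) mod B = m" "(\<rho> r - 1) div B = \<rho> r div B" using B by simp_all
    obtain v where v: "sweep_right (g_dec B r) 0 (tape_of B k (\<lambda>r. \<rho> r div B)) =
      (v, tape_of B k ((\<lambda>r. \<rho> r div B)(r := \<rho> r div B - 0)), [])" using IH[of 0] by auto
    show ?thesis
      by (rule exI, rule sweep_right_conc_Suc[where g = "g_dec B r", OF _ v]) (use 3 m e in \<open>auto simp: g_dec_def\<close>)
  qed
qed auto

lemma sweep_right_eq:
  assumes "q < 2"
  shows "sweep_right (g_eq ps) q (tape_of B k \<rho>) =
    (if q = 1 \<and> (\<forall>(a,b)\<in>set ps. \<rho> a mod B ^ k = \<rho> b mod B ^ k) then 1 else 0, tape_of B k \<rho>, [])"
  using assms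
proof (induction k arbitrary: \<rho> q)
  case (Suc k)
  define q1 where "q1 = (if q = 1 \<and> (\<forall>(a,b)\<in>set ps. \<rho> a mod B = \<rho> b mod B) then 1 else 0::nat)"
  have "q1 < 2" by (simp add: q1_def)
  then show ?case
    by (intro sweep_right_conc_Suc[where g = "g_eq ps", OF _ trans[OF Suc.IH[of q1]]])
     (simp_all add: g_eq_def q1_def mod_power_Suc_eq_iff del: power_Suc, auto)
qed (auto simp: less_2_cases_iff)

lemma sweep_right_nz:
  assumes "q < 2"
  shows "sweep_right (g_nz r) q (tape_of B k \<rho>) =
    (if q = 1 \<or> \<rho> r mod B ^ k \<noteq> 0 then 1 else 0, tape_of B k \<rho>, [])"
  using assms
proof (induction k arbitrary: \<rho> q)
  case (Suc k)
  define q1 where "q1 = (if q = 1 \<or> \<rho> r mod B \<noteq> 0 then 1 else 0::nat)"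
  have "q1 < 2" by (simp add: q1_def)
  moreover have "\<rho> r mod B ^ Suc k = 0 \<longleftrightarrow> \<rho> r mod B = 0 \<and> (\<rho> r div B) mod B ^ k = 0"
    using mod_power_Suc_eq_iff[of "\<rho> r" B k 0] by simp
  ultimately show ?case
    by (intro sweep_right_conc_Suc[where g = "g_nz r", OF _ trans[OF Suc.IH[of q1]]])
     (simp_all add: g_nz_def q1_def del: power_Suc)
qed (auto simp: less_2_cases_iff)

lemma sweep_right_asg: "sweep_right (g_asg \<sigma>) q (tape_of B k \<rho>) =
    (q, tape_of B k (\<lambda>r. case \<sigma> r of None \<Rightarrow> 0 | Some s \<Rightarrow> \<rho> s), [])"
proof (induction k arbitrary: \<rho>)
  case (Suc k)
  show ?case
    by (rule sweep_right_conc_Suc[where g = "g_asg \<sigma>", OF _ Suc.IH]) (auto simp: g_asg_def split: option.splits)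
qed simp

lemma sweep_right_push:
  assumes "q < B"
  shows "\<exists>v. sweep_right (g_push r) q (tape_of B k \<rho>) = (v, tape_of B k (\<rho>(r := \<rho> r * B + q)), [])"
  using assms
proof (induction k arbitrary: \<rho> q)
  case (Suc k)
  have "\<rho> r mod B < B" using B by simp
  then have "\<exists>v. sweep_right (g_push r) (\<rho> r mod B) (tape_of B k (\<lambda>r. \<rho> r div B)) =
     (v, tape_of B k ((\<lambda>r. \<rho> r div B)(r := (\<rho> r div B) * B + \<rho> r mod B)), [])"
    by (rule Suc.IH)
  then obtain v where v: "sweep_right (g_push r) (\<rho> r mod B) (tape_of B k (\<lambda>r. \<rho> r div B)) =
     (v, tape_of B k ((\<lambda>r. \<rho> r div B)(r := (\<rho> r div B) * B + \<rho> r mod B)), [])" by blast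
  show ?case
    by (rule exI, rule sweep_right_conc_Suc[where g = "g_push r", OF _ v]) (use Suc.prems B in \<open>auto simp: g_push_def\<close>)
qed auto

lemma sweep_left_pop:
  assumes "\<rho> r < B ^ k"
  shows "sweep_left (g_pop r) 0 (tape_of B k \<rho>) = (\<rho> r mod B, tape_of B k (\<rho>(r := \<rho> r div B)))"
  using assms
proof (induction k arbitrary: \<rho>)
  case (Suc k)
  let ?\<rho> = "\<lambda>r. \<rho> r div B"
  have "\<rho> r div B < B ^ k" using Suc.prems B by (simp add: less_mult_imp_div_less mult.commute)
  then have IH: "sweep_left (g_pop r) 0 (tape_of B k ?\<rho>) = (?\<rho> r mod B, tape_of B k (?\<rho>(r := ?\<rho> r div B)))"
    by (rule Suc.IH)
  have e: "(\<lambda>x. (\<rho>(r := \<rho> r div B)) x mod B) = (\<lambda>x. \<rho> x mod B)(r := \<rho> r div B mod B)"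
      "(\<lambda>x. (\<rho>(r := \<rho> r div B)) x div B) = ?\<rho>(r := \<rho> r div B div B)" by auto
  show ?case unfolding tape_of.simps sweep_left.simps e IH by (simp add: g_pop_def)
qed auto

lemma N_pos: "0 < N" using B N_def by simp

lemma wp_Skip: "t (tape_of B l \<rho>, i, out) \<Longrightarrow> wp Skip \<rho> i out t"
  unfolding wp_def using exec.Skip by blast

lemma wp_Seq: "exec w a (tape_of B l \<rho>, i, out) (tape_of B l \<rho>', i', out') \<Longrightarrow> wp b \<rho>' i' out' t \<Longrightarrow> wp (Seq a b) \<rho> i out t"
  unfolding wp_def using exec.Seq by blast

lemma wp_Switch:
  "op_sem w p (tape_of B l \<rho>, i, out) = (v, tape_of B l \<rho>', i', out') \<Longrightarrow> wp (f v) \<rho>' i' out' t \<Longrightarrow>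
    wp (Switch p f) \<rho> i out t"
  unfolding wp_def using exec.Switch by blast

lemma wp_inc:
  assumes "good \<rho>"
    and "wp (f (if \<rho> r + 1 = N then 1 else 0)) (\<rho>(r := if \<rho> r + 1 = N then 0 else \<rho> r + 1)) i out t"
  shows "wp (Switch (incop B r) f) \<rho> i out t"
proof -
  have m: "(\<rho> r + 1) mod N = (if \<rho> r + 1 = N then 0 else \<rho> r + 1)"
    using assms(1) unfolding good_def by (metis Suc_eq_plus1 Suc_lessI mod_less mod_self)
  then have f: "(\<rho> r + 1) mod B ^ l = 0 \<longleftrightarrow> \<rho> r + 1 = N" by (auto simp: N_def)
  have "tape_of B l (\<rho>(r := \<rho> r + 1)) = tape_of B l (\<rho>(r := if \<rho> r + 1 = N then 0 else \<rho> r + 1))"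
    by (rule tape_of_cong) (use N_def in auto)
  then have "op_sem w (incop B r) (tape_of B l \<rho>, i, out) = (if \<rho> r + 1 = N then 1 else 0,
     tape_of B l (\<rho>(r := if \<rho> r + 1 = N then 0 else \<rho> r + 1)), i, out)"
    using sweep_right_inc[of 1 r l \<rho>] f by (simp add: incop_def)
  then show ?thesis using assms(2) by (rule wp_Switch)
qed

lemma wp_dec:
  assumes "0 < \<rho> r" and "\<And>v. wp (f v) (\<rho>(r := \<rho> r - 1)) i out t"
  shows "wp (Switch (decop B r) f) \<rho> i out t"
proof -
  obtain v where "op_sem w (decop B r) (tape_of B l \<rho>, i, out) = (v, tape_of B l (\<rho>(r := \<rho> r - 1)), i, out)"
    using sweep_right_dec[of 1 \<rho> r l] assms by (auto simp: decop_def)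
  then show ?thesis using assms(2) by (rule wp_Switch)
qed

lemma op_sem_nz:
  assumes "good \<rho>"
  shows "op_sem w (nzop r) (tape_of B l \<rho>, i, out) = (if \<rho> r \<noteq> 0 then 1 else 0, tape_of B l \<rho>, i, out)"
  using sweep_right_nz[of 0 r l \<rho>] assms by (simp add: nzop_def good_def flip: N_def)

lemma wp_nz:
  assumes "good \<rho>" and "wp (f (if \<rho> r \<noteq> 0 then 1 else 0)) \<rho> i out t"
  shows "wp (Switch (nzop r) f) \<rho> i out t"
  using op_sem_nz[OF assms(1)] assms(2) by (rule wp_Switch)

lemma op_sem_eq:
  assumes "good \<rho>"
  shows "op_sem w (eqop ps) (tape_of B l \<rho>, i, out) = (if \<forall>(a,b)\<in>set ps. \<rho> a = \<rho> b then 1 else 0, tape_of B l \<rho>, i, out)"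
proof -
  have "\<rho> r mod B ^ l = \<rho> r" for r using assms by (simp add: good_def flip: N_def)
  then show ?thesis using sweep_right_eq[of 1 ps l \<rho>] by (simp add: eqop_def)
qed

lemma wp_eq:
  assumes "good \<rho>" and "wp (f (if \<forall>(a,b)\<in>set ps. \<rho> a = \<rho> b then 1 else 0)) \<rho> i out t"
  shows "wp (Switch (eqop ps) f) \<rho> i out t"
  using op_sem_eq[OF assms(1)] assms(2) by (rule wp_Switch)

lemma wp_asg:
  assumes "\<And>v. wp (f v) (\<lambda>r. case \<sigma> r of None \<Rightarrow> 0 | Some s \<Rightarrow> \<rho> s) i out t"
  shows "wp (Switch (asgop \<sigma>) f) \<rho> i out t"
proof -
  have "op_sem w (asgop \<sigma>) (tape_of B l \<rho>, i, out) = (0, tape_of B l (\<lambda>r. case \<sigma> r of None \<Rightarrow> 0 | Some s \<Rightarrow> \<rho> s), i, out)"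
    using sweep_right_asg[of \<sigma> 0 l \<rho>] by (simp add: asgop_def)
  then show ?thesis using assms by (rule wp_Switch)
qed

lemma wp_push:
  assumes "d < B" "\<And>v. wp (f v) (\<rho>(r := (\<rho> r * B + d) mod N)) i out t"
  shows "wp (Switch (pushop r d) f) \<rho> i out t"
proof -
  have "tape_of B l (\<rho>(r := \<rho> r * B + d)) = tape_of B l (\<rho>(r := (\<rho> r * B + d) mod N))"
    by (rule tape_of_cong) (use N_def in auto)
  then obtain v where "op_sem w (pushop r d) (tape_of B l \<rho>, i, out) =
      (v, tape_of B l (\<rho>(r := (\<rho> r * B + d) mod N)), i, out)"
    using sweep_right_push[of d r l \<rho>] assms(1) by (auto simp: pushop_def)
  then show ?thesis using assms(2) by (rule wp_Switch)
qed

lemma wp_pop: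
  assumes "good \<rho>" "wp (f (\<rho> r mod B)) (\<rho>(r := \<rho> r div B)) i out t"
  shows "wp (Switch (popop r) f) \<rho> i out t"
proof -
  have "op_sem w (popop r) (tape_of B l \<rho>, i, out) = (\<rho> r mod B, tape_of B l (\<rho>(r := \<rho> r div B)), i, out)"
    using sweep_left_pop[of \<rho> r l] assms(1) by (simp add: popop_def good_def flip: N_def)
  then show ?thesis using assms(2) by (rule wp_Switch)
qed

lemma wp_emit:
  assumes "\<And>v. wp (f v) \<rho> i (out @ bs) t"
  shows "wp (Switch (emitop bs) f) \<rho> i out t"
proof -
  have "op_sem w (emitop bs) (tape_of B l \<rho>, i, out) = (0, tape_of B l \<rho>, i, out @ bs)"
    by (simp add: emitop_def case_prod_unfold)
  then show ?thesis using assms by (rule wp_Switch)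
qed

lemma wp_print:
  assumes "\<And>v. wp (f v) \<rho> i (out @ concat (map g (tape_of B l \<rho>))) t"
  shows "wp (Switch (printop g) f) \<rho> i out t"
proof -
  have "op_sem w (printop g) (tape_of B l \<rho>, i, out) = (0, tape_of B l \<rho>, i, out @ concat (map g (tape_of B l \<rho>)))"
    by (simp add: printop_def case_prod_unfold)
  then show ?thesis using assms by (rule wp_Switch)
qed

lemma wp_inp:
  assumes "wp (f (vf (read_input w i))) \<rho> (min (length w + 1) (move d i)) out t"
  shows "wp (Switch (Inp vf d) f) \<rho> i out t"
  using assms by (intro wp_Switch) auto

lemma good_upd: "good \<rho> \<Longrightarrow> v < N \<Longrightarrow> good (\<rho>(r := v))"
  by (auto simp: good_def)

end

section \<open>Numbers spread over several registers\<close>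

fun mval :: "nat \<Rightarrow> ('r \<Rightarrow> nat) \<Rightarrow> 'r list \<Rightarrow> nat" where
  "mval N \<rho> [] = 0"
| "mval N \<rho> (r # rs) = \<rho> r + N * mval N \<rho> rs"

text \<open>Ripple carry through a list of registers that serve as digits in base \<open>N\<close>;
  the flag reports overflow of the whole list.\<close>

fun minc :: "nat \<Rightarrow> 'r list \<Rightarrow> ('r \<Rightarrow> nat) \<Rightarrow> ('r \<Rightarrow> nat) \<times> bool" where
  "minc N [] \<rho> = (\<rho>, True)"
| "minc N (r # rs) \<rho> = (if \<rho> r + 1 = N then minc N rs (\<rho>(r := 0)) else (\<rho>(r := \<rho> r + 1), False))"

primrec incs :: "nat \<Rightarrow> 'r list \<Rightarrow> (bool \<Rightarrow> ('a,'r) com) \<Rightarrow> ('a,'r) com" where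
  "incs B [] k = k True"
| "incs B (r # rs) k = Switch (incop B r) (\<lambda>v. if v = 1 then incs B rs k else k False)"

lemma mval_cong: "(\<And>r. r \<in> set rs \<Longrightarrow> \<rho> r = \<rho>' r) \<Longrightarrow> mval N \<rho> rs = mval N \<rho>' rs"
  by (induction rs) auto

lemma mval_upd [simp]: "r \<notin> set rs \<Longrightarrow> mval N (\<rho>(r := v)) rs = mval N \<rho> rs"
  by (rule mval_cong) auto

lemma mval_append: "mval N \<rho> (rs @ rs') = mval N \<rho> rs + N ^ length rs * mval N \<rho> rs'"
  by (induction rs) (auto simp: algebra_simps)

lemma mval_less: "(\<And>r. r \<in> set rs \<Longrightarrow> \<rho> r < N) \<Longrightarrow> mval N \<rho> rs < N ^ length rs"
proof (induction rs)
  case (Cons r rs)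
  then have "\<rho> r + 1 \<le> N" "mval N \<rho> rs + 1 \<le> N ^ length rs" by (auto simp: Suc_le_eq)
  then have "\<rho> r + 1 + N * mval N \<rho> rs \<le> N * (mval N \<rho> rs + 1)" by simp
  also have "\<dots> \<le> N * N ^ length rs" using \<open>mval N \<rho> rs + 1 \<le> _\<close> by (rule mult_le_mono2)
  finally show ?case by simp
qed simp

lemma mval_inject:
  assumes "\<And>r. r \<in> set rs \<Longrightarrow> \<rho> r < N \<and> \<rho>' r < N" "mval N \<rho> rs = mval N \<rho>' rs" "r \<in> set rs"
  shows "\<rho> r = \<rho>' r"
  using assms
proof (induction rs)
  case (Cons s rs)
  have s: "\<rho> s < N" "\<rho>' s < N" using Cons.prems(1)[of s] by auto
  have "\<rho> s = \<rho>' s" using arg_cong[OF Cons.prems(2), of "\<lambda>x. x mod N"] s by simp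
  moreover have "mval N \<rho> rs = mval N \<rho>' rs" using Cons.prems(2) s calculation by simp
  ultimately show ?case using Cons by auto
qed simp

lemma minc_spec:
  assumes "distinct rs" "\<And>r. r \<in> set rs \<Longrightarrow> \<rho> r < N"
  shows "(snd (minc N rs \<rho>) \<longleftrightarrow> mval N \<rho> rs + 1 = N ^ length rs) \<and>
     mval N (fst (minc N rs \<rho>)) rs = (if mval N \<rho> rs + 1 = N ^ length rs then 0 else mval N \<rho> rs + 1) \<and>
     (\<forall>r. r \<notin> set rs \<longrightarrow> fst (minc N rs \<rho>) r = \<rho> r) \<and> (\<forall>r\<in>set rs. fst (minc N rs \<rho>) r < N)"
  using assms
proof (induction rs arbitrary: \<rho>)
  case (Cons r rs)
  have less: "mval N \<rho> rs < N ^ length rs" using Cons.prems by (intro mval_less) auto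
  have r: "\<rho> r < N" using Cons.prems by auto
  show ?case
  proof (cases "\<rho> r + 1 = N")
    case True
    define \<rho>0 where "\<rho>0 = \<rho>(r := 0)"
    have m0: "mval N \<rho>0 rs = mval N \<rho> rs" using Cons.prems(1) by (simp add: \<rho>0_def)
    have "\<And>s. s \<in> set rs \<Longrightarrow> \<rho>0 s < N" using Cons.prems by (auto simp: \<rho>0_def)
    then have IH: "(snd (minc N rs \<rho>0) \<longleftrightarrow> mval N \<rho> rs + 1 = N ^ length rs) \<and>
     mval N (fst (minc N rs \<rho>0)) rs = (if mval N \<rho> rs + 1 = N ^ length rs then 0 else mval N \<rho> rs + 1) \<and>
     (\<forall>s. s \<notin> set rs \<longrightarrow> fst (minc N rs \<rho>0) s = \<rho>0 s) \<and> (\<forall>s\<in>set rs. fst (minc N rs \<rho>0) s < N)"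
      using Cons.IH[of \<rho>0] Cons.prems(1) unfolding m0 by simp
    have e: "\<rho> r + N * mval N \<rho> rs + 1 = N * (mval N \<rho> rs + 1)" using True by simp
    have e': "\<rho> r + N * mval N \<rho> rs + 1 = N * N ^ length rs \<longleftrightarrow> mval N \<rho> rs + 1 = N ^ length rs"
      unfolding e using r by (simp del: mult_Suc_right)
    have 0: "\<rho>0 r = 0" "\<And>s. s \<noteq> r \<Longrightarrow> \<rho>0 s = \<rho> s" by (auto simp: \<rho>0_def)
    have u: "minc N (r # rs) \<rho> = minc N rs \<rho>0" using True by (simp add: \<rho>0_def)
    have "fst (minc N rs \<rho>0) r = 0" using IH Cons.prems 0 by simp
    then show ?thesis unfolding u using IH e e' r 0 Cons.prems(1) by auto
  next
    case False
    then have lt: "\<rho> r + 1 < N" using r by simp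
    \<comment> \<open>The lowest digit in base \<open>N\<close> is positive on the left and 0 on the
      right.\<close>
    have "\<rho> r + N * mval N \<rho> rs + 1 \<noteq> N * N ^ length rs"
    proof
      assume "\<rho> r + N * mval N \<rho> rs + 1 = N * N ^ length rs"
      then have "(\<rho> r + 1 + N * mval N \<rho> rs) mod N = 0" by simp
      then have "(\<rho> r + 1) mod N = 0" by simp
      then show False using False r by simp
    qed
    moreover have "mval N (\<rho>(r := \<rho> r + 1)) rs = mval N \<rho> rs" using Cons.prems(1) by (intro mval_upd) simp
    moreover have "minc N (r # rs) \<rho> = (\<rho>(r := \<rho> r + 1), False)" using False by simp
    ultimately show ?thesis using lt Cons.prems by (auto simp del: minc.simps simp: fun_upd_def)
  qed
qed simp

context regs begin

lemma good_minc: "good \<rho> \<Longrightarrow> good (fst (minc N rs \<rho>))"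
proof (induction rs arbitrary: \<rho>)
  case (Cons r rs)
  then show ?case using N_pos by (auto simp: good_def intro: Suc_lessI)
qed simp

lemma wp_incs:
  assumes "good \<rho>" "wp (k (snd (minc N rs \<rho>))) (fst (minc N rs \<rho>)) i out t"
  shows "wp (incs B rs k) \<rho> i out t"
  using assms
proof (induction rs arbitrary: \<rho>)
  case (Cons r rs)
  have "good (\<rho>(r := 0))" using Cons.prems N_pos by (auto simp: good_def)
  then have "wp (if (if \<rho> r + 1 = N then 1 else 0) = (1::nat) then incs B rs k else k False)
     (\<rho>(r := if \<rho> r + 1 = N then 0 else \<rho> r + 1)) i out t"
    using Cons.IH[of "\<rho>(r := 0)"] Cons.prems(2) by (cases "\<rho> r + 1 = N") (simp_all add: fun_upd_def)
  then show ?case unfolding incs.simps by (rule wp_inc[OF Cons.prems(1)])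
qed simp

end

section \<open>Configurations as numbers\<close>

text \<open>The cell next to the head is the least significant digit, so pushing and popping act at
  the head. The bottom marker lies below cell 0.\<close>

fun encL :: "nat \<Rightarrow> nat \<Rightarrow> (nat \<Rightarrow> nat) \<Rightarrow> nat \<Rightarrow> nat" where
  "encL B mk t 0 = mk"
| "encL B mk t (Suc p) = encL B mk t p * B + t p"

text \<open>The scanned cell is the least significant digit; cells from \<open>Z\<close> on are
  omitted, as they will always be blank.\<close>

definition encR :: "nat \<Rightarrow> (nat \<Rightarrow> nat) \<Rightarrow> nat \<Rightarrow> nat \<Rightarrow> nat" where
  "encR B t p Z = foldr (\<lambda>i a. a * B + t i) [p..<Z] 0"

lemma encR_step: "p < Z \<Longrightarrow> encR B t p Z = encR B t (Suc p) Z * B + t p"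
  by (simp add: encR_def upt_conv_Cons)

lemma encR_cong: "(\<And>i. p \<le> i \<Longrightarrow> t i = t' i) \<Longrightarrow> encR B t p Z = encR B t' p Z"
  unfolding encR_def by (intro foldr_cong) auto

lemma encL_cong: "(\<And>i. i < p \<Longrightarrow> t i = t' i) \<Longrightarrow> encL B mk t p = encL B mk t' p"
  by (induction p) auto

lemma push_less: "x < B ^ k \<Longrightarrow> d < B \<Longrightarrow> x * B + d < B ^ Suc k" for x B d :: nat
proof -
  assume "x < B ^ k" "d < B"
  then have "x * B + d < (x + 1) * B" by simp
  also have "\<dots> \<le> B ^ k * B" using \<open>x < B ^ k\<close> by (intro mult_le_mono1) simp
  finally show ?thesis by (simp add: mult.commute)
qed

lemma encL_less: "mk < B \<Longrightarrow> (\<And>i. t i < B) \<Longrightarrow> encL B mk t p < B ^ Suc p"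
proof (induction p)
  case (Suc p)
  then show ?case using push_less[of "encL B mk t p" B "Suc p" "t p"] by simp
qed simp

lemma encR_less: "0 < B \<Longrightarrow> (\<And>i. t i < B) \<Longrightarrow> p \<le> Z \<Longrightarrow> encR B t p Z < B ^ (Z - p)"
proof (induction "Z - p" arbitrary: p)
  case (Suc k)
  then have "p < Z" by simp
  have "k = Z - Suc p" using Suc.hyps(2) by simp
  then have "encR B t (Suc p) Z < B ^ k" "Z - p = Suc k"
    using Suc.hyps(1)[of "Suc p"] Suc.prems Suc.hyps(2) \<open>p < Z\<close> by auto
  then show ?case using push_less[of _ B k "t p"] encR_step[OF \<open>p < Z\<close>] Suc by simp
qed (simp add: encR_def)

lemma encL_pos: "0 < mk \<Longrightarrow> 0 < B \<Longrightarrow> 0 < encL B mk t p"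
  by (induction p) auto

type_synonym trans = "nat \<times> nat \<times> dir \<times> dir \<times> unit option"

text \<open>Tape symbols and states serve as digits in base \<open>B\<close>, \<open>mk\<close> is the bottom marker of the left stack,
  and \<open>chs\<close> lists all transitions.\<close>
locale ntm =
  fixes M :: "('a, unit) tm" and Q \<Gamma> :: "nat set" and B mk :: nat and chs :: "trans list"
  assumes start: "tm_start M \<in> Q" and blank: "0 \<in> \<Gamma>"
    and closed: "\<And>q a s q' s' di dw ot. q \<in> Q \<Longrightarrow> s \<in> \<Gamma> \<Longrightarrow> (q',s',di,dw,ot) \<in> tm_delta M q a s \<Longrightarrow>
      q' \<in> Q \<and> s' \<in> \<Gamma> \<and> (q',s',di,dw,ot) \<in> set chs"
    and chs_less: "\<And>q' s' di dw ot. (q',s',di,dw,ot) \<in> set chs \<Longrightarrow> q' < B \<and> s' < B"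
    and Q_less: "\<And>q. q \<in> Q \<Longrightarrow> q < B" and G_less: "\<And>s. s \<in> \<Gamma> \<Longrightarrow> s < B"
    and mk: "0 < mk" "mk < B" "mk \<notin> \<Gamma>"

text \<open>With \<open>Z < l\<close> a register can hold all cells below \<open>Z\<close> together
  with the state, as well as the left stack with its marker.\<close>

locale ntm_run = ntm M Q \<Gamma> B mk chs + regs B l N w
  for M :: "('a, unit) tm" and Q \<Gamma> B mk chs l N and w :: "'a list" +
  fixes Z :: nat
  assumes w_less: "length w + 1 < N"
    and Z_less: "Z < l"
    and bounded: "\<And>c. reachable M w c \<Longrightarrow> c_wpos c < Z"
begin

abbreviation push :: "nat \<Rightarrow> nat \<Rightarrow> nat" where "push x d \<equiv> (x * B + d) mod N"

text \<open>The wrap to 0 reflects an overflowing register. It occurs only for positions beyond the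
  right end marker, which belong to no configuration.\<close>

fun imove :: "dir \<Rightarrow> nat \<Rightarrow> nat" where
  "imove Lft i = i - 1"
| "imove Stay i = i"
| "imove Rgt i = (if i = length w + 1 then i else if i + 1 = N then 0 else i + 1)"

text \<open>Meeting the marker means that the head is on cell 0, where a move to the left has no
  effect: the marker is put back and the head stays.\<close>

fun wmove :: "dir \<Rightarrow> nat \<Rightarrow> nat \<Rightarrow> nat \<Rightarrow> nat \<times> nat" where
  "wmove Rgt s L R = (push L s, R)"
| "wmove Stay s L R = (L, push R s)"
| "wmove Lft s L R = (if L mod B = mk then (push (L div B) mk, push R s)
     else (L div B, push (push R s) (L mod B)))"

text \<open>The state is the topmost digit of the right stack \<open>R\<close>, the scanned symbol the one below it. On numbers
  that encode no configuration the result is meaningless but harmless.\<close>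
fun vstep :: "trans \<Rightarrow> nat \<times> nat \<times> nat \<Rightarrow> nat \<times> nat \<times> nat" where
  "vstep ch (L, R, I) = (let q = R mod B; s = R div B mod B; R2 = R div B div B in
     if ch \<in> tm_delta M q (read_input w I) s then
       (case ch of (q',s',di,dw,ot) \<Rightarrow> case wmove dw s' L R2 of (L',R') \<Rightarrow> (L', push R' q', imove di I))
     else (L, push (push R2 s) q, I))"

definition enc :: "unit conf \<Rightarrow> nat \<times> nat \<times> nat" where
  "enc c = (encL B mk (c_tape c) (c_wpos c),
     encR B (c_tape c) (c_wpos c) Z * B + c_state c, c_ipos c)"

definition valid :: "unit conf \<Rightarrow> bool" where
  "valid c \<longleftrightarrow> c_state c \<in> Q \<and> (\<forall>i. c_tape c i \<in> \<Gamma>) \<and> (\<forall>i\<ge>Z. c_tape c i = 0) \<and> c_wpos c < Z \<and>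
     c_ipos c \<le> length w + 1"

lemma pow_le_N: "k \<le> l \<Longrightarrow> B ^ k \<le> N"
  using B by (simp add: N_def)

lemma push_lessD: "x * B + d < N \<Longrightarrow> x < N"
proof -
  assume "x * B + d < N"
  moreover have "x * 1 \<le> x * B" using B by (intro mult_le_mono2) simp
  ultimately show ?thesis by linarith
qed

text \<open>The marker makes the left stack positive; this is where the positive codes required for
  counting come from.\<close>

lemma enc_bounds:
  assumes "valid c" "enc c = (L,R,I)"
  shows "0 < L \<and> L < N \<and> R < N \<and> I < N"
proof -
  have t: "c_tape c i < B" for i using assms G_less by (auto simp: valid_def)
  have "L < B ^ Suc (c_wpos c)" using encL_less[of mk B "c_tape c" "c_wpos c"] mk(2) t assms by (simp add: enc_def del: power_Suc)
  moreover have "encR B (c_tape c) (c_wpos c) Z < B ^ (Z - c_wpos c)"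
    using assms B t by (intro encR_less) (auto simp: valid_def)
  then have "R < B ^ Suc (Z - c_wpos c)"
    using push_less Q_less assms by (auto simp: valid_def enc_def simp del: power_Suc)
  moreover have "Suc (c_wpos c) \<le> l" "Suc (Z - c_wpos c) \<le> l" using assms Z_less by (auto simp: valid_def)
  ultimately have "L < N" "R < N" using pow_le_N order_less_le_trans by blast+
  moreover have "I < N" using assms w_less by (auto simp: valid_def enc_def)
  moreover have "0 < L" using assms encL_pos[of mk B "c_tape c" "c_wpos c"] mk B by (simp add: enc_def)
  ultimately show ?thesis by simp
qed

definition next_conf :: "trans \<Rightarrow> unit conf \<Rightarrow> unit conf" where
  "next_conf ch c = (case ch of (q',s',di,dw,ot) \<Rightarrow>
     \<lparr> c_state = q', c_ipos = min (length w + 1) (move di (c_ipos c)),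
       c_tape = (c_tape c)(c_wpos c := s'), c_wpos = move dw (c_wpos c),
       c_out = c_out c @ (case ot of None \<Rightarrow> [] | Some x \<Rightarrow> [x]) \<rparr>)"

lemma step_iff: "step M w c c' \<longleftrightarrow>
  (\<exists>ch\<in>tm_delta M (c_state c) (read_input w (c_ipos c)) (c_tape c (c_wpos c)). c' = next_conf ch c)"
  by (simp add: step_def next_conf_def Bex_def split_paired_Ex)

text \<open>An inapplicable transition leaves the code as it is. Such loops do not change what is
  reachable, and each vertex obtains exactly \<open>length chs\<close> successors.\<close>

lemma vstep_enc:
  assumes v: "valid c" and v': "ch \<in> tm_delta M (c_state c) (read_input w (c_ipos c)) (c_tape c (c_wpos c)) \<Longrightarrow>
      valid (next_conf ch c)"
  shows "vstep ch (enc c) =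
    (if ch \<in> tm_delta M (c_state c) (read_input w (c_ipos c)) (c_tape c (c_wpos c)) then enc (next_conf ch c) else enc c)"
proof -
  let ?t = "c_tape c" and ?p = "c_wpos c" and ?q = "c_state c"
  have t: "?t i < B" for i using v G_less by (auto simp: valid_def)
  have q: "?q < B" using v Q_less by (auto simp: valid_def)
  have p: "?p < Z" using v by (simp add: valid_def)
  let ?R2 = "encR B ?t (Suc ?p) Z"
  have R: "encR B ?t ?p Z = ?R2 * B + ?t ?p" by (rule encR_step[OF p])
  let ?R = "(?R2 * B + ?t ?p) * B + ?q"
  have d: "?R mod B = ?q" "?R div B mod B = ?t ?p" "?R div B div B = ?R2" using q t[of ?p] by simp_all
  have e: "enc c = (encL B mk ?t ?p, ?R, c_ipos c)" by (simp add: enc_def R)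
  have vs: "vstep ch (enc c) = (if ch \<in> tm_delta M ?q (read_input w (c_ipos c)) (?t ?p) then
       (case ch of (q',s',di,dw,ot) \<Rightarrow> case wmove dw s' (encL B mk ?t ?p) ?R2 of (L',R') \<Rightarrow>
          (L', push R' q', imove di (c_ipos c)))
     else (encL B mk ?t ?p, push (push ?R2 (?t ?p)) ?q, c_ipos c))"
    by (simp only: e vstep.simps Let_def d)
  show ?thesis
  proof (cases "ch \<in> tm_delta M ?q (read_input w (c_ipos c)) (?t ?p)")
    case False
    have "?R < N" using enc_bounds[OF v e] by simp
    moreover have "?R2 * B + ?t ?p < N" using calculation push_lessD by blast
    ultimately show ?thesis using False unfolding vs by (simp add: e)
  next
    case True
    obtain q' s' di dw ot where ch: "ch = (q',s',di,dw,ot)" by (cases ch)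
    let ?c = "next_conf ch c"
    let ?t' = "?t(?p := s')"
    have vc: "valid ?c" using v' True by simp
    obtain L' R' I' where e': "enc ?c = (L',R',I')" by (cases "enc ?c")
    \<comment> \<open>Because the code of the successor is below \<open>N\<close>, no reduction
      modulo \<open>N\<close> takes effect in what follows.\<close>
    have b: "L' < N" "R' < N" "I' < N" using enc_bounds[OF vc e'] by auto
    have q'B: "q' < B" using closed[of ?q "?t ?p"] v True Q_less unfolding ch by (auto simp: valid_def)
    have R2': "encR B ?t' (Suc ?p) Z = ?R2" by (rule encR_cong) auto
    have L': "encL B mk ?t' k = encL B mk ?t k" if "k \<le> ?p" for k by (rule encL_cong) (use that in auto)
    have I: "imove di (c_ipos c) = c_ipos ?c"
    proof (cases di)
      case Rgt
      then show ?thesis using v w_less by (auto simp: next_conf_def ch valid_def)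
    qed (use v in \<open>auto simp: next_conf_def ch valid_def\<close>)
    have "case wmove dw s' (encL B mk ?t ?p) ?R2 of (L1,R1) \<Rightarrow>
       L1 = encL B mk ?t' (move dw ?p) \<and> push R1 q' = encR B ?t' (move dw ?p) Z * B + q'"
    proof (cases dw)
      case Rgt
      have "encL B mk ?t' (Suc ?p) = encL B mk ?t ?p * B + s'" by (simp add: L')
      then show ?thesis using Rgt e' b R2' by (auto simp: enc_def next_conf_def ch)
    next
      case Stay
      have "encR B ?t' ?p Z = ?R2 * B + s'" using encR_step[OF p, of B ?t'] R2' by simp
      moreover have "(?R2 * B + s') * B + q' < N" using Stay e' b calculation by (auto simp: enc_def next_conf_def ch)
      moreover have "?R2 * B + s' < N" using calculation(2) push_lessD by blast
      ultimately show ?thesis using Stay by (simp add: L')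
    next
      case Lft
      show ?thesis
      proof (cases ?p)
        case 0
        have "encR B ?t' 0 Z = ?R2 * B + s'" using encR_step[OF p, of B ?t'] R2' 0 by simp
        moreover have "(?R2 * B + s') * B + q' < N" using Lft e' b calculation 0 by (auto simp: enc_def next_conf_def ch)
        moreover have "?R2 * B + s' < N" using calculation(2) push_lessD by blast
        moreover have "mk < N" using enc_bounds[OF v e] 0 by simp
        ultimately show ?thesis using Lft 0 mk by simp
      next
        case (Suc p')
        \<comment> \<open>The marker is no tape symbol, so the bottom of the stack is not confused
          with a cell.\<close>
        have tp: "?t p' \<noteq> mk" using v mk by (auto simp: valid_def)
        have L1: "encL B mk ?t ?p mod B = ?t p'" "encL B mk ?t ?p div B = encL B mk ?t p'"
          unfolding Suc using t[of p'] by simp_all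
        have "encR B ?t' ?p Z = ?R2 * B + s'" using encR_step[OF p, of B ?t'] R2' by simp
        moreover have "p' < Z" using p Suc by simp
        ultimately have r: "encR B ?t' p' Z = (?R2 * B + s') * B + ?t p'"
          using encR_step[of p' Z B ?t'] Suc by simp
        then have 1: "((?R2 * B + s') * B + ?t p') * B + q' < N" using Lft e' b Suc by (auto simp: enc_def next_conf_def ch)
        then have 2: "(?R2 * B + s') * B + ?t p' < N" using push_lessD by blast
        then have 3: "?R2 * B + s' < N" using push_lessD by blast
        have "wmove dw s' (encL B mk ?t ?p) ?R2 = (encL B mk ?t p', (?R2 * B + s') * B + ?t p')"
          using Lft tp L1 2 3 by simp
        then show ?thesis using Lft Suc r 1 L'[of p'] by simp
      qed
    qed
    then show ?thesis using True I unfolding vs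
      by (auto simp: ch enc_def next_conf_def split: prod.splits)
  qed
qed

lemma valid_init: "valid (init_conf M)"
  using start blank bounded[of "init_conf M"] by (auto simp: valid_def init_conf_def reachable_def)

lemma valid_step:
  assumes "valid c" "reachable M w c"
    and "ch \<in> tm_delta M (c_state c) (read_input w (c_ipos c)) (c_tape c (c_wpos c))"
  shows "valid (next_conf ch c) \<and> reachable M w (next_conf ch c) \<and> ch \<in> set chs"
proof -
  obtain q' s' di dw ot where ch: "ch = (q',s',di,dw,ot)" by (cases ch)
  have "step M w c (next_conf ch c)" using assms(3) step_iff by blast
  then have r: "reachable M w (next_conf ch c)" using assms(2) unfolding reachable_def by (rule rtranclp.rtrancl_into_rtrancl[rotated])
  have "c_state c \<in> Q" "c_tape c (c_wpos c) \<in> \<Gamma>" using assms(1) by (auto simp: valid_def)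
  then have "q' \<in> Q \<and> s' \<in> \<Gamma> \<and> ch \<in> set chs" using closed assms(3) ch by blast
  then show ?thesis using r bounded[OF r] assms(1) by (auto simp: valid_def next_conf_def ch)
qed

lemma reachable_valid: "reachable M w c \<Longrightarrow> valid c"
proof -
  assume "reachable M w c"
  then have "(step M w)\<^sup>*\<^sup>* (init_conf M) c" by (simp add: reachable_def)
  then have "valid c \<and> reachable M w c"
  proof (induction rule: rtranclp_induct)
    case base
    then show ?case using valid_init by (simp add: reachable_def)
  next
    case (step y z)
    from step.hyps(2) obtain ch where
      "ch \<in> tm_delta M (c_state y) (read_input w (c_ipos y)) (c_tape y (c_wpos y))" "z = next_conf ch y"
      unfolding step_iff by blast
    then show ?case using valid_step[of y ch] step.IH by simp
  qed
  then show ?thesis ..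
qed

section \<open>Configurations as vertices of the counted graph\<close>

definition num3 :: "nat \<times> nat \<times> nat \<Rightarrow> nat" where
  "num3 x = (case x of (a,b,c) \<Rightarrow> a + N * (b + N * c))"

definition comps :: "nat \<Rightarrow> nat \<times> nat \<times> nat" where
  "comps x = (x mod N, x div N mod N, x div N div N)"

lemma comps_num3: "a < N \<Longrightarrow> b < N \<Longrightarrow> comps (num3 (a,b,c)) = (a,b,c)"
  by (simp add: comps_def num3_def)

definition vnum :: "nat \<Rightarrow> nat \<Rightarrow> nat" where
  "vnum i x = num3 (vstep (chs ! i) (comps x))"

definition vacc :: "nat \<Rightarrow> bool" where
  "vacc x \<longleftrightarrow> fst (snd (comps x)) mod B \<in> tm_accept M"

text \<open>This is what two pushes onto registers with value 0 produce; as
  \<open>B \<le> N\<close>, the reductions do not change the digits.\<close>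

definition vstart :: nat where "vstart = num3 (mk mod N, tm_start M mod N, 0)"

lemma comps_enc: "valid c \<Longrightarrow> comps (num3 (enc c)) = enc c"
  using enc_bounds[of c] comps_num3 by (cases "enc c") auto

lemma B_le_N: "B \<le> N" using pow_le_N[of 1] Z_less by simp

lemma vstart_enc: "vstart = num3 (enc (init_conf M))"
proof -
  have "encR B (\<lambda>_. 0) 0 Z = 0" unfolding encR_def by (induction Z) auto
  moreover have "mk < N" "tm_start M < N" using mk(2) Q_less[OF start] B_le_N by auto
  ultimately show ?thesis by (simp add: vstart_def enc_def init_conf_def)
qed

lemma vnum_enc:
  assumes "reachable M w c" "i < length chs"
  shows "\<exists>c'. reachable M w c' \<and> vnum i (num3 (enc c)) = num3 (enc c')"
proof -
  have v: "valid c" using reachable_valid assms by simp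
  show ?thesis
    unfolding vnum_def comps_enc[OF v]
    using vstep_enc[OF v, of "chs ! i"] valid_step[OF v assms(1), of "chs ! i"] assms by (auto split: if_splits)
qed

sublocale counting "N * N * N" "length chs" vnum vstart vacc .

lemma lev_reachable: "x \<in> lev d \<Longrightarrow> \<exists>c. reachable M w c \<and> x = num3 (enc c)"
proof (induction d arbitrary: x)
  case 0
  then have "x = vstart" by simp
  then have "x = num3 (enc (init_conf M))" using vstart_enc by (rule trans)
  moreover have "reachable M w (init_conf M)" by (simp add: reachable_def)
  ultimately show ?case by blast
next
  case (Suc d)
  then consider "x \<in> lev d" | i y where "i < length chs" "y \<in> lev d" "x = vnum i y" by auto
  then show ?case
  proof cases
    case 2
    then show ?thesis using Suc.IH[of y] vnum_enc by metis
  qed (rule Suc.IH)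
qed

lemma reachable_lev: 
  assumes "reachable M w c"
  shows "\<exists>d. num3 (enc c) \<in> lev d"
proof -
  have "(step M w)\<^sup>*\<^sup>* (init_conf M) c" using assms by (simp add: reachable_def)
  then have "reachable M w c \<and> (\<exists>d. num3 (enc c) \<in> lev d)"
  proof (induction rule: rtranclp_induct)
    case base
    have "num3 (enc (init_conf M)) \<in> lev 0" using vstart_enc by (metis lev.simps(1) singletonI)
    then show ?case by (auto simp: reachable_def simp del: lev.simps)
  next
    case (step y z)
    then obtain d where d: "num3 (enc y) \<in> lev d" and r: "reachable M w y" by blast
    obtain ch where ch: "ch \<in> tm_delta M (c_state y) (read_input w (c_ipos y)) (c_tape y (c_wpos y))"
      "z = next_conf ch y" using step_iff step.hyps(2) by blast
    have v: "valid y" using reachable_valid r by simp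
    have n: "valid z" "reachable M w z" "ch \<in> set chs" using valid_step[OF v r ch(1)] ch(2) by auto
    then obtain i where i: "i < length chs" "chs ! i = ch" by (meson in_set_conv_nth)
    have "vnum i (num3 (enc y)) = num3 (enc z)"
      unfolding vnum_def comps_enc[OF v] i(2) using vstep_enc[OF v, of ch] n ch by simp
    then have "num3 (enc z) \<in> lev (Suc d)" using d i unfolding lev_Suc_iff by blast
    then show ?case using n by blast
  qed
  then show ?thesis by blast
qed

lemma num3_less:
  assumes "a < N" "b < N" "c < N"
  shows "num3 (a,b,c) < N * N * N"
proof -
  have "b + N * c < N * N" using push_less[of c N 1 b] assms by (simp add: mult.commute add.commute)
  then show ?thesis using push_less[of "b + N * c" N 2 a] assms
    by (simp add: num3_def mult.commute mult.assoc add.commute power2_eq_square power3_eq_cube)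
qed

lemma num3_pos: "0 < a \<Longrightarrow> 0 < num3 (a,b,c)" by (simp add: num3_def)

sublocale counting_ok "N * N * N" "length chs" vnum vstart vacc
proof
  fix d x assume "x \<in> lev d"
  then obtain c where c: "reachable M w c" "x = num3 (enc c)" using lev_reachable by blast
  obtain L R I where e: "enc c = (L,R,I)" by (cases "enc c")
  have "0 < L \<and> L < N \<and> R < N \<and> I < N" using enc_bounds[OF reachable_valid[OF c(1)] e] .
  then show "0 < x" "x < N * N * N" unfolding c(2) e using num3_pos num3_less by auto
qed

text \<open>The procedure accepts exactly when \<open>M\<close> does not; the circuit, which
  expresses that accepting is impossible, negates a second time.\<close>

theorem accepts_iff: "accepts M w \<longleftrightarrow> \<not> (\<exists>\<eta>. ((CI, \<lambda>_. 0), (CAcc, \<eta>)) \<in> irel\<^sup>*)"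
proof -
  have a: "vacc (num3 (enc c)) \<longleftrightarrow> c_state c \<in> tm_accept M" if "reachable M w c" for c
  proof -
    have v: "valid c" using reachable_valid that by simp
    then have "c_state c < B" using Q_less by (simp add: valid_def)
    then show ?thesis unfolding vacc_def comps_enc[OF v] by (simp add: enc_def)
  qed
  show ?thesis unfolding acc_reachable_iff accepts_def using a lev_reachable reachable_lev by metis
qed

end

section \<open>The program printing the circuit\<close>

lemma okop_basic:
  assumes "2 \<le> B"
  shows "okop B B (incop B r)" "okop B B (decop B r)" "okop B B (nzop r)" "okop B B (eqop ps)"
    "okop B B (asgop \<sigma>)" "d < B \<Longrightarrow> okop B B (pushop r d)" "okop B B (popop r)" "okop B B (emitop bs)"
    "okop B B (printop g)" "x \<in> cells B \<Longrightarrow> okop B B (extop x)"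
proof -
  have "Suc n < B" if "n < B" "n \<noteq> B - Suc 0" for n using that by linarith
  then show "okop B B (incop B r)" "okop B B (decop B r)"
    using assms by (auto simp: incop_def decop_def g_inc_def g_dec_def cells_def less_imp_diff_less)
  show "okop B B (nzop r)" "okop B B (eqop ps)"
    using assms by (auto simp: nzop_def eqop_def g_nz_def g_eq_def)
  show "okop B B (asgop \<sigma>)"
    using assms by (auto simp: asgop_def g_asg_def cells_def split: option.splits)
  show "d < B \<Longrightarrow> okop B B (pushop r d)" "okop B B (popop r)"
    using assms by (auto simp: pushop_def popop_def g_push_def g_pop_def cells_def)
  show "okop B B (emitop bs)" "okop B B (printop g)" "x \<in> cells B \<Longrightarrow> okop B B (extop x)"
    using assms by (auto simp: emitop_def printop_def extop_def)
qed

lemma okcom_incs: "2 \<le> B \<Longrightarrow> okcom B B (k True) \<Longrightarrow> okcom B B (k False) \<Longrightarrow> okcom B B (incs B rs k)"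
  by (induction rs) (auto simp: okop_basic)

datatype idx = J0 | J1 | J2
text \<open>Register banks: main variables (\<open>KM\<close>) and the clock (\<open>KT\<close>, \<open>KU\<close>), their backup copies
  (\<open>KB\<close>, \<open>KC\<close>, \<open>KD\<close>), and auxiliary registers (\<open>KX\<close>).\<close>
datatype bank = KM | KT | KU | KB | KC | KD | KX

type_synonym reg = "bank \<times> var \<times> idx"

instance var :: finite
proof
  have "(UNIV :: var set) = {VD,VC,VV,VE,VU,VM,VX,VL}" using var.exhaust by blast
  then show "finite (UNIV :: var set)" by (metis finite.emptyI finite_insert)
qed

instance idx :: finite
proof
  have "(UNIV :: idx set) = {J0,J1,J2}" using idx.exhaust by blast
  then show "finite (UNIV :: idx set)" by (metis finite.emptyI finite_insert)
qed

instance bank :: finite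
proof
  have "(UNIV :: bank set) = {KM,KT,KU,KB,KC,KD,KX}" using bank.exhaust by blast
  then show "finite (UNIV :: bank set)" by (metis finite.emptyI finite_insert)
qed

text \<open>A variable ranges over codes of configurations and so takes three registers: two stacks
  and the input position.\<close>

definition bun :: "bank \<Rightarrow> var \<Rightarrow> reg list" where "bun k v = [(k,v,J0), (k,v,J1), (k,v,J2)]"
definition allvars :: "var list" where "allvars = [VD,VC,VV,VE,VU,VM,VX,VL]"
definition main_regs :: "reg list" where "main_regs = concat (map (bun KM) allvars)"
text \<open>The clock gets two banks, because the bound \<open>2 * length ctrls * N ^ 24\<close> on
  the number of edges exceeds the \<open>N ^ 24\<close> values of a single one.\<close>

definition time_regs :: "reg list" where "time_regs = concat (map (bun KT) allvars) @ concat (map (bun KU) allvars)"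
text \<open>The clock comes last and is therefore most significant, which puts the layers of the
  circuit in the right order.\<close>

definition all_regs :: "reg list" where "all_regs = main_regs @ time_regs"

text \<open>\<open>NN\<close> holds the position of the right end marker, \<open>PP\<close> counts
  down while the input head is being placed, \<open>FL\<close> ends the main loop, and
  \<open>ZZ\<close> stays 0 to be compared with \<open>FL\<close>.\<close>

abbreviation NN :: reg where "NN \<equiv> (KX,VD,J0)"
abbreviation PP :: reg where "PP \<equiv> (KX,VC,J0)"
abbreviation FL :: reg where "FL \<equiv> (KX,VV,J0)"
abbreviation ZZ :: reg where "ZZ \<equiv> (KX,VE,J0)"
abbreviation XL :: reg where "XL \<equiv> (KM,VX,J0)"
abbreviation XR :: reg where "XR \<equiv> (KM,VX,J1)"
abbreviation XI :: reg where "XI \<equiv> (KM,VX,J2)"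

abbreviation Do :: "('a,'r) oper \<Rightarrow> ('a,'r) com \<Rightarrow> ('a,'r) com" where
  "Do p k \<equiv> Switch p (\<lambda>_. k)"

type_synonym 'a prog = "('a, reg) com"

text \<open>The first move leaves the right end marker, which reads like the left one and would stop
  the loop at once.\<close>

definition rewind :: "'a prog \<Rightarrow> 'a prog" where
  "rewind k = Do (Inp (\<lambda>_. 0) Lft)
     (Seq (While (Inp (\<lambda>a. case a of None \<Rightarrow> 0 | Some _ \<Rightarrow> 1) Lft) Skip) k)"

definition asgM :: "(var \<Rightarrow> var option) \<Rightarrow> reg \<Rightarrow> reg option" where
  "asgM \<sigma> = (\<lambda>(k,v,j). if k = KM then map_option (\<lambda>u. (KM,u,j)) (\<sigma> v) else Some (k,v,j))"

definition eqv :: "var \<Rightarrow> var \<Rightarrow> (bool \<Rightarrow> 'a prog) \<Rightarrow> 'a prog" where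
  "eqv u v k = Switch (eqop (zip (bun KM u) (bun KM v))) (\<lambda>z. k (z = 1))"

definition bits_code :: "bool list \<Rightarrow> bool list" where
  "bits_code bs = concat (map (\<lambda>b. tok_code (if b then T1 else T0)) bs)"

text \<open>Digits and control states are written in unary, padded to fixed length: names then are injective, and
  their order is governed by the control state.\<close>
definition dcode :: "nat \<Rightarrow> nat \<Rightarrow> bool list" where
  "dcode B d = replicate d True @ replicate (B - d) False"

definition cell_bits :: "nat \<Rightarrow> reg cell \<Rightarrow> bool list" where
  "cell_bits B x = concat (map (\<lambda>r. dcode B (x r)) all_regs)"

text \<open>Where the choice matters, \<open>False\<close> leads to the smaller code:
  \<open>CD\<close> precedes \<open>CW\<close>, and \<open>CS f i\<close> precedes
  \<open>CW f (i + 1)\<close>. The factor 4 interleaves both families without collisions.\<close>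

fun ccode :: "ctrl \<Rightarrow> nat" where
  "ccode CI = 0" | "ccode CAcc = 1" | "ccode CDead = 2" | "ccode CA = 3" | "ccode CF = 4"
| "ccode (CB f) = 5 + of_bool f" | "ccode (CC f) = 7 + of_bool f" | "ccode (CD f) = 9 + of_bool f"
| "ccode (CE f) = 11 + of_bool f" | "ccode (CS f i) = 13 + 4 * i + of_bool f"
| "ccode (CW f i) = 15 + 4 * i + of_bool f"

definition copy_regs :: "reg \<Rightarrow> reg option" where
  "copy_regs = (\<lambda>(k,y). Some (case k of KB \<Rightarrow> KM | KC \<Rightarrow> KT | KD \<Rightarrow> KU | _ \<Rightarrow> k, y))"
definition restore_regs :: "reg \<Rightarrow> reg option" where
  "restore_regs = (\<lambda>(k,y). Some (case k of KM \<Rightarrow> KB | KT \<Rightarrow> KC | KU \<Rightarrow> KD | _ \<Rightarrow> k, y))"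

lemma okcom_eqv:
  "2 \<le> B \<Longrightarrow> okcom B B (k True) \<Longrightarrow> okcom B B (k False) \<Longrightarrow> okcom B B (eqv u v k)"
  unfolding eqv_def by (auto simp: okop_basic) (metis (full_types))

lemma okcom_rewind: "2 \<le> B \<Longrightarrow> okcom B B k \<Longrightarrow> okcom B B (rewind k)"
  by (auto simp: rewind_def split: option.splits)

context ntm begin

definition "ncc = 17 + 4 * length chs"

fun ctrl_ok :: "ctrl \<Rightarrow> bool" where
  "ctrl_ok (CW f i) \<longleftrightarrow> i \<le> length chs"
| "ctrl_ok (CS f i) \<longleftrightarrow> i < length chs"
| "ctrl_ok _ \<longleftrightarrow> True"

definition ctrls :: "ctrl list" where
  "ctrls = [CI, CAcc, CDead, CA, CF] @ concat (map (\<lambda>f. [CB f, CC f, CD f, CE f] @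
     map (CS f) [0..<length chs] @ map (CW f) [0..<Suc (length chs)]) [False, True])"

lemma set_ctrls: "p \<in> set ctrls \<longleftrightarrow> ctrl_ok p"
  by (cases p) (auto simp: ctrls_def)

fun wcom :: "dir \<Rightarrow> nat \<Rightarrow> 'a prog \<Rightarrow> 'a prog" where
  "wcom Rgt s k = Do (pushop XL s) k"
| "wcom Stay s k = Do (pushop XR s) k"
| "wcom Lft s k = Switch (popop XL) (\<lambda>y. if y = mk then Do (pushop XL mk) (Do (pushop XR s) k)
     else Do (pushop XR s) (Do (pushop XR y) k))"

fun icom :: "dir \<Rightarrow> 'a prog \<Rightarrow> 'a prog" where
  "icom Rgt k = Switch (eqop [(XI,NN)]) (\<lambda>v. if v = 1 then k else Do (incop B XI) k)"
| "icom Stay k = k"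
| "icom Lft k = Switch (nzop XI) (\<lambda>v. if v = 1 then Do (decop B XI) k else k)"

text \<open>The real input head does not follow the simulated one from gate to gate; it is placed
  afresh from the left end before each transition.\<close>

definition seek :: "'a prog \<Rightarrow> 'a prog" where
  "seek k = Do (asgop (\<lambda>r. if r = PP then Some XI else Some r))
     (rewind (Seq (While (nzop PP) (Do (decop B PP) (Do (Inp (\<lambda>_. 0) Rgt) Skip))) k))"

text \<open>State and symbol have been popped into the control, so applicability of the fixed
  transition \<open>ch\<close> depends only on the input symbol and is decided by the program
  text.\<close>

definition vcom :: "trans \<Rightarrow> 'a prog \<Rightarrow> 'a prog" where
  "vcom ch k = seek (Switch (popop XR) (\<lambda>q. Switch (popop XR) (\<lambda>s.
     Switch (Inp (\<lambda>a. if ch \<in> tm_delta M q a s then 1 else 0) Stay) (\<lambda>v.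
       if v = 1 then (case ch of (q',s',di,dw,ot) \<Rightarrow> wcom dw s' (Do (pushop XR q') (icom di k)))
       else Do (pushop XR s) (Do (pushop XR q) k)))))"

definition incv :: "var \<Rightarrow> (bool \<Rightarrow> 'a prog) \<Rightarrow> 'a prog" where
  "incv v k = incs B (bun KM v) k"

primrec test_succs :: "trans list \<Rightarrow> (bool \<Rightarrow> 'a prog) \<Rightarrow> bool \<Rightarrow> 'a prog" where
  "test_succs [] k f = Do (asgop (asgM (Some(VX := None)))) (k f)"
| "test_succs (ch # cs) k f = Do (asgop (asgM (Some(VX := Some VU)))) (vcom ch (eqv VX VV (\<lambda>e. test_succs cs k (f \<or> e))))"

text \<open>The counterpart of \<open>istep\<close> for a fixed control state and choice. The next
  control state is known only at run time; it is passed to the continuation.\<close>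

fun action :: "ctrl \<Rightarrow> bool \<Rightarrow> (ctrl \<Rightarrow> 'a prog) \<Rightarrow> 'a prog" where
  "action CI b k = incv VC (\<lambda>_. k CA)"
| "action CA b k = Do (asgop (asgM (Some(VU := None, VM := None)))) (k (CB False))"
| "action (CB f) b k = (if b then Do (asgop (asgM (Some(VX := None, VL := None))))
      (Do (pushop XL mk) (Do (pushop XR (tm_start M)) (k (CW f 0)))) else k (CD f))"
| "action (CW f i) b k = k (if i < length chs then (if b then CW f (i + 1) else CS f i) else CC f)"
| "action (CS f i) b k = eqv VL VD (\<lambda>e. if e then k CDead else vcom (chs ! i) (incv VL (\<lambda>_. k (CW f 0))))"
| "action (CC f) b k = eqv VX VU (\<lambda>e. if e then incv VM (\<lambda>_. eqv VU VV (\<lambda>e. test_succs chs (\<lambda>f. k (CD f)) (f \<or> e))) else k CDead)"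
| "action (CD f) b k = incv VU (\<lambda>ov. if ov then k (CE f) else k (CB f))"
| "action (CE f) b k = eqv VM VC (\<lambda>e. if e then (if f then
      Do (asgop (asgM (Some(VX := Some VV)))) (Switch (popop XR) (\<lambda>q. Do (asgop (asgM (Some(VX := None))))
        (if q \<in> tm_accept M then k CDead else incv VE (\<lambda>_. k CF))))
      else k CF) else k CDead)"
| "action CF b k = incv VV (\<lambda>ov. if ov then incv VD (\<lambda>ov. if ov then k CAcc
      else Do (asgop (asgM (Some(VC := Some VE, VE := None)))) (k CA)) else k CA)"
| "action CAcc b k = k CAcc"
| "action CDead b k = k CDead"

definition ucode :: "ctrl \<Rightarrow> bool list" where "ucode p = dcode ncc (ccode p)"

definition print_name :: "ctrl \<Rightarrow> 'a prog \<Rightarrow> 'a prog" where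
  "print_name p k = Do (emitop (bits_code (True # ucode p))) (Do (printop (\<lambda>x. bits_code (cell_bits B x))) k)"

definition emit :: "tok list \<Rightarrow> 'a prog \<Rightarrow> 'a prog" where
  "emit ts k = Do (emitop (concat (map tok_code ts))) k"

text \<open>An overflowing clock identifies the last layer, whose gates are inputs. Otherwise each
  predecessor is computed in place, printed, and undone by means of the backup.\<close>

definition gate_com :: "ctrl \<Rightarrow> 'a prog \<Rightarrow> 'a prog" where
  "gate_com p k = Do (asgop copy_regs) (print_name p (emit [TSep] (incs B time_regs (\<lambda>ov. if ov
     then Do (asgop restore_regs) (emit [TIn, if p = CAcc then T0 else T1, TSep, TEnd] k)
     else emit [TDiv, TSep] (action p False (\<lambda>p'. print_name p' (emit [TSep]
       (Do (asgop restore_regs) (incs B time_regs (\<lambda>_. action p True (\<lambda>p'. print_name p' (emit [TSep, TEnd]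
         (Do (asgop restore_regs) k)))))))))))))"

definition body :: "'a prog" where
  "body = foldr gate_com ctrls (incs B all_regs (\<lambda>ov. if ov then Do (incop B FL) Skip else Skip))"

text \<open>When the loop ends, the overflow has brought all counted registers back to 0, so the
  name of the output gate can be printed from them. The number asked for is 1.\<close>

definition main_com :: "'a prog" where
  "main_com = Seq (While (eqop [(FL,ZZ)]) body)
     (emit [TOut] (print_name CI (emit [TOut, T1] Skip)))"

section \<open>States, values and digits of the program stay below the base\<close>

lemma okcom_wcom: "2 \<le> B \<Longrightarrow> s < B \<Longrightarrow> okcom B B k \<Longrightarrow> okcom B B (wcom dw s k)"
  using mk by (cases dw) (auto simp: okop_basic)

lemma okcom_icom: "2 \<le> B \<Longrightarrow> okcom B B k \<Longrightarrow> okcom B B (icom di k)"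
  by (cases di) (auto simp: okop_basic)

lemma okcom_seek: "2 \<le> B \<Longrightarrow> okcom B B k \<Longrightarrow> okcom B B (seek k)"
  unfolding seek_def by (auto simp: okop_basic intro!: okcom_rewind)

lemma okcom_vcom:
  assumes B2: "2 \<le> B" and "ch \<in> set chs" "okcom B B k"
  shows "okcom B B (vcom ch k)"
proof -
  obtain q' s' di dw ot where ch: "ch = (q',s',di,dw,ot)" by (cases ch)
  then have "q' < B" "s' < B" using chs_less assms(2) by auto
  then show ?thesis using assms unfolding vcom_def ch
    by (auto simp: okop_basic intro!: okcom_seek okcom_wcom okcom_icom)
qed

lemma okcom_incv: "2 \<le> B \<Longrightarrow> okcom B B (k True) \<Longrightarrow> okcom B B (k False) \<Longrightarrow> okcom B B (incv v k)"
  unfolding incv_def by (rule okcom_incs)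

lemma okcom_chk:
  assumes B2: "2 \<le> B" and "set cs \<subseteq> set chs" "\<And>f. okcom B B (k f)"
  shows "okcom B B (test_succs cs k f)"
  using assms(2)
proof (induction cs arbitrary: f)
  case Nil
  then show ?case using assms okop_basic[OF B2] by simp
next
  case (Cons ch cs)
  then show ?case using B2 by (auto simp: okop_basic intro!: okcom_vcom okcom_eqv)
qed

lemma okcom_action:
  assumes B2: "2 \<le> B" and k: "\<And>p. okcom B B (k p)" and p: "ctrl_ok p"
  shows "okcom B B (action p b k)"
  using p B2 k mk Q_less[OF start]
  by (cases p) (auto simp: okop_basic intro!: okcom_vcom okcom_eqv okcom_incv okcom_chk)

lemma okcom_gate_com:
  assumes B2: "2 \<le> B" and k: "okcom B B k" and p: "ctrl_ok p"
  shows "okcom B B (gate_com p k)"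
proof -
  have e: "okcom B B k \<Longrightarrow> okcom B B (emit ts k)" "okcom B B k \<Longrightarrow> okcom B B (print_name p k)" for ts k p
    using okop_basic[OF B2] by (auto simp: emit_def print_name_def)
  show ?thesis unfolding gate_com_def
    using okop_basic[OF B2] k p by (auto intro!: e okcom_incs[OF B2] okcom_action[OF B2])
qed

lemma okcom_main_com: "2 \<le> B \<Longrightarrow> okcom B B main_com"
proof -
  assume B2: "2 \<le> B"
  have f: "okcom B B (foldr gate_com ps k)" if "\<forall>p\<in>set ps. ctrl_ok p" "okcom B B k" for ps k
    using that by (induction ps) (auto intro: okcom_gate_com[OF B2])
  show ?thesis using okop_basic[OF B2] set_ctrls
    by (auto simp: main_com_def body_def emit_def print_name_def intro!: f okcom_incs[OF B2])
qed

end

section \<open>Correctness of the transitions\<close>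

lemma exec_rewind_loop:
  "j \<le> length w \<Longrightarrow> exec w (While (Inp (\<lambda>a. case a of None \<Rightarrow> 0 | Some _ \<Rightarrow> 1) Lft) Skip) (xs, j, out) (xs, 0, out)"
proof (induction j)
  case 0
  show ?case by (rule exec.WhileF) (simp add: read_input_def)
next
  case (Suc j)
  show ?case
  proof (rule exec.WhileT)
    show "op_sem w (Inp (\<lambda>a. case a of None \<Rightarrow> 0 | Some _ \<Rightarrow> 1) Lft) (xs, Suc j, out) = (1, xs, j, out)"
      using Suc.prems by (simp add: read_input_def)
    show "exec w (While (Inp (\<lambda>a. case a of None \<Rightarrow> 0 | Some _ \<Rightarrow> 1) Lft) Skip) (xs, j, out) (xs, 0, out)"
      by (rule Suc.IH) (use Suc.prems in simp)
  qed (auto intro: exec.Skip)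
qed

lemma exec_rewind:
  assumes "i \<le> length w + 1" "exec w k (xs, 0, out) t"
  shows "exec w (rewind k) (xs, i, out) t"
  unfolding rewind_def
proof (rule exec.Switch)
  show "op_sem w (Inp (\<lambda>_. 0) Lft) (xs, i, out) = (0, xs, i - 1, out)" using assms(1) by simp
  show "exec w (Seq (While (Inp (\<lambda>a. case a of None \<Rightarrow> 0 | Some _ \<Rightarrow> 1) Lft) Skip) k) (xs, i - 1, out) t"
    by (rule exec.Seq[OF exec_rewind_loop assms(2)]) (use assms(1) in simp)
qed

context ntm_run begin

abbreviation "wend \<equiv> length w + 1"

lemma wp_subst: "wp k \<rho>1 i out t \<Longrightarrow> \<rho>1 = \<rho>2 \<Longrightarrow> wp k \<rho>2 i out t" by simp

lemma wp_rewind: "i \<le> wend \<Longrightarrow> wp k \<rho> 0 out t \<Longrightarrow> wp (rewind k) \<rho> i out t"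
  unfolding wp_def using exec_rewind by blast

text \<open>A value beyond the input leaves the head on the right end marker, where the same is read
  as at the larger position.\<close>

lemma exec_seek_loop:
  assumes "good \<rho>" "i \<le> wend"
  shows "exec w (While (nzop PP) (Do (decop B PP) (Do (Inp (\<lambda>_. 0) Rgt) Skip)))
    (tape_of B l \<rho>, i, out) (tape_of B l (\<rho>(PP := 0)), min wend (i + \<rho> PP), out)"
  using assms
proof (induction "\<rho> PP" arbitrary: \<rho> i)
  case 0
  have "\<rho>(PP := 0) = \<rho>" using 0 by auto
  moreover have "op_sem w (nzop PP) (tape_of B l \<rho>, i, out) = (0, tape_of B l \<rho>, i, out)"
    using op_sem_nz[OF 0(2), of PP] 0(1) by simp
  then have "exec w (While (nzop PP) (Do (decop B PP) (Do (Inp (\<lambda>_. 0) Rgt) Skip)))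
    (tape_of B l \<rho>, i, out) (tape_of B l \<rho>, i, out)" by (rule exec.WhileF)
  ultimately show ?case using 0 by simp
next
  case (Suc k)
  let ?\<rho> = "\<rho>(PP := \<rho> PP - 1)"
  have g: "good ?\<rho>" using Suc.prems by (auto simp: good_def less_imp_diff_less)
  have o: "op_sem w (nzop PP) (tape_of B l \<rho>, i, out) = (1, tape_of B l \<rho>, i, out)"
    using op_sem_nz[OF Suc.prems(1), of PP] Suc.hyps(2) by simp
  have "wp (Do (decop B PP) (Do (Inp (\<lambda>_. 0) Rgt) Skip)) \<rho> i out (\<lambda>t. t = (tape_of B l ?\<rho>, min wend (i + 1), out))"
    by (rule wp_dec, use Suc.hyps(2) in simp, rule wp_inp) (simp add: wp_Skip)
  then have 1: "exec w (Do (decop B PP) (Do (Inp (\<lambda>_. 0) Rgt) Skip)) (tape_of B l \<rho>, i, out) (tape_of B l ?\<rho>, min wend (i + 1), out)"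
    by (simp add: wp_def)
  have m: "min wend (min wend (i + 1) + k) = min wend (i + \<rho> PP)" using Suc.hyps(2) by linarith
  have "exec w (While (nzop PP) (Do (decop B PP) (Do (Inp (\<lambda>_. 0) Rgt) Skip)))
    (tape_of B l ?\<rho>, min wend (i + 1), out) (tape_of B l (?\<rho>(PP := 0)), min wend (min wend (i + 1) + ?\<rho> PP), out)"
    by (rule Suc.hyps(1)) (use Suc.hyps(2) g in auto)
  moreover have "?\<rho> PP = k" "?\<rho>(PP := 0) = \<rho>(PP := 0)" using Suc.hyps(2) by (simp, auto)
  ultimately have 2: "exec w (While (nzop PP) (Do (decop B PP) (Do (Inp (\<lambda>_. 0) Rgt) Skip)))
    (tape_of B l ?\<rho>, min wend (i + 1), out) (tape_of B l (\<rho>(PP := 0)), min wend (i + \<rho> PP), out)" using m by metis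
  show ?case by (rule exec.WhileT[OF o _ 1 2]) simp
qed

lemma wp_seek:
  assumes "good \<rho>" "i \<le> wend" "wp k (\<rho>(PP := 0)) (min wend (\<rho> XI)) out t"
  shows "wp (seek k) \<rho> i out t"
  unfolding seek_def
proof (rule wp_asg)
  let ?\<rho> = "\<rho>(PP := \<rho> XI)"
  have e: "(\<lambda>r. case (if r = PP then Some XI else Some r) of None \<Rightarrow> 0 | Some s \<Rightarrow> \<rho> s) = ?\<rho>"
    by auto
  have g: "good ?\<rho>" using assms(1) by (auto simp: good_def)
  have "wp (Seq (While (nzop PP) (Do (decop B PP) (Do (Inp (\<lambda>_. 0) Rgt) Skip))) k) ?\<rho> 0 out t"
  proof (rule wp_Seq)
    show "exec w (While (nzop PP) (Do (decop B PP) (Do (Inp (\<lambda>_. 0) Rgt) Skip))) (tape_of B l ?\<rho>, 0, out)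
      (tape_of B l (?\<rho>(PP := 0)), min wend (0 + ?\<rho> PP), out)"
      by (rule exec_seek_loop[OF g]) simp
    show "wp k (?\<rho>(PP := 0)) (min wend (0 + ?\<rho> PP)) out t" using assms(3) by simp
  qed
  then show "wp (rewind (Seq (While (nzop PP) (Do (decop B PP) (Do (Inp (\<lambda>_. 0) Rgt) Skip))) k))
     (\<lambda>r. case (if r = PP then Some XI else Some r) of None \<Rightarrow> 0 | Some s \<Rightarrow> \<rho> s) i out t"
    unfolding e by (rule wp_rewind[OF assms(2)])
qed

lemma wp_wcom:
  assumes g: "good \<rho>" and s: "s < B" and m: "wmove dw s (\<rho> XL) (\<rho> XR) = (L',R')"
    and k: "wp k (\<rho>(XL := L', XR := R')) i out t"
  shows "wp (wcom dw s k) \<rho> i out t"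
proof (cases dw)
  case Rgt
  have "\<rho>(XL := (\<rho> XL * B + s) mod N) = \<rho>(XL := L', XR := R')" using m Rgt by (auto simp: fun_eq_iff)
  then show ?thesis using k Rgt s by (auto intro!: wp_push)
next
  case Stay
  have "\<rho>(XR := (\<rho> XR * B + s) mod N) = \<rho>(XL := L', XR := R')" using m Stay by (auto simp: fun_eq_iff)
  then show ?thesis using k Stay s by (auto intro!: wp_push)
next
  case Lft
  let ?\<rho> = "\<rho>(XL := \<rho> XL div B)" and ?y = "\<rho> XL mod B"
  show ?thesis
  proof (cases "?y = mk")
    case True
    have "wp (Do (pushop XL mk) (Do (pushop XR s) k)) ?\<rho> i out t"
      by (intro wp_push mk s, rule wp_subst[OF k]) (use m Lft True in \<open>auto simp: fun_eq_iff\<close>)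
    then show ?thesis unfolding Lft wcom.simps using True by (intro wp_pop g) simp
  next
    case False
    have "wp (Do (pushop XR s) (Do (pushop XR ?y) k)) ?\<rho> i out t"
      by (intro wp_push s, use B in simp, rule wp_subst[OF k]) (use m Lft False in \<open>auto simp: fun_eq_iff\<close>)
    then show ?thesis unfolding Lft wcom.simps using False by (intro wp_pop g) simp
  qed
qed

lemma wp_icom:
  assumes g: "good \<rho>" and n: "\<rho> NN = wend" and k: "wp k (\<rho>(XI := imove di (\<rho> XI))) i out t"
  shows "wp (icom di k) \<rho> i out t"
proof (cases di)
  case Rgt
  show ?thesis
  proof (cases "\<rho> XI = wend")
    case True
    then have "\<rho>(XI := imove di (\<rho> XI)) = \<rho>" using Rgt by (auto simp: fun_eq_iff)
    then show ?thesis using Rgt True n k by (auto intro!: wp_eq g)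
  next
    case False
    have "wp (Do (incop B XI) k) \<rho> i out t"
      by (rule wp_inc[OF g], rule wp_subst[OF k]) (use Rgt False in auto)
    then show ?thesis using Rgt False n by (auto intro!: wp_eq g)
  qed
next
  case Stay
  then have "\<rho>(XI := imove di (\<rho> XI)) = \<rho>" by (auto simp: fun_eq_iff)
  then show ?thesis using Stay k by simp
next
  case Lft
  show ?thesis
  proof (cases "\<rho> XI = 0")
    case True
    then have "\<rho>(XI := imove di (\<rho> XI)) = \<rho>" using Lft by (auto simp: fun_eq_iff)
    then show ?thesis using Lft True k by (auto intro!: wp_nz g)
  next
    case False
    have "wp (Do (decop B XI) k) \<rho> i out t"
      by (rule wp_dec, use False in simp, rule wp_subst[OF k]) (use Lft in auto)
    then show ?thesis using Lft False by (auto intro!: wp_nz g)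
  qed
qed

lemma wmove_less: "L < N \<Longrightarrow> R < N \<Longrightarrow> wmove dw s L R = (L',R') \<Longrightarrow> L' < N \<and> R' < N"
  using N_pos by (cases dw) (auto split: if_splits simp: div_less_dividend intro: le_less_trans[OF div_le_dividend])

lemma imove_less: "I < N \<Longrightarrow> imove di I < N"
  using w_less by (cases di) (auto simp: less_imp_diff_less)

text \<open>Arbitrary triples below \<open>N\<close> have to be covered, for the circuit contains
  gates also for those that encode no configuration.\<close>

lemma vstep_less:
  assumes "L < N" "R < N" "I < N" "vstep ch (L,R,I) = (L',R',I')"
  shows "L' < N \<and> R' < N \<and> I' < N"
proof -
  have R2: "R div B div B < N" using assms(2) by (meson div_le_dividend le_less_trans)
  show ?thesis using assms wmove_less[OF assms(1) R2] imove_less[OF assms(3)] N_pos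
    by (auto simp: Let_def split: if_splits prod.splits)
qed

lemma read_input_min: "read_input w (min wend i) = read_input w i"
  by (auto simp: read_input_def)

lemma wp_vcom:
  assumes g: "good \<rho>" and n: "\<rho> NN = wend" and i: "i \<le> wend" and ch: "ch \<in> set chs"
    and v: "vstep ch (\<rho> XL, \<rho> XR, \<rho> XI) = (L',R',I')"
    and k: "wp k (\<rho>(PP := 0, XL := L', XR := R', XI := I')) (min wend (\<rho> XI)) out t"
  shows "wp (vcom ch k) \<rho> i out t"
  unfolding vcom_def
proof (intro wp_seek[OF g i] wp_pop)
  obtain q' s' di dw ot where che: "ch = (q',s',di,dw,ot)" by (cases ch)
  then have q's': "q' < B" "s' < B" using chs_less ch by auto
  let ?\<rho>0 = "\<rho>(PP := 0)"
  let ?q = "?\<rho>0 XR mod B"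
  let ?\<rho>1 = "?\<rho>0(XR := ?\<rho>0 XR div B)"
  let ?s = "?\<rho>1 XR mod B"
  let ?\<rho>2 = "?\<rho>1(XR := ?\<rho>1 XR div B)"
  show g0: "good ?\<rho>0" using g N_pos by (simp add: good_upd)
  have dl: "x div B < N" if "x < N" for x using that by (meson div_le_dividend le_less_trans)
  have g1: "good ?\<rho>1" by (rule good_upd[OF g0], rule dl) (use g0 in \<open>unfold good_def, blast\<close>)
  then show "good ?\<rho>1" .
  have g2: "good ?\<rho>2" by (rule good_upd[OF g1], rule dl) (use g1 in \<open>unfold good_def, blast\<close>)
  let ?i = "min wend (\<rho> XI)"
  have "wp (if (if ch \<in> tm_delta M ?q (read_input w ?i) ?s then 1 else 0) = (1::nat)
     then (case ch of (q',s',di,dw,ot) \<Rightarrow> wcom dw s' (Do (pushop XR q') (icom di k)))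
     else Do (pushop XR ?s) (Do (pushop XR ?q) k)) ?\<rho>2 (min wend (move Stay ?i)) out t"
  proof (cases "ch \<in> tm_delta M ?q (read_input w ?i) ?s")
    case True
    obtain L1 R1 where wm: "wmove dw s' (\<rho> XL) (\<rho> XR div B div B) = (L1,R1)"
      by (cases "wmove dw s' (\<rho> XL) (\<rho> XR div B div B)")
    \<comment> \<open>The head stands at the clipped position, which reads the same symbol as
      \<open>XI\<close>.\<close>
    have "ch \<in> tm_delta M (\<rho> XR mod B) (read_input w (\<rho> XI)) (\<rho> XR div B mod B)"
      using True by (simp add: read_input_min[simplified])
    then have r: "L' = L1" "R' = push R1 q'" "I' = imove di (\<rho> XI)"
      using v wm unfolding che by (auto simp: Let_def)
    have lt: "L1 < N" "R1 < N" using wmove_less[OF _ _ wm] g dl by (auto simp: good_def)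
    let ?\<rho>3 = "?\<rho>2(XL := L1, XR := R1)"
    let ?\<rho>4 = "?\<rho>3(XR := (?\<rho>3 XR * B + q') mod N)"
    have g4: "good ?\<rho>4"
      by (rule good_upd[OF good_upd[OF good_upd[OF g2 lt(1)] lt(2)]]) (use N_pos in simp)
    have "wp k (?\<rho>4(XI := imove di (?\<rho>4 XI))) ?i out t"
      by (rule wp_subst[OF k]) (use r in \<open>auto simp: fun_eq_iff\<close>)
    then have "wp (icom di k) ?\<rho>4 ?i out t" by (rule wp_icom[OF g4, rotated]) (use n in simp)
    then have "wp (Do (pushop XR q') (icom di k)) ?\<rho>3 ?i out t" by (intro wp_push q's') 
    then have "wp (wcom dw s' (Do (pushop XR q') (icom di k))) ?\<rho>2 ?i out t"
      by (rule wp_wcom[OF g2 q's'(2), rotated]) (use wm in simp)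
    then show ?thesis using True unfolding che by simp
  next
    case False
    then have "ch \<notin> tm_delta M (\<rho> XR mod B) (read_input w (\<rho> XI)) (\<rho> XR div B mod B)"
      by (simp add: read_input_min[simplified])
    then have r: "L' = \<rho> XL" "R' = push (push (\<rho> XR div B div B) (\<rho> XR div B mod B)) (\<rho> XR mod B)" "I' = \<rho> XI"
      using v by (auto simp: Let_def)
    have "wp (Do (pushop XR ?s) (Do (pushop XR ?q) k)) ?\<rho>2 ?i out t"
      by (rule wp_push, use B in simp, rule wp_push, use B in simp, rule wp_subst[OF k])
         (use r in \<open>auto simp: fun_eq_iff\<close>)
    then show ?thesis using False by simp
  qed
  then show "wp (Switch (Inp (\<lambda>a. if ch \<in> tm_delta M ?q a ?s then 1 else 0) Stay) (\<lambda>v.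
       if v = 1 then (case ch of (q',s',di,dw,ot) \<Rightarrow> wcom dw s' (Do (pushop XR q') (icom di k)))
       else Do (pushop XR ?s) (Do (pushop XR ?q) k))) ?\<rho>2 ?i out t"
    by (rule wp_inp[where vf = "\<lambda>a. if ch \<in> tm_delta M ?q a ?s then 1 else 0" and f = "\<lambda>v.
       if v = 1 then (case ch of (q',s',di,dw,ot) \<Rightarrow> wcom dw s' (Do (pushop XR q') (icom di k)))
       else Do (pushop XR ?s) (Do (pushop XR ?q) k)"])
qed

section \<open>Transitions on the main variables\<close>

definition eta :: "(reg \<Rightarrow> nat) \<Rightarrow> var \<Rightarrow> nat" where
  "eta \<rho> v = mval N \<rho> (bun KM v)"

lemma eta_num3: "eta \<rho> v = num3 (\<rho> (KM,v,J0), \<rho> (KM,v,J1), \<rho> (KM,v,J2))"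
  by (simp add: eta_def bun_def num3_def)

abbreviation "W \<equiv> N * N * N"

lemma eta_less: "good \<rho> \<Longrightarrow> eta \<rho> v < W"
  unfolding eta_num3 by (rule num3_less) (auto simp: good_def)

definition ready :: "(reg \<Rightarrow> nat) \<Rightarrow> nat \<Rightarrow> bool" where
  "ready \<rho> i \<longleftrightarrow> good \<rho> \<and> \<rho> NN = wend \<and> i \<le> wend"

text \<open>A transition may change the main registers, and \<open>seek\<close> leaves its counter
  \<open>PP\<close> behind.\<close>

definition frame :: "(reg \<Rightarrow> nat) \<Rightarrow> (reg \<Rightarrow> nat) \<Rightarrow> bool" where
  "frame \<rho> \<rho>' \<longleftrightarrow> (\<forall>r. fst r \<noteq> KM \<and> r \<noteq> PP \<longrightarrow> \<rho>' r = \<rho> r)"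

lemma frame_trans: "frame \<rho> \<rho>' \<Longrightarrow> frame \<rho>' \<rho>'' \<Longrightarrow> frame \<rho> \<rho>''"
  by (simp add: frame_def)

lemma frame_refl: "frame \<rho> \<rho>" by (simp add: frame_def)

lemma wp_incv:
  assumes "ready \<rho> i" and "\<And>\<rho>'. ready \<rho>' i \<Longrightarrow> frame \<rho> \<rho>' \<Longrightarrow>
      eta \<rho>' = (eta \<rho>)(v := if eta \<rho> v + 1 = W then 0 else eta \<rho> v + 1) \<Longrightarrow> wp (k (eta \<rho> v + 1 = W)) \<rho>' i out t"
  shows "wp (incv v k) \<rho> i out t"
proof -
  let ?\<rho> = "fst (minc N (bun KM v) \<rho>)"
  have g: "good \<rho>" using assms(1) by (simp add: ready_def)
  have d: "distinct (bun KM v)" by (simp add: bun_def)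
  have W: "N ^ length (bun KM v) = W" by (simp add: bun_def)
  have sp: "(snd (minc N (bun KM v) \<rho>) \<longleftrightarrow> eta \<rho> v + 1 = W) \<and>
     eta ?\<rho> v = (if eta \<rho> v + 1 = W then 0 else eta \<rho> v + 1) \<and>
     (\<forall>r. r \<notin> set (bun KM v) \<longrightarrow> ?\<rho> r = \<rho> r)"
    using minc_spec[OF d, of \<rho> N] g unfolding eta_def W by (auto simp: good_def)
  have fr: "frame \<rho> ?\<rho>" using sp by (auto simp: frame_def bun_def)
  have "eta ?\<rho> u = eta \<rho> u" if "u \<noteq> v" for u
    unfolding eta_def by (rule mval_cong) (use sp that in \<open>auto simp: bun_def\<close>)
  then have e: "eta ?\<rho> = (eta \<rho>)(v := if eta \<rho> v + 1 = W then 0 else eta \<rho> v + 1)" using sp by auto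
  have o: "ready ?\<rho> i" using assms(1) good_minc[OF g] fr by (auto simp: ready_def frame_def)
  have "snd (minc N (bun KM v) \<rho>) = (eta \<rho> v + 1 = W)" using sp by blast
  then have "wp (k (snd (minc N (bun KM v) \<rho>))) ?\<rho> i out t" using assms(2)[OF o fr e] by (simp only:)
  then show ?thesis unfolding incv_def by (rule wp_incs[OF g])
qed

lemma wp_asgv:
  assumes "ready \<rho> i" and "\<And>\<rho>'. ready \<rho>' i \<Longrightarrow> frame \<rho> \<rho>' \<Longrightarrow>
      eta \<rho>' = (\<lambda>v. case \<sigma> v of None \<Rightarrow> 0 | Some u \<Rightarrow> eta \<rho> u) \<Longrightarrow> wp k \<rho>' i out t"
  shows "wp (Do (asgop (asgM \<sigma>)) k) \<rho> i out t"
proof (rule wp_asg)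
  let ?\<rho> = "\<lambda>r. case asgM \<sigma> r of None \<Rightarrow> 0 | Some s \<Rightarrow> \<rho> s"
  have g: "good ?\<rho>" using assms(1) N_pos by (auto simp: ready_def good_def split: option.splits)
  have fr: "frame \<rho> ?\<rho>" by (auto simp: frame_def asgM_def)
  have "?\<rho> NN = wend" using assms(1) by (simp add: ready_def asgM_def)
  then have o: "ready ?\<rho> i" using g assms(1) by (simp add: ready_def)
  have "eta ?\<rho> v = (case \<sigma> v of None \<Rightarrow> 0 | Some u \<Rightarrow> eta \<rho> u)" for v
    by (simp add: eta_def bun_def asgM_def split: option.splits)
  then show "wp k ?\<rho> i out t" by (intro assms(2)[OF o fr] ext)
qed

lemma wp_eqv:
  assumes "ready \<rho> i" and "wp (k (eta \<rho> u = eta \<rho> v)) \<rho> i out t"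
  shows "wp (eqv u v k) \<rho> i out t"
proof -
  have g: "good \<rho>" using assms(1) by (simp add: ready_def)
  have eq: "(\<forall>(a,b)\<in>set (zip (bun KM u) (bun KM v)). \<rho> a = \<rho> b) \<longleftrightarrow> eta \<rho> u = eta \<rho> v"
  proof
    assume "eta \<rho> u = eta \<rho> v"
    then have "comps (eta \<rho> u) = comps (eta \<rho> v)" by simp
    then show "\<forall>(a,b)\<in>set (zip (bun KM u) (bun KM v)). \<rho> a = \<rho> b"
      using g comps_num3 by (simp add: eta_num3 bun_def good_def)
  qed (simp add: eta_num3 bun_def)
  show ?thesis unfolding eqv_def using assms(2)
    by (intro wp_eq[OF g], unfold eq) (cases "eta \<rho> u = eta \<rho> v"; simp)
qed

lemma wp_vcom_eta:
  assumes o: "ready \<rho> i" and j: "j < length chs"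
    and k: "\<And>\<rho>' i'. ready \<rho>' i' \<Longrightarrow> frame \<rho> \<rho>' \<Longrightarrow> eta \<rho>' = (eta \<rho>)(VX := vnum j (eta \<rho> VX)) \<Longrightarrow> wp k \<rho>' i' out t"
  shows "wp (vcom (chs ! j) k) \<rho> i out t"
proof -
  have g: "good \<rho>" and n: "\<rho> NN = wend" and i: "i \<le> wend" using o by (auto simp: ready_def)
  obtain L' R' I' where v: "vstep (chs ! j) (\<rho> XL, \<rho> XR, \<rho> XI) = (L',R',I')"
    by (cases "vstep (chs ! j) (\<rho> XL, \<rho> XR, \<rho> XI)")
  have lt: "L' < N" "R' < N" "I' < N" using vstep_less[OF _ _ _ v] g by (auto simp: good_def)
  let ?\<rho> = "\<rho>(PP := 0, XL := L', XR := R', XI := I')"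
  have g': "good ?\<rho>" using g lt N_pos by (intro good_upd) auto
  then have o': "ready ?\<rho> (min wend (\<rho> XI))" using n by (auto simp: ready_def)
  have c: "comps (eta \<rho> VX) = (\<rho> XL, \<rho> XR, \<rho> XI)" using g by (simp add: eta_num3 comps_num3 good_def)
  have vn: "vnum j (eta \<rho> VX) = num3 (L',R',I')" by (simp only: vnum_def c v)
  have "eta ?\<rho> VX = num3 (L',R',I')" "\<And>u. u \<noteq> VX \<Longrightarrow> eta ?\<rho> u = eta \<rho> u" by (simp_all add: eta_num3)
  then have e: "eta ?\<rho> = (eta \<rho>)(VX := vnum j (eta \<rho> VX))" by (auto simp: fun_eq_iff vn)
  show ?thesis by (rule wp_vcom[OF g n i _ v]) (use j k o' e in \<open>auto simp: frame_def\<close>)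
qed

text \<open>Stated for the transitions from number \<open>j\<close> on, to allow induction on how
  many remain.\<close>

lemma wp_chk:
  assumes "ready \<rho> i" "j \<le> length chs"
    and "\<And>\<rho>' i'. ready \<rho>' i' \<Longrightarrow> frame \<rho> \<rho>' \<Longrightarrow> eta \<rho>' = (eta \<rho>)(VX := 0) \<Longrightarrow>
      wp (k (f \<or> (\<exists>i<length chs. j \<le> i \<and> vnum i (eta \<rho> VU) = eta \<rho> VV))) \<rho>' i' out t"
  shows "wp (test_succs (drop j chs) k f) \<rho> i out t"
  using assms
proof (induction "length chs - j" arbitrary: j \<rho> i f)
  case 0
  then have j: "drop j chs = []" "\<And>i. i < length chs \<Longrightarrow> \<not> j \<le> i" by auto
  show ?case unfolding j test_succs.simps
  proof (rule wp_asgv[OF 0(2)])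
    fix \<rho>' assume "ready \<rho>' i" "frame \<rho> \<rho>'" "eta \<rho>' = (\<lambda>v. case (Some(VX := None)) v of None \<Rightarrow> 0 | Some u \<Rightarrow> eta \<rho> u)"
    moreover have "(\<lambda>v. case (Some(VX := None)) v of None \<Rightarrow> 0 | Some u \<Rightarrow> eta \<rho> u) = (eta \<rho>)(VX := 0)" by auto
    moreover have "(f \<or> (\<exists>i<length chs. j \<le> i \<and> vnum i (eta \<rho> VU) = eta \<rho> VV)) = f" using j(2) by blast
    ultimately show "wp (k f) \<rho>' i out t" using 0(4)[of \<rho>' i] by simp
  qed
next
  case (Suc m)
  then have jl: "j < length chs" by simp
  have d: "drop j chs = chs ! j # drop (Suc j) chs" using jl by (simp add: Cons_nth_drop_Suc)
  show ?case unfolding d test_succs.simps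
  proof (rule wp_asgv[OF Suc.prems(1)])
    fix \<rho>1 assume 1: "ready \<rho>1 i" "frame \<rho> \<rho>1"
      "eta \<rho>1 = (\<lambda>v. case (Some(VX := Some VU)) v of None \<Rightarrow> 0 | Some u \<Rightarrow> eta \<rho> u)"
    show "wp (vcom (chs ! j) (eqv VX VV (\<lambda>e. test_succs (drop (Suc j) chs) k (f \<or> e)))) \<rho>1 i out t"
    proof (rule wp_vcom_eta[OF 1(1) jl])
      fix \<rho>2 i2 assume 2: "ready \<rho>2 i2" "frame \<rho>1 \<rho>2" "eta \<rho>2 = (eta \<rho>1)(VX := vnum j (eta \<rho>1 VX))"
      have e: "eta \<rho>2 VX = vnum j (eta \<rho> VU)" "\<And>v. v \<noteq> VX \<Longrightarrow> eta \<rho>2 v = eta \<rho> v" using 1 2 by auto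
      show "wp (eqv VX VV (\<lambda>e. test_succs (drop (Suc j) chs) k (f \<or> e))) \<rho>2 i2 out t"
      proof (rule wp_eqv[OF 2(1)], rule Suc.hyps(1))
        show "m = length chs - Suc j" "ready \<rho>2 i2" "Suc j \<le> length chs" using Suc.hyps(2) 2 jl by auto
        fix \<rho>3 i3 assume 3: "ready \<rho>3 i3" "frame \<rho>2 \<rho>3" "eta \<rho>3 = (eta \<rho>2)(VX := 0)"
        have "frame \<rho> \<rho>3" using 1 2 3 frame_trans by blast
        moreover have "eta \<rho>3 = (eta \<rho>)(VX := 0)" using 3(3) e(2) by auto
        moreover have "((f \<or> eta \<rho>2 VX = eta \<rho>2 VV) \<or> (\<exists>i<length chs. Suc j \<le> i \<and> vnum i (eta \<rho>2 VU) = eta \<rho>2 VV))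
           = (f \<or> (\<exists>i<length chs. j \<le> i \<and> vnum i (eta \<rho> VU) = eta \<rho> VV))"
          using e jl by (auto simp: Suc_le_eq order_le_less)
        ultimately show "wp (k ((f \<or> eta \<rho>2 VX = eta \<rho>2 VV) \<or>
           (\<exists>i<length chs. Suc j \<le> i \<and> vnum i (eta \<rho>2 VU) = eta \<rho>2 VV))) \<rho>3 i3 out t"
          using Suc.prems(3)[OF 3(1)] by simp
      qed
    qed
  qed
qed

end

section \<open>Names of gates as bit strings\<close>

lemma register_lists: "distinct time_regs" "length time_regs = 48" "length main_regs = 24" "distinct all_regs"
  by (simp_all add: time_regs_def main_regs_def all_regs_def bun_def allvars_def)

lemma all_regs_banks: "set main_regs = {r. fst r = KM}" "set time_regs = {r. fst r = KT \<or> fst r = KU}"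
proof -
  have v: "v \<in> set allvars" for v by (cases v) (auto simp: allvars_def)
  have b: "set (concat (map (bun k) allvars)) = {r. fst r = k}" for k
  proof -
    have "(k,v,j) \<in> set (concat (map (bun k) allvars))" for v j
      using v[of v] by (cases j) (auto simp: bun_def)
    then show ?thesis by (auto simp: bun_def)
  qed
  show "set main_regs = {r. fst r = KM}" "set time_regs = {r. fst r = KT \<or> fst r = KU}"
    unfolding main_regs_def time_regs_def set_append b by auto
qed

lemma bits_code_append: "bits_code (xs @ ys) = bits_code xs @ bits_code ys" by (simp add: bits_code_def)
lemma bits_code_concat: "bits_code (concat xss) = concat (map bits_code xss)"
  by (induction xss) (simp_all add: bits_code_append, simp add: bits_code_def)
lemma bits_code_num_toks: "concat (map tok_code (num_toks n)) = bits_code (bin n)"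
  by (simp add: num_toks_def bits_code_def comp_def)

lemma dcode_length: "d \<le> B \<Longrightarrow> length (dcode B d) = B" by (simp add: dcode_def)
lemma dcode_inject: "dcode B d = dcode B e \<Longrightarrow> d = e"
proof -
  have c: "length (filter id (dcode B d)) = d" for d by (simp add: dcode_def)
  show "dcode B d = dcode B e \<Longrightarrow> d = e" by (metis c)
qed

lemma concat_map_dcode_inject:
  assumes "\<And>r. r \<in> set rs \<Longrightarrow> x r < B \<and> y r < B"
    "concat (map (\<lambda>r. dcode B (x r)) rs) @ xs = concat (map (\<lambda>r. dcode B (y r)) rs) @ ys"
  shows "(\<forall>r\<in>set rs. x r = y r) \<and> xs = ys"
  using assms
proof (induction rs)
  case (Cons r rs)
  have l: "length (dcode B (x r)) = length (dcode B (y r))"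
    using Cons.prems(1)[of r] by (simp add: dcode_length)
  have "dcode B (x r) @ (concat (map (\<lambda>r. dcode B (x r)) rs) @ xs) =
      dcode B (y r) @ (concat (map (\<lambda>r. dcode B (y r)) rs) @ ys)" using Cons.prems(2) by simp
  then have "dcode B (x r) = dcode B (y r) \<and>
    concat (map (\<lambda>r. dcode B (x r)) rs) @ xs = concat (map (\<lambda>r. dcode B (y r)) rs) @ ys"
    by (rule append_eq_append_conv[OF disjI1[OF l], THEN iffD1])
  then have 1: "dcode B (x r) = dcode B (y r)"
    and 2: "concat (map (\<lambda>r. dcode B (x r)) rs) @ xs = concat (map (\<lambda>r. dcode B (y r)) rs) @ ys"
    by (rule conjunct1, elim conjunct2)
  have "x r = y r" using 1 by (rule dcode_inject)
  moreover have "(\<forall>r\<in>set rs. x r = y r) \<and> xs = ys"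
    by (rule Cons.IH[OF _ 2]) (use Cons.prems(1) in auto)
  ultimately show ?case by auto
qed simp

text \<open>Each digit occupies exactly \<open>B\<close> bits, so the printed tape can be cut at
  known places.\<close>

lemma digits_inject:
  assumes "0 < B" "concat (map (cell_bits B) (tape_of B l \<rho>)) = concat (map (cell_bits B) (tape_of B l \<rho>'))" "r \<in> set all_regs"
  shows "\<rho> r mod B ^ l = \<rho>' r mod B ^ l"
  using assms(2)
proof (induction l arbitrary: \<rho> \<rho>')
  case (Suc l)
  have "(\<forall>r\<in>set all_regs. \<rho> r mod B = \<rho>' r mod B) \<and>
    concat (map (cell_bits B) (tape_of B l (\<lambda>r. \<rho> r div B))) = concat (map (cell_bits B) (tape_of B l (\<lambda>r. \<rho>' r div B)))"
  proof (rule concat_map_dcode_inject[where B = B])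
    have "cell_bits B (\<lambda>r. \<rho> r mod B) @ concat (map (cell_bits B) (tape_of B l (\<lambda>r. \<rho> r div B))) =
      cell_bits B (\<lambda>r. \<rho>' r mod B) @ concat (map (cell_bits B) (tape_of B l (\<lambda>r. \<rho>' r div B)))"
      using Suc.prems by simp
    then show "concat (map (\<lambda>r. dcode B (\<rho> r mod B)) all_regs) @ concat (map (cell_bits B) (tape_of B l (\<lambda>r. \<rho> r div B))) =
      concat (map (\<lambda>r. dcode B (\<rho>' r mod B)) all_regs) @ concat (map (cell_bits B) (tape_of B l (\<lambda>r. \<rho>' r div B)))"
      unfolding cell_bits_def[of B "\<lambda>r. \<rho> r mod B"] cell_bits_def[of B "\<lambda>r. \<rho>' r mod B"] .
  qed (use assms(1) in simp)
  then show ?case using Suc.IH[of "\<lambda>r. \<rho> r div B" "\<lambda>r. \<rho>' r div B"] assms(3) mod_power_Suc_eq_iff by blast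
qed simp

lemma digits_cong:
  assumes "\<And>r. r \<in> set all_regs \<Longrightarrow> \<rho> r = \<rho>' r"
  shows "concat (map (cell_bits B) (tape_of B l \<rho>)) = concat (map (cell_bits B) (tape_of B l \<rho>'))"
  using assms
proof (induction l arbitrary: \<rho> \<rho>')
  case (Suc l)
  have "cell_bits B (\<lambda>r. \<rho> r mod B) = cell_bits B (\<lambda>r. \<rho>' r mod B)"
    unfolding cell_bits_def using Suc.prems by (intro arg_cong[where f = concat] map_cong) auto
  then show ?case using Suc.IH[of "\<lambda>r. \<rho> r div B" "\<lambda>r. \<rho>' r div B"] Suc.prems by simp
qed simp

lemma digits_length:
  "0 < B \<Longrightarrow> length (concat (map (cell_bits B) (tape_of B l \<rho>))) = l * (B * length all_regs)"
proof (induction l arbitrary: \<rho>)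
  case (Suc l)
  have "length (concat (map (\<lambda>r. dcode B (\<rho> r mod B)) rs)) = B * length rs" for rs
    using Suc.prems by (induction rs) (simp_all add: dcode_length)
  then show ?case using Suc by (simp add: cell_bits_def)
qed simp

lemma ccode_inject: "ccode p = ccode q \<Longrightarrow> p = q"
  by (cases p; cases q; auto simp: of_bool_def split: if_splits; presburger)

lemma bval_less_branch:
  assumes "length us = length vs"
  shows "bval (zs @ False # us) < bval (zs @ True # vs)"
  using assms bval_less[of us] by (simp add: bval_append bval_Cons)

text \<open>After \<open>c\<close> common ones the larger code has a 1 where the smaller has a 0; as
  the total lengths agree, this decides the comparison whatever follows.\<close>

lemma bval_dcode_mono:
  assumes "c < d" "d \<le> P" "length us = length vs"
  shows "bval (True # dcode P c @ us) < bval (True # dcode P d @ vs)"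
proof -
  have "replicate (P - c) False = False # replicate (P - c - 1) False"
    using assms by (cases "P - c") auto
  moreover have "replicate d True = replicate c True @ True # replicate (d - c - 1) True"
    using assms by (metis Suc_diff_1 add_diff_inverse_nat less_imp_Suc_add diff_add_inverse less_not_sym
       replicate_Suc replicate_add zero_less_diff)
  ultimately have e: "True # dcode P c @ us = (True # replicate c True) @ False # (replicate (P - c - 1) False @ us)"
    "True # dcode P d @ vs = (True # replicate c True) @ True # (replicate (d - c - 1) True @ replicate (P - d) False @ vs)"
    by (simp_all add: dcode_def)
  show ?thesis unfolding e by (rule bval_less_branch) (use assms in simp)
qed

context ntm_run begin

lemma Suc_mod_W: "x < W \<Longrightarrow> (x + 1) mod W = (if x + 1 = W then 0 else x + 1)"
  by (cases "x + 1 = W") auto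

lemma wp_action:
  assumes o: "ready \<rho> i" and p: "ctrl_ok p"
    and k: "\<And>\<rho>' i'. ready \<rho>' i' \<Longrightarrow> frame \<rho> \<rho>' \<Longrightarrow> eta \<rho>' = snd (istep b (p, eta \<rho>)) \<Longrightarrow>
      wp (k (fst (istep b (p, eta \<rho>)))) \<rho>' i' out t"
  shows "wp (action p b k) \<rho> i out t"
proof -
  have fin: "wp (k p') \<rho>' i' out t" if "ready \<rho>' i'" "frame \<rho> \<rho>'" "istep b (p, eta \<rho>) = (p', \<eta>')" "eta \<rho>' = \<eta>'"
    for p' \<eta>' \<rho>' i' using k[OF that(1,2)] that(3,4) by simp
  have g: "good \<rho>" using o by (simp add: ready_def)
  note sm = Suc_mod_W[OF eta_less[OF g]]
  show ?thesis
  proof (cases p)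
    case CI
    show ?thesis unfolding CI action.simps
    proof (rule wp_incv[OF o])
      fix \<rho>1 assume 1: "ready \<rho>1 i" "frame \<rho> \<rho>1" "eta \<rho>1 = (eta \<rho>)(VC := if eta \<rho> VC + 1 = W then 0 else eta \<rho> VC + 1)"
      show "wp (k CA) \<rho>1 i out t" by (rule fin[OF 1(1,2) _ 1(3)]) (simp only: CI istep.simps sm)
    qed
  next
    case CA
    show ?thesis unfolding CA action.simps
    proof (rule wp_asgv[OF o])
      fix \<rho>1 assume "ready \<rho>1 i" "frame \<rho> \<rho>1" and
        e: "eta \<rho>1 = (\<lambda>v. case (Some(VU := None, VM := None)) v of None \<Rightarrow> 0 | Some u \<Rightarrow> eta \<rho> u)"
      moreover have "eta \<rho>1 = (eta \<rho>)(VU := 0, VM := 0)" by (auto simp: e fun_eq_iff)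
      ultimately show "wp (k (CB False)) \<rho>1 i out t" using fin[of \<rho>1 i "CB False"] CA by simp
    qed
  next
    case (CB f)
    show ?thesis
    proof (cases b)
      case False
      then show ?thesis unfolding CB action.simps using fin[OF o frame_refl, of "CD f"] CB by simp
    next
      case True
      have "wp (Do (asgop (asgM (Some(VX := None, VL := None))))
         (Do (pushop XL mk) (Do (pushop XR (tm_start M)) (k (CW f 0))))) \<rho> i out t"
      proof (rule wp_asgv[OF o])
        fix \<rho>1 assume o1: "ready \<rho>1 i" and f1: "frame \<rho> \<rho>1" and
          e: "eta \<rho>1 = (\<lambda>v. case (Some(VX := None, VL := None)) v of None \<Rightarrow> 0 | Some u \<Rightarrow> eta \<rho> u)"
        have "eta \<rho>1 VX = 0" by (simp add: e)
        \<comment> \<open>A code 0 consists of three zero components, so pushing the marker and the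
          start state gives \<open>vstart\<close>.\<close>
        then have z: "\<rho>1 XL = 0" "\<rho>1 XR = 0" "\<rho>1 XI = 0" using N_pos by (simp_all add: eta_num3 num3_def)
        let ?\<rho> = "\<rho>1(XL := (\<rho>1 XL * B + mk) mod N)"
        let ?\<rho>' = "?\<rho>(XR := (?\<rho> XR * B + tm_start M) mod N)"
        have g1: "good \<rho>1" using o1 by (simp add: ready_def)
        have "good ?\<rho>'" by (rule good_upd[OF good_upd[OF g1]]) (use N_pos in simp_all)
        then have o': "ready ?\<rho>' i" using o1 by (simp add: ready_def)
        have f': "frame \<rho> ?\<rho>'" using f1 by (simp add: frame_def)
        have v: "eta ?\<rho>' VX = vstart" by (simp add: eta_num3 z vstart_def)
        have "eta ?\<rho>' u = eta \<rho>1 u" if "u \<noteq> VX" for u using that by (simp add: eta_num3)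
        then have e': "eta ?\<rho>' = (eta \<rho>)(VX := vstart, VL := 0)" using v by (auto simp: fun_eq_iff e)
        have "wp (k (CW f 0)) ?\<rho>' i out t" by (rule fin[OF o' f' _ e']) (simp add: CB True)
        then show "wp (Do (pushop XL mk) (Do (pushop XR (tm_start M)) (k (CW f 0)))) \<rho>1 i out t"
          by (intro wp_push mk Q_less[OF start])
      qed
      then show ?thesis unfolding CB action.simps using True by simp
    qed
  next
    case (CW f j)
    show ?thesis unfolding CW action.simps using fin[OF o frame_refl] CW by simp
  next
    case (CS f j)
    then have j: "j < length chs" using p by simp
    show ?thesis
    proof (cases "eta \<rho> VL = eta \<rho> VD")
      case True
      then show ?thesis unfolding CS action.simps
        by (intro wp_eqv[OF o]) (use fin[OF o frame_refl] CS True in simp)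
    next
      case False
      have "wp (vcom (chs ! j) (incv VL (\<lambda>_. k (CW f 0)))) \<rho> i out t"
      proof (rule wp_vcom_eta[OF o j])
        fix \<rho>1 i1 assume 1: "ready \<rho>1 i1" "frame \<rho> \<rho>1" "eta \<rho>1 = (eta \<rho>)(VX := vnum j (eta \<rho> VX))"
        show "wp (incv VL (\<lambda>_. k (CW f 0))) \<rho>1 i1 out t"
        proof (rule wp_incv[OF 1(1)])
          fix \<rho>2 assume 2: "ready \<rho>2 i1" "frame \<rho>1 \<rho>2"
             "eta \<rho>2 = (eta \<rho>1)(VL := if eta \<rho>1 VL + 1 = W then 0 else eta \<rho>1 VL + 1)"
          have "eta \<rho>1 VL = eta \<rho> VL" using 1(3) by simp
          then have e: "eta \<rho>2 = (eta \<rho>)(VX := vnum j (eta \<rho> VX), VL := (eta \<rho> VL + 1) mod W)"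
            by (simp only: 2(3) sm) (simp only: 1(3))
          show "wp (k (CW f 0)) \<rho>2 i1 out t"
            by (rule fin[OF 2(1) frame_trans[OF 1(2) 2(2)] _ e]) (simp add: CS False)
        qed
      qed
      then show ?thesis unfolding CS action.simps using False by (intro wp_eqv[OF o]) simp
    qed
  next
    case (CC f)
    show ?thesis
    proof (cases "eta \<rho> VX = eta \<rho> VU")
      case False
      then show ?thesis unfolding CC action.simps
        by (intro wp_eqv[OF o]) (use fin[OF o frame_refl] CC False in simp)
    next
      case True
      have "wp (incv VM (\<lambda>_. eqv VU VV (\<lambda>e. test_succs chs (\<lambda>f. k (CD f)) (f \<or> e)))) \<rho> i out t"
      proof (rule wp_incv[OF o], rule wp_eqv)
        fix \<rho>1 assume 1: "ready \<rho>1 i" "frame \<rho> \<rho>1"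
          "eta \<rho>1 = (eta \<rho>)(VM := if eta \<rho> VM + 1 = W then 0 else eta \<rho> VM + 1)"
        show "ready \<rho>1 i" by (rule 1)
        have "wp (test_succs (drop 0 chs) (\<lambda>f. k (CD f)) (f \<or> eta \<rho>1 VU = eta \<rho>1 VV)) \<rho>1 i out t"
        proof (rule wp_chk[OF 1(1)])
          fix \<rho>2 i2 assume 2: "ready \<rho>2 i2" "frame \<rho>1 \<rho>2" "eta \<rho>2 = (eta \<rho>1)(VX := 0)"
          have e: "eta \<rho>2 = (eta \<rho>)(VM := (eta \<rho> VM + 1) mod W, VX := 0)"
            unfolding sm by (simp only: 2(3) 1(3))
          have f: "((f \<or> eta \<rho>1 VU = eta \<rho>1 VV) \<or> (\<exists>i<length chs. 0 \<le> i \<and> vnum i (eta \<rho>1 VU) = eta \<rho>1 VV)) =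
             (f \<or> eta \<rho> VU = eta \<rho> VV \<or> (\<exists>i<length chs. vnum i (eta \<rho> VU) = eta \<rho> VV))"
            using 1(3) by simp
          show "wp (k (CD ((f \<or> eta \<rho>1 VU = eta \<rho>1 VV) \<or>
            (\<exists>i<length chs. 0 \<le> i \<and> vnum i (eta \<rho>1 VU) = eta \<rho>1 VV)))) \<rho>2 i2 out t"
            unfolding f by (rule fin[OF 2(1) frame_trans[OF 1(2) 2(2)] _ e]) (simp add: CC True)
        qed simp
        then show "wp (test_succs chs (\<lambda>f. k (CD f)) (f \<or> eta \<rho>1 VU = eta \<rho>1 VV)) \<rho>1 i out t" by simp
      qed
      then show ?thesis unfolding CC action.simps using True by (intro wp_eqv[OF o]) simp
    qed
  next
    case (CD f)
    show ?thesis unfolding CD action.simps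
    proof (rule wp_incv[OF o])
      fix \<rho>1 assume 1: "ready \<rho>1 i" "frame \<rho> \<rho>1"
        "eta \<rho>1 = (eta \<rho>)(VU := if eta \<rho> VU + 1 = W then 0 else eta \<rho> VU + 1)"
      show "wp (if eta \<rho> VU + 1 = W then k (CE f) else k (CB f)) \<rho>1 i out t"
        using fin[OF 1(1,2) _ 1(3)] CD by (cases "eta \<rho> VU + 1 = W") simp_all
    qed
  next
    case (CE f)
    consider "eta \<rho> VM \<noteq> eta \<rho> VC" | "eta \<rho> VM = eta \<rho> VC" "\<not> f" | "eta \<rho> VM = eta \<rho> VC" f by blast
    then show ?thesis
    proof cases
      case 1
      then show ?thesis unfolding CE action.simps
        by (intro wp_eqv[OF o]) (use fin[OF o frame_refl _ refl, of CDead] CE 1 in simp)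
    next
      case 2
      then show ?thesis unfolding CE action.simps
        by (intro wp_eqv[OF o]) (use fin[OF o frame_refl _ refl, of CF] CE 2 in simp)
    next
      case 3
      have "wp (Do (asgop (asgM (Some(VX := Some VV)))) (Switch (popop XR) (\<lambda>q. Do (asgop (asgM (Some(VX := None))))
        (if q \<in> tm_accept M then k CDead else incv VE (\<lambda>_. k CF))))) \<rho> i out t"
      proof (rule wp_asgv[OF o], rule wp_pop)
        fix \<rho>1 assume 1: "ready \<rho>1 i" "frame \<rho> \<rho>1" and
          e1: "eta \<rho>1 = (\<lambda>v. case (Some(VX := Some VV)) v of None \<Rightarrow> 0 | Some u \<Rightarrow> eta \<rho> u)"
        show g1: "good \<rho>1" using 1 by (simp add: ready_def)
        have "comps (eta \<rho>1 VX) = (\<rho>1 XL, \<rho>1 XR, \<rho>1 XI)" using g1 by (simp add: eta_num3 comps_num3 good_def)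
        moreover have "eta \<rho>1 VX = eta \<rho> VV" by (simp add: e1)
        ultimately have acc: "\<rho>1 XR mod B \<in> tm_accept M \<longleftrightarrow> vacc (eta \<rho> VV)" by (simp add: vacc_def)
        let ?\<rho> = "\<rho>1(XR := \<rho>1 XR div B)"
        have "\<rho>1 XR div B < N" using g1 by (meson div_le_dividend good_def le_less_trans)
        then have o2: "ready ?\<rho> i" using 1 good_upd[OF g1] by (simp add: ready_def)
        have f2: "frame \<rho> ?\<rho>" using 1 by (simp add: frame_def)
        have e2: "eta ?\<rho> u = eta \<rho> u" if "u \<noteq> VX" for u
        proof -
          have "eta ?\<rho> u = eta \<rho>1 u" using that by (simp add: eta_num3)
          then show ?thesis using that by (simp add: e1)
        qed
        show "wp (Do (asgop (asgM (Some(VX := None))))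
           (if \<rho>1 XR mod B \<in> tm_accept M then k CDead else incv VE (\<lambda>_. k CF))) ?\<rho> i out t"
        proof (rule wp_asgv[OF o2])
          fix \<rho>3 assume 3: "ready \<rho>3 i" "frame ?\<rho> \<rho>3" and
            e: "eta \<rho>3 = (\<lambda>v. case (Some(VX := None)) v of None \<Rightarrow> 0 | Some u \<Rightarrow> eta ?\<rho> u)"
          have e3: "eta \<rho>3 = (eta \<rho>)(VX := 0)" using e2 by (auto simp: fun_eq_iff e)
          have f3: "frame \<rho> \<rho>3" using frame_trans[OF f2 3(2)] .
          show "wp (if \<rho>1 XR mod B \<in> tm_accept M then k CDead else incv VE (\<lambda>_. k CF)) \<rho>3 i out t"
          proof (cases "vacc (eta \<rho> VV)")
            case True
            have "wp (k CDead) \<rho>3 i out t" by (rule fin[OF 3(1) f3 _ e3]) (use CE \<open>eta \<rho> VM = eta \<rho> VC\<close> \<open>f\<close> True in simp)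
            then show ?thesis using acc True by simp
          next
            case False
            have "wp (incv VE (\<lambda>_. k CF)) \<rho>3 i out t"
            proof (rule wp_incv[OF 3(1)])
              fix \<rho>4 assume 4: "ready \<rho>4 i" "frame \<rho>3 \<rho>4"
                "eta \<rho>4 = (eta \<rho>3)(VE := if eta \<rho>3 VE + 1 = W then 0 else eta \<rho>3 VE + 1)"
              have "eta \<rho>3 VE = eta \<rho> VE" by (simp add: e3)
              then have "eta \<rho>4 = (eta \<rho>)(VE := (eta \<rho> VE + 1) mod W, VX := 0)"
                by (simp only: 4(3) sm) (auto simp: e3)
              then show "wp (k CF) \<rho>4 i out t"
                by (rule fin[OF 4(1) frame_trans[OF f3 4(2)], rotated])
                  (use CE \<open>eta \<rho> VM = eta \<rho> VC\<close> \<open>f\<close> False in simp)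
            qed
            then show ?thesis using acc False by simp
          qed
        qed
      qed
      then show ?thesis unfolding CE action.simps using 3 by (intro wp_eqv[OF o]) simp
    qed
  next
    case CF
    show ?thesis unfolding CF action.simps
    proof (rule wp_incv[OF o])
      fix \<rho>1 assume 1: "ready \<rho>1 i" "frame \<rho> \<rho>1"
        "eta \<rho>1 = (eta \<rho>)(VV := if eta \<rho> VV + 1 = W then 0 else eta \<rho> VV + 1)"
      show "wp (if eta \<rho> VV + 1 = W then incv VD (\<lambda>ov. if ov then k CAcc
        else Do (asgop (asgM (Some(VC := Some VE, VE := None)))) (k CA)) else k CA) \<rho>1 i out t"
      proof (cases "eta \<rho> VV + 1 = W")
        case False
        then show ?thesis using fin[OF 1(1,2) _ 1(3)] CF by simp
      next
        case True
        have d: "eta \<rho>1 VD = eta \<rho> VD" by (simp add: 1(3))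
        have "wp (incv VD (\<lambda>ov. if ov then k CAcc
          else Do (asgop (asgM (Some(VC := Some VE, VE := None)))) (k CA))) \<rho>1 i out t"
        proof (rule wp_incv[OF 1(1)])
          fix \<rho>2 assume 2: "ready \<rho>2 i" "frame \<rho>1 \<rho>2"
            "eta \<rho>2 = (eta \<rho>1)(VD := if eta \<rho>1 VD + 1 = W then 0 else eta \<rho>1 VD + 1)"
          have f2: "frame \<rho> \<rho>2" using frame_trans[OF 1(2) 2(2)] .
          show "wp (if eta \<rho>1 VD + 1 = W then k CAcc
            else Do (asgop (asgM (Some(VC := Some VE, VE := None)))) (k CA)) \<rho>2 i out t"
          proof (cases "eta \<rho> VD + 1 = W")
            case D: True
            then have e: "eta \<rho>2 = (eta \<rho>)(VV := 0, VD := 0)" using True by (simp only: 2(3) 1(3) d) simp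
            have "wp (k CAcc) \<rho>2 i out t" by (rule fin[OF 2(1) f2 _ e]) (use CF True D in simp)
            then show ?thesis using D d by simp
          next
            case D: False
            then have e: "eta \<rho>2 = (eta \<rho>)(VV := 0, VD := eta \<rho> VD + 1)" using True by (simp only: 2(3) 1(3) d) simp
            have "wp (Do (asgop (asgM (Some(VC := Some VE, VE := None)))) (k CA)) \<rho>2 i out t"
            proof (rule wp_asgv[OF 2(1)])
              fix \<rho>3 assume 3: "ready \<rho>3 i" "frame \<rho>2 \<rho>3"
                "eta \<rho>3 = (\<lambda>v. case (Some(VC := Some VE, VE := None)) v of None \<Rightarrow> 0 | Some u \<Rightarrow> eta \<rho>2 u)"
              have e3: "eta \<rho>3 = (eta \<rho>)(VV := 0, VD := eta \<rho> VD + 1, VC := eta \<rho> VE, VE := 0)"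
                by (auto simp: fun_eq_iff 3(3) e)
              show "wp (k CA) \<rho>3 i out t" by (rule fin[OF 3(1) frame_trans[OF f2 3(2)] _ e3]) (use CF True D in simp)
            qed
            then show ?thesis using D d by simp
          qed
        qed
        then show ?thesis using True by simp
      qed
    qed
  next
    case CAcc
    show ?thesis unfolding CAcc action.simps using fin[OF o frame_refl] CAcc by simp
  next
    case CDead
    show ?thesis unfolding CDead action.simps using fin[OF o frame_refl] CDead by simp
  qed
qed

end

section \<open>The printed circuit\<close>

lemma relpow_mono: "R \<subseteq> S \<Longrightarrow> R ^^ k \<subseteq> S ^^ k" for R S :: "('x \<times> 'x) set"
  by (induction k) auto

lemma mval_surj:
  assumes "distinct rs" "\<kappa> < N ^ length rs" "0 < N"
  shows "\<exists>\<rho>. (\<forall>r. \<rho> r < N) \<and> mval N \<rho> rs = \<kappa>"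
  using assms
proof (induction rs arbitrary: \<kappa>)
  case Nil
  then show ?case by (intro exI[of _ "\<lambda>_. 0"]) simp
next
  case (Cons r rs)
  have "\<kappa> div N < N ^ length rs" using Cons.prems by (simp add: less_mult_imp_div_less mult.commute)
  then obtain \<rho> where \<rho>: "\<forall>r. \<rho> r < N" "mval N \<rho> rs = \<kappa> div N" using Cons by auto
  let ?\<rho> = "\<rho>(r := \<kappa> mod N)"
  have "mval N ?\<rho> rs = \<kappa> div N" using \<rho>(2) Cons.prems(1) by (metis distinct.simps(2) mval_upd)
  then have "mval N ?\<rho> (r # rs) = \<kappa>" by simp
  moreover have "\<forall>s. ?\<rho> s < N" using \<rho>(1) Cons.prems by simp
  ultimately show ?case by blast
qed

text \<open>A block of nodes may be put in front at once, since their successors lie in the rest of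
  the list.\<close>

lemma (in and_gates) topo_append:
  assumes "topo rest" "distinct ps" "\<And>p. p \<in> set ps \<Longrightarrow> nm p \<notin> nm ` set rest \<and>
      (leaf p \<or> f0 p \<in> set rest \<and> f1 p \<in> set rest \<and> nm (f0 p) \<le> nm (f1 p))"
    "inj_on nm (set ps)"
  shows "topo (ps @ rest)"
  using assms(2-)
proof (induction ps)
  case (Cons p ps)
  have "nm p \<notin> nm ` set ps" using Cons.prems(1,3) by (auto simp: inj_on_def)
  then show ?case using Cons by auto
qed (use assms(1) in simp)

context ntm begin

lemma distinct_ctrls: "distinct ctrls"
  by (auto simp: ctrls_def distinct_map inj_on_def)

lemma ccode_le: "ctrl_ok p \<Longrightarrow> ccode p \<le> ncc"
  by (cases p) (auto simp: ncc_def of_bool_def)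

end

context ntm_run begin

abbreviation "Nn \<equiv> N ^ 24"
abbreviation "Tn \<equiv> N ^ 48"

lemma mval_bundles: "mval N \<rho> (concat (map (bun KM) vs)) = mval W (eta \<rho>) vs"
  by (induction vs) (simp_all add: mval_append eta_def bun_def algebra_simps)

lemma W_power: "W ^ length allvars = Nn"
proof -
  have "W = N ^ 3" by (simp add: power3_eq_cube)
  then show ?thesis by (simp add: allvars_def flip: power_mult)
qed

lemma mval_all: "mval N \<rho> all_regs = mval W (eta \<rho>) allvars + Nn * mval N \<rho> time_regs"
  using mval_bundles[of \<rho> allvars] register_lists(3) by (simp add: all_regs_def mval_append main_regs_def)

lemma mval_main_less: "(\<And>v. \<eta> v < W) \<Longrightarrow> mval W \<eta> allvars < Nn"
  using mval_less[of allvars \<eta> W] by (simp only: W_power)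

lemma goodD: "good \<rho> \<Longrightarrow> \<rho> r < N"
  by (simp add: good_def)

lemma div_Nn: "m < Nn \<Longrightarrow> (m + Nn * t) div Nn = t"
  using N_pos by (subst div_mult_self2) auto

lemma mod_Nn: "m < Nn \<Longrightarrow> (m + Nn * t) mod Nn = m"
  by simp

lemma mval_all_div: "good \<rho> \<Longrightarrow> mval N \<rho> all_regs div Nn = mval N \<rho> time_regs"
  unfolding mval_all by (intro div_Nn mval_main_less eta_less)

text \<open>Registers outside \<open>all_regs\<close> are arbitrary here; neither names nor
  variables depend on them.\<close>

definition dec :: "nat \<Rightarrow> reg \<Rightarrow> nat" where
  "dec \<kappa> = (SOME \<rho>. good \<rho> \<and> mval N \<rho> all_regs = \<kappa>)"

lemma dec: "\<kappa> < Nn * Tn \<Longrightarrow> good (dec \<kappa>) \<and> mval N (dec \<kappa>) all_regs = \<kappa>"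
proof -
  assume "\<kappa> < Nn * Tn"
  moreover have "Nn * Tn = N ^ length all_regs" by (simp add: all_regs_def register_lists flip: power_add)
  ultimately have "\<exists>\<rho>. good \<rho> \<and> mval N \<rho> all_regs = \<kappa>"
    using mval_surj[of all_regs \<kappa> N] register_lists(4) N_pos unfolding good_def by auto
  then show ?thesis unfolding dec_def by (rule someI_ex)
qed

definition name_bits :: "ctrl \<Rightarrow> (reg \<Rightarrow> nat) \<Rightarrow> bool list" where
  "name_bits p \<rho> = True # ucode p @ concat (map (cell_bits B) (tape_of B l \<rho>))"

lemma B_pos: "0 < B" using B by simp

lemma mval_all_less: "good \<rho> \<Longrightarrow> mval N \<rho> all_regs < Nn * Tn"
proof -
  assume "good \<rho>"
  then have "mval N \<rho> all_regs < N ^ length all_regs" by (intro mval_less goodD)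
  then show ?thesis by (simp add: all_regs_def register_lists flip: power_add)
qed

lemma dec_mval:
  assumes g: "good \<rho>" and r: "r \<in> set all_regs"
  shows "dec (mval N \<rho> all_regs) r = \<rho> r"
proof -
  have "good (dec (mval N \<rho> all_regs)) \<and> mval N (dec (mval N \<rho> all_regs)) all_regs = mval N \<rho> all_regs"
    by (rule dec[OF mval_all_less[OF g]])
  then have h: "good (dec (mval N \<rho> all_regs))"
    "mval N (dec (mval N \<rho> all_regs)) all_regs = mval N \<rho> all_regs" by auto
  show ?thesis by (rule mval_inject[OF conjI[OF goodD[OF h(1)] goodD[OF g]] h(2) r])
qed

lemma name_bits_dec: "good \<rho> \<Longrightarrow> name_bits p (dec (mval N \<rho> all_regs)) = name_bits p \<rho>"
  unfolding name_bits_def using digits_cong[of "dec (mval N \<rho> all_regs)" \<rho> B l] dec_mval by simp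

lemma eta_dec_mval:
  assumes "good \<rho>"
  shows "eta (dec (mval N \<rho> all_regs)) = eta \<rho>"
proof
  fix v
  have "set (bun KM v) \<subseteq> set all_regs" unfolding all_regs_def set_append all_regs_banks(1) by (auto simp: bun_def)
  then show "eta (dec (mval N \<rho> all_regs)) v = eta \<rho> v"
    unfolding eta_def by (intro mval_cong dec_mval[OF assms]) auto
qed

definition node_name :: "ctrl \<times> nat \<Rightarrow> nat" where "node_name n = bval (name_bits (fst n) (dec (snd n)))"
definition last_layer :: "ctrl \<times> nat \<Rightarrow> bool" where "last_layer n \<longleftrightarrow> snd n div Nn + 1 = Tn"
definition acc_node :: "ctrl \<times> nat \<Rightarrow> bool" where "acc_node n \<longleftrightarrow> fst n = CAcc"
definition node_succ :: "bool \<Rightarrow> ctrl \<times> nat \<Rightarrow> ctrl \<times> nat" where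
  "node_succ b n = (case istep b (fst n, eta (dec (snd n))) of (p, \<eta>) \<Rightarrow>
     (p, mval W \<eta> allvars + Nn * (snd n div Nn + 1)))"

sublocale and_gates node_name last_layer acc_node "node_succ False" "node_succ True" .

text \<open>Increasing numbers give a legal order, because every edge raises the clock, the most
  significant part.\<close>

definition nodes :: "nat \<Rightarrow> (ctrl \<times> nat) list" where
  "nodes a = concat (map (\<lambda>\<kappa>. map (\<lambda>p. (p,\<kappa>)) ctrls) [a..<Nn * Tn])"

lemma set_nodes: "(p,\<kappa>) \<in> set (nodes a) \<longleftrightarrow> ctrl_ok p \<and> a \<le> \<kappa> \<and> \<kappa> < Nn * Tn"
  by (force simp: nodes_def set_ctrls)

lemma nodes_step: "\<kappa> < Nn * Tn \<Longrightarrow> nodes \<kappa> = map (\<lambda>p. (p,\<kappa>)) ctrls @ nodes (Suc \<kappa>)"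
  by (simp add: nodes_def upt_conv_Cons)

lemma vnum_less:
  assumes "x < W"
  shows "vnum i x < W"
proof -
  obtain L' R' I' where v: "vstep (chs ! i) (comps x) = (L',R',I')" by (cases "vstep (chs ! i) (comps x)")
  have "x div N div N < N" using assms by (intro less_mult_imp_div_less)
  moreover have "x mod N < N" "x div N mod N < N" using N_pos by simp_all
  ultimately have "L' < N \<and> R' < N \<and> I' < N" using v vstep_less unfolding comps_def by blast
  then show ?thesis using num3_less by (simp add: vnum_def v)
qed

lemma istep_less:
  assumes "\<And>v. \<eta> v < W"
  shows "snd (istep b (p, \<eta>)) v < W"
proof -
  have W: "0 < W" using N_pos by simp
  have s: "vstart < W" unfolding vstart_def by (rule num3_less) (use N_pos in auto)
  have suc: "\<eta> u + 1 \<noteq> W \<Longrightarrow> Suc (\<eta> u) < W" for u using assms[of u] by linarith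
  show ?thesis using assms W s vnum_less[OF assms] suc
    by (cases p) (auto simp del: mult_pos_pos nat_0_less_mult_iff)
qed

lemma istep_ctrl_ok: "ctrl_ok p \<Longrightarrow> ctrl_ok (fst (istep b (p, \<eta>)))"
  by (cases p) auto

text \<open>The predecessors of a gate have to be listed in increasing order of their names.\<close>
lemma istep_order:
  "istep False n = istep True n \<or> ccode (fst (istep False n)) < ccode (fst (istep True n))"
  by (cases n; cases "fst n") (auto simp: of_bool_def)

lemma node_succ_nodes:
  assumes "ctrl_ok p" "\<kappa> < Nn * Tn" "\<not> last_layer (p,\<kappa>)"
  shows "node_succ b (p,\<kappa>) \<in> set (nodes (Suc \<kappa>))" "snd (node_succ b (p,\<kappa>)) div Nn = \<kappa> div Nn + 1"
    "eta (dec (snd (node_succ b (p,\<kappa>)))) = snd (istep b (p, eta (dec \<kappa>)))"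
    "fst (node_succ b (p,\<kappa>)) = fst (istep b (p, eta (dec \<kappa>)))"
proof -
  obtain p' \<eta>' where i: "istep b (p, eta (dec \<kappa>)) = (p',\<eta>')" by (cases "istep b (p, eta (dec \<kappa>))")
  have le: "\<eta>' v < W" for v
    using istep_less[of "eta (dec \<kappa>)" b p v] eta_less dec[OF assms(2)] i by simp
  let ?m = "mval W \<eta>' allvars" and ?t = "\<kappa> div Nn"
  have m: "?m < Nn" using mval_main_less le by blast
  have n: "node_succ b (p,\<kappa>) = (p', ?m + Nn * (?t + 1))" by (simp add: node_succ_def i)
  have P: "0 < Nn" using N_pos by simp
  have "?t < Tn" using assms(2) by (simp add: less_mult_imp_div_less mult.commute)
  then have t: "?t + 1 < Tn" using assms(3) by (simp add: last_layer_def)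
  \<comment> \<open>A higher clock makes the number larger whatever happens to the main
    registers.\<close>
  have "\<kappa> < Nn * (?t + 1)" using dividend_less_times_div[OF P, of \<kappa>] by simp
  then have "Suc \<kappa> \<le> ?m + Nn * (?t + 1)" by simp
  moreover have up: "?m + Nn * (?t + 1) < Nn * Tn"
  proof -
    have "?m + Nn * (?t + 1) < Nn * (?t + 1 + 1)" using m by simp
    also have "\<dots> \<le> Nn * Tn" using t by (intro mult_le_mono2) simp
    finally show ?thesis .
  qed
  moreover have "ctrl_ok p'" using istep_ctrl_ok[OF assms(1), of b "eta (dec \<kappa>)"] i by simp
  ultimately show "node_succ b (p,\<kappa>) \<in> set (nodes (Suc \<kappa>))" unfolding n set_nodes by simp
  show dv: "snd (node_succ b (p,\<kappa>)) div Nn = \<kappa> div Nn + 1" unfolding n snd_conv by (rule div_Nn[OF m])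
  show "fst (node_succ b (p,\<kappa>)) = fst (istep b (p, eta (dec \<kappa>)))" unfolding n i by simp
  have d: "good (dec (?m + Nn * (?t + 1)))" "mval N (dec (?m + Nn * (?t + 1))) all_regs = ?m + Nn * (?t + 1)"
    using dec[OF up] by auto
  have "mval W (eta (dec (?m + Nn * (?t + 1)))) allvars = ?m"
    using arg_cong[OF d(2), of "\<lambda>x. x mod Nn"] mod_Nn[OF m]
      mod_Nn[OF mval_main_less[of "eta (dec (?m + Nn * (?t + 1)))"], OF eta_less[OF d(1)]]
    unfolding mval_all by (simp only:)
  then have "eta (dec (?m + Nn * (?t + 1))) v = \<eta>' v" if "v \<in> set allvars" for v
    using mval_inject[of allvars _ W \<eta>' v] eta_less[OF d(1)] le that by blast
  moreover have "v \<in> set allvars" for v by (cases v) (auto simp: allvars_def)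
  ultimately show "eta (dec (snd (node_succ b (p,\<kappa>)))) = snd (istep b (p, eta (dec \<kappa>)))" unfolding n i by auto
qed

lemma ucode_length: "ctrl_ok p \<Longrightarrow> length (ucode p) = ncc"
  unfolding ucode_def by (rule dcode_length[OF ccode_le])

lemma name_bits_length: "ctrl_ok p \<Longrightarrow> length (name_bits p \<rho>) = 1 + ncc + l * (B * length all_regs)"
  by (simp add: name_bits_def ucode_length digits_length[OF B_pos])

text \<open>All name strings have the same length. Equal values thus mean equal strings, which split
  into the control code and the digits.\<close>

lemma node_name_inject:
  assumes "ctrl_ok p" "ctrl_ok q" "\<kappa> < Nn * Tn" "\<kappa>' < Nn * Tn" "node_name (p,\<kappa>) = node_name (q,\<kappa>')"
  shows "p = q \<and> \<kappa> = \<kappa>'"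
proof -
  have "name_bits p (dec \<kappa>) = name_bits q (dec \<kappa>')"
    using assms bval_inject[of "name_bits p (dec \<kappa>)" "name_bits q (dec \<kappa>')"] name_bits_length
    by (simp add: node_name_def)
  then have e: "ucode p @ concat (map (cell_bits B) (tape_of B l (dec \<kappa>))) =
     ucode q @ concat (map (cell_bits B) (tape_of B l (dec \<kappa>')))" by (simp add: name_bits_def)
  have l: "length (ucode p) = length (ucode q)" using assms ucode_length by simp
  have u: "ucode p = ucode q \<and> concat (map (cell_bits B) (tape_of B l (dec \<kappa>))) = concat (map (cell_bits B) (tape_of B l (dec \<kappa>')))"
    using e by (rule append_eq_append_conv[OF disjI1[OF l], THEN iffD1])
  have "p = q" using u unfolding ucode_def by (meson dcode_inject ccode_inject)
  moreover have "dec \<kappa> r = dec \<kappa>' r" if "r \<in> set all_regs" for r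
  proof -
    have "dec \<kappa> r mod B ^ l = dec \<kappa>' r mod B ^ l"
      by (rule digits_inject[OF B_pos _ that]) (use u in blast)
    moreover have "dec \<kappa> r < N" "dec \<kappa>' r < N"
      using dec[OF assms(3), THEN conjunct1, THEN goodD] dec[OF assms(4), THEN conjunct1, THEN goodD] by blast+
    ultimately show ?thesis by (simp flip: N_def)
  qed
  then have "mval N (dec \<kappa>) all_regs = mval N (dec \<kappa>') all_regs" by (rule mval_cong)
  then have "\<kappa> = \<kappa>'" using dec[OF assms(3)] dec[OF assms(4)] by simp
  ultimately show ?thesis by simp
qed

lemma node_name_order:
  assumes "ctrl_ok p"
  shows "node_name (node_succ False (p,\<kappa>)) \<le> node_name (node_succ True (p,\<kappa>))"
proof -
  let ?n = "(p, eta (dec \<kappa>))"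
  have f: "fst (node_succ b (p,\<kappa>)) = fst (istep b ?n)" for b by (auto simp: node_succ_def split: prod.splits)
  from istep_order[of ?n] show ?thesis
  proof
    assume "istep False ?n = istep True ?n"
    then have "node_succ False (p,\<kappa>) = node_succ True (p,\<kappa>)" unfolding node_succ_def by simp
    then show ?thesis by simp
  next
    assume "ccode (fst (istep False ?n)) < ccode (fst (istep True ?n))"
    then show ?thesis unfolding node_name_def name_bits_def ucode_def f
      by (intro less_imp_le bval_dcode_mono ccode_le istep_ctrl_ok assms) (simp_all add: digits_length[OF B_pos])
  qed
qed

lemma topo_nodes: "\<kappa> \<le> Nn * Tn \<Longrightarrow> topo (nodes \<kappa>)"
proof (induction rule: inc_induct)
  case base
  then show ?case by (simp add: nodes_def)
next
  case (step \<kappa>)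
  show ?case unfolding nodes_step[OF step.hyps(2)]
  proof (rule topo_append[OF step.IH])
    show "distinct (map (\<lambda>p. (p,\<kappa>)) ctrls)" by (simp add: distinct_map distinct_ctrls inj_on_def)
    show "inj_on node_name (set (map (\<lambda>p. (p,\<kappa>)) ctrls))"
      using node_name_inject step.hyps(2) by (auto simp: inj_on_def set_ctrls)
    fix n assume "n \<in> set (map (\<lambda>p. (p,\<kappa>)) ctrls)"
    then obtain p where n: "n = (p,\<kappa>)" "ctrl_ok p" by (auto simp: set_ctrls)
    have "node_name (p,\<kappa>) \<noteq> node_name (q,\<kappa>')" if "(q,\<kappa>') \<in> set (nodes (Suc \<kappa>))" for q \<kappa>'
      using node_name_inject[of p q \<kappa> \<kappa>'] that n(2) step.hyps(2) unfolding set_nodes by auto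
    then show "node_name n \<notin> node_name ` set (nodes (Suc \<kappa>)) \<and> (last_layer n \<or> node_succ False n \<in> set (nodes (Suc \<kappa>)) \<and>
      node_succ True n \<in> set (nodes (Suc \<kappa>)) \<and> node_name (node_succ False n) \<le> node_name (node_succ True n))"
      unfolding n(1) using node_succ_nodes(1)[OF n(2) step.hyps(2)] node_name_order[OF n(2)] by auto
  qed
qed

section \<open>The value of the circuit\<close>

definition safe :: "ctrl \<times> nat \<Rightarrow> bool" where
  "safe n \<longleftrightarrow> (\<forall>m. ((fst n, eta (dec (snd n))), m) \<in> irel ^^ (Tn - 1 - snd n div Nn) \<longrightarrow> fst m \<noteq> CAcc)"

text \<open>\<open>irel\<close> branches into just the two choices, so avoiding \<open>CAcc\<close>
  from a node is the conjunction over its two successors with one step less to go.\<close>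

lemma safe_rec:
  assumes "n \<in> set (nodes 0)"
  shows "safe n \<longleftrightarrow> (if last_layer n then \<not> acc_node n else safe (node_succ False n) \<and> safe (node_succ True n))"
proof -
  obtain p \<kappa> where n: "n = (p,\<kappa>)" by (cases n)
  have p: "ctrl_ok p" "\<kappa> < Nn * Tn" using assms unfolding n set_nodes by auto
  show ?thesis
  proof (cases "last_layer n")
    case True
    then have "Tn - 1 - snd n div Nn = 0" by (simp add: last_layer_def)
    then show ?thesis using True unfolding safe_def acc_node_def by simp
  next
    case False
    have "\<kappa> div Nn < Tn" using p(2) by (simp add: less_mult_imp_div_less mult.commute)
    then have k: "Tn - 1 - \<kappa> div Nn = Suc (Tn - 1 - (\<kappa> div Nn + 1))" using False by (simp add: last_layer_def n)
    note nx = node_succ_nodes[OF p False[unfolded n]]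
    let ?s = "(p, eta (dec \<kappa>))"
    have r: "(?s, m) \<in> irel ^^ (Suc k) \<longleftrightarrow> (istep False ?s, m) \<in> irel ^^ k \<or> (istep True ?s, m) \<in> irel ^^ k" for m k
    proof -
      have e1: "(?s, m) \<in> irel ^^ (Suc k) \<longleftrightarrow> (\<exists>y. (?s, y) \<in> irel \<and> (y, m) \<in> irel ^^ k)"
        unfolding relpow.simps(2) relpow_commute[symmetric] by blast
      have e2: "(?s, y) \<in> irel \<longleftrightarrow> y = istep False ?s \<or> y = istep True ?s" for y
        unfolding irel_def by (auto, metis (full_types))
      show ?thesis unfolding e1 e2 by blast
    qed
    have s: "(fst (node_succ b (p,\<kappa>)), eta (dec (snd (node_succ b (p,\<kappa>))))) = istep b ?s" for b
      unfolding nx(3,4) by simp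
    show ?thesis using False unfolding n safe_def s nx(2) fst_conv snd_conv k r by auto
  qed
qed

text \<open>A path can be shortened to at most as many steps as there are edges, and these are fewer
  than \<open>Tn\<close>. The loop at \<open>CAcc\<close> then stretches it to exactly
  \<open>Tn - 1\<close> steps.\<close>

lemma reach_bounded:
  assumes B2: "2 * length ctrls < B"
  shows "(\<exists>m. ((CI, \<lambda>_. 0), m) \<in> irel ^^ (Tn - 1) \<and> fst m = CAcc) \<longleftrightarrow> (\<exists>\<eta>. ((CI, \<lambda>_. 0), (CAcc, \<eta>)) \<in> irel\<^sup>*)"
proof
  assume "\<exists>m. ((CI, \<lambda>_. 0), m) \<in> irel ^^ (Tn - 1) \<and> fst m = CAcc"
  then obtain \<eta> where "((CI, \<lambda>_. 0), (CAcc, \<eta>)) \<in> irel ^^ (Tn - 1)" by (metis prod.collapse)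
  then have "((CI, \<lambda>_. 0), (CAcc, \<eta>)) \<in> irel\<^sup>*" by (rule relpow_imp_rtrancl)
  then show "\<exists>\<eta>. ((CI, \<lambda>_. 0), (CAcc, \<eta>)) \<in> irel\<^sup>*" by blast
next
  assume "\<exists>\<eta>. ((CI, \<lambda>_. 0), (CAcc, \<eta>)) \<in> irel\<^sup>*"
  then obtain \<eta> where e: "((CI, \<lambda>_. 0), (CAcc, \<eta>)) \<in> irel\<^sup>*" by blast
  define S :: "(ctrl \<times> (var \<Rightarrow> nat)) set" where "S = {n. ctrl_ok (fst n) \<and> (\<forall>v. snd n v < W)}"
  \<comment> \<open>\<open>irel\<close> is infinite, as valuations are unbounded; runs from the
    start stay in this finite part.\<close>
  define R where "R = (\<lambda>(n,b). (n, istep b n)) ` (S \<times> UNIV)"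
  have W: "0 < W" using N_pos by simp
  let ?h = "\<lambda>n. (fst n, mval W (snd n) allvars)"
  have inj: "inj_on ?h S"
  proof (rule inj_onI)
    fix x y assume x: "x \<in> S" "y \<in> S" "?h x = ?h y"
    have "snd x v = snd y v" for v
      by (rule mval_inject[of allvars _ W]) (use x in \<open>auto simp: S_def allvars_def, cases v, auto\<close>)
    then show "x = y" using x(3) by (auto simp: prod_eq_iff)
  qed
  have sub: "?h ` S \<subseteq> set ctrls \<times> {..<Nn}"
  proof
    fix y assume "y \<in> ?h ` S"
    then obtain n where n: "n \<in> S" "y = ?h n" by blast
    then have "mval W (snd n) allvars < Nn" by (intro mval_main_less) (simp add: S_def)
    then show "y \<in> set ctrls \<times> {..<Nn}" using n by (simp add: S_def set_ctrls)
  qed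
  have finS: "finite S" using inj sub by (meson finite_SigmaI finite_imageD finite_lessThan finite_set finite_subset)
  have "card S \<le> card (set ctrls \<times> {..<Nn})" by (rule card_inj_on_le[OF inj sub]) simp
  also have "\<dots> \<le> length ctrls * Nn" by (simp add: card_length)
  finally have cS: "card S \<le> length ctrls * Nn" .
  have finR: "finite R" unfolding R_def using finS by simp
  have "card R \<le> card (S \<times> (UNIV :: bool set))" unfolding R_def by (rule card_image_le) (use finS in simp)
  also have "\<dots> = 2 * card S" by (simp add: card_cartesian_product)
  also have "\<dots> \<le> 2 * (length ctrls * Nn)" using cS by (intro mult_le_mono2)
  also have "\<dots> = 2 * length ctrls * Nn" by (simp only: mult.assoc)
  also have "\<dots> < N * Nn"
  proof -
    have "2 * length ctrls < N" using B2 B_le_N by simp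
    then show ?thesis using N_pos by simp
  qed
  also have "\<dots> \<le> Tn"
  proof -
    have "N ^ 25 \<le> N ^ 48" using N_pos by (intro power_increasing) auto
    then show ?thesis by (simp add: power_add[of N 1 24, simplified, symmetric])
  qed
  finally have cR: "card R \<le> Tn - 1" by simp
  have "((CI, \<lambda>_. 0), m) \<in> R\<^sup>* \<and> m \<in> S" if "((CI, \<lambda>_. 0), m) \<in> irel\<^sup>*" for m
    using that
  proof (induction rule: rtrancl_induct)
    case base
    then show ?case using W by (simp add: S_def)
  next
    case (step y z)
    then obtain b where z: "z = istep b y" by (auto simp: irel_def)
    have "z \<in> S" using step.IH istep_less[of "snd y" b "fst y"] istep_ctrl_ok[of "fst y" b "snd y"] z by (auto simp: S_def)
    moreover have "(y, z) \<in> R" using step.IH z unfolding R_def by (auto intro!: image_eqI[of _ _ "(y,b)"])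
    ultimately show ?case using step.IH by (meson rtrancl.rtrancl_into_rtrancl)
  qed
  from this[OF e] have "((CI, \<lambda>_. 0), (CAcc, \<eta>)) \<in> R\<^sup>*" by blast
  then obtain k where k: "k \<le> card R" "((CI, \<lambda>_. 0), (CAcc, \<eta>)) \<in> R ^^ k"
    unfolding rtrancl_finite_eq_relpow[OF finR] by auto
  have "R \<subseteq> irel" unfolding R_def irel_def by auto
  then have "((CI, \<lambda>_. 0), (CAcc, \<eta>)) \<in> irel ^^ k" using k(2) relpow_mono by blast
  moreover have "((CAcc, \<eta>), (CAcc, \<eta>)) \<in> irel ^^ j" for j
  proof (induction j)
    case (Suc j)
    have "((CAcc, \<eta>), istep True (CAcc, \<eta>)) \<in> irel" unfolding irel_def by blast
    then have "((CAcc, \<eta>), (CAcc, \<eta>)) \<in> irel" by simp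
    then show ?case using Suc by auto
  qed simp
  ultimately have "((CI, \<lambda>_. 0), (CAcc, \<eta>)) \<in> irel ^^ (k + (Tn - 1 - k))" unfolding relpow_add by blast
  moreover have "k + (Tn - 1 - k) = Tn - 1" using k(1) cR by linarith
  ultimately show "\<exists>m. ((CI, \<lambda>_. 0), m) \<in> irel ^^ (Tn - 1) \<and> fst m = CAcc" by (metis fst_conv)
qed

lemma start_node: "(CI, 0) \<in> set (nodes 0)"
  unfolding set_nodes using N_pos by simp

theorem circuit_correct:
  assumes "2 * length ctrls < B"
  shows "is_circuit {ODiv} (map mk_gate (nodes 0)) (node_name (CI, 0))"
    "1 \<in> sem (map mk_gate (nodes 0)) (node_name (CI, 0)) \<longleftrightarrow> accepts M w"
proof -
  show "is_circuit {ODiv} (map mk_gate (nodes 0)) (node_name (CI, 0))"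
    unfolding is_circuit_def using valid_gates_topo[OF topo_nodes[of 0]] start_node by force
  have z: "good (\<lambda>_. 0)" using N_pos by (simp add: good_def)
  have m0: "mval N' (\<lambda>_. 0) rs = 0" for N' and rs :: "'b list" by (induction rs) auto
  have "eta (dec 0) = eta (\<lambda>_. 0)" using eta_dec_mval[OF z] m0[of N all_regs] by simp
  then have e: "eta (dec 0) = (\<lambda>_. 0)" by (simp add: eta_def m0 fun_eq_iff)
  have "1 \<in> sem (map mk_gate (nodes 0)) (node_name (CI, 0)) \<longleftrightarrow> safe (CI, 0)"
    using sem_topo[OF topo_nodes[of 0] start_node, of safe] safe_rec by simp
  also have "\<dots> \<longleftrightarrow> \<not> (\<exists>m. ((CI, \<lambda>_. 0), m) \<in> irel ^^ (Tn - 1) \<and> fst m = CAcc)"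
    unfolding safe_def by (auto simp: e)
  also have "\<dots> \<longleftrightarrow> accepts M w" unfolding reach_bounded[OF assms] accepts_iff ..
  finally show "1 \<in> sem (map mk_gate (nodes 0)) (node_name (CI, 0)) \<longleftrightarrow> accepts M w" .
qed

end

section \<open>Printing the gates\<close>

abbreviation tcode :: "tok list \<Rightarrow> bool list" where "tcode ts \<equiv> concat (map tok_code ts)"

lemma num_toks_01: "num_toks 0 = [T0]" "num_toks (Suc 0) = [T1]"
  by (simp_all add: num_toks_def bin.simps)

context ntm_run begin

lemma wp_emit_toks: "wp k \<rho> i (out @ tcode ts) P \<Longrightarrow> wp (emit ts k) \<rho> i out P"
  unfolding emit_def by (rule wp_emit)

lemma wp_print_name: 
  assumes "wp k \<rho> i (out @ bits_code (name_bits p \<rho>)) P"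
  shows "wp (print_name p k) \<rho> i out P"
proof -
  have "bits_code (name_bits p \<rho>) = bits_code (True # ucode p) @ concat (map (\<lambda>x. bits_code (cell_bits B x)) (tape_of B l \<rho>))"
  proof -
    have "name_bits p \<rho> = (True # ucode p) @ concat (map (cell_bits B) (tape_of B l \<rho>))" by (simp add: name_bits_def)
    then show ?thesis by (simp only: bits_code_append bits_code_concat map_map comp_def)
  qed
  then have "wp k \<rho> i ((out @ bits_code (True # ucode p)) @ concat (map (\<lambda>x. bits_code (cell_bits B x)) (tape_of B l \<rho>))) P"
    using assms by (simp only: append_assoc)
  then have "wp (Do (printop (\<lambda>x. bits_code (cell_bits B x))) k) \<rho> i (out @ bits_code (True # ucode p)) P"
    by (rule wp_print)
  then show ?thesis unfolding print_name_def by (rule wp_emit)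
qed

lemma tcode_name: "good \<rho> \<Longrightarrow> tcode (num_toks (node_name (p, mval N \<rho> all_regs))) = bits_code (name_bits p \<rho>)"
  by (simp only: bits_code_num_toks node_name_def fst_conv snd_conv name_bits_dec) (simp only: name_bits_def bin_bval_True)

text \<open>In contrast to \<open>frame\<close>, the main registers are preserved as well, because
  they have been restored; the backup banks may have changed.\<close>

definition frame2 :: "(reg \<Rightarrow> nat) \<Rightarrow> (reg \<Rightarrow> nat) \<Rightarrow> bool" where
  "frame2 \<rho> \<rho>' \<longleftrightarrow> (\<forall>k y. k \<in> {KM,KT,KU} \<or> k = KX \<and> (k,y) \<noteq> PP \<longrightarrow> \<rho>' (k,y) = \<rho> (k,y))"

lemma frame2_refl: "frame2 \<rho> \<rho>" by (simp add: frame2_def)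

lemma frame2_trans: "frame2 \<rho> \<rho>' \<Longrightarrow> frame2 \<rho>' \<rho>'' \<Longrightarrow> frame2 \<rho> \<rho>''"
  by (simp add: frame2_def)

lemma mval_all_cong:
  assumes "\<And>k y. k \<in> {KM,KT,KU} \<Longrightarrow> \<rho>' (k,y) = \<rho> (k,y)"
  shows "mval N \<rho>' all_regs = mval N \<rho> all_regs" "mval N \<rho>' time_regs = mval N \<rho> time_regs" "eta \<rho>' = eta \<rho>"
proof -
  have "\<rho>' r = \<rho> r" if "fst r \<in> {KM,KT,KU}" for r using assms[of "fst r" "snd r"] that by simp
  then show "mval N \<rho>' all_regs = mval N \<rho> all_regs" "mval N \<rho>' time_regs = mval N \<rho> time_regs"
    unfolding all_regs_def by (intro mval_cong; use all_regs_banks in auto)+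
  show "eta \<rho>' = eta \<rho>" using assms by (auto simp: eta_num3)
qed

definition backed_up :: "(reg \<Rightarrow> nat) \<Rightarrow> bool" where
  "backed_up \<rho> \<longleftrightarrow> (\<forall>y. \<rho> (KB,y) = \<rho> (KM,y) \<and> \<rho> (KC,y) = \<rho> (KT,y) \<and> \<rho> (KD,y) = \<rho> (KU,y))"

lemma minc_time:
  assumes "ready \<rho> i"
  shows "ready (fst (minc N time_regs \<rho>)) i"
    "snd (minc N time_regs \<rho>) \<longleftrightarrow> mval N \<rho> time_regs + 1 = Tn"
    "mval N \<rho> time_regs + 1 \<noteq> Tn \<Longrightarrow> mval N (fst (minc N time_regs \<rho>)) time_regs = mval N \<rho> time_regs + 1"
    "fst r \<noteq> KT \<Longrightarrow> fst r \<noteq> KU \<Longrightarrow> fst (minc N time_regs \<rho>) r = \<rho> r"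
    "eta (fst (minc N time_regs \<rho>)) = eta \<rho>"
proof -
  have g: "good \<rho>" using assms by (simp add: ready_def)
  have "\<And>r. r \<in> set time_regs \<Longrightarrow> \<rho> r < N" using g by (rule goodD)
  note sp = minc_spec[OF register_lists(1), of \<rho> N, unfolded register_lists(2), OF this]
  show "snd (minc N time_regs \<rho>) \<longleftrightarrow> mval N \<rho> time_regs + 1 = Tn" using sp by blast
  show "mval N \<rho> time_regs + 1 \<noteq> Tn \<Longrightarrow> mval N (fst (minc N time_regs \<rho>)) time_regs = mval N \<rho> time_regs + 1"
    using sp by presburger
  show f: "fst r \<noteq> KT \<Longrightarrow> fst r \<noteq> KU \<Longrightarrow> fst (minc N time_regs \<rho>) r = \<rho> r" for r
    using sp all_regs_banks(2) by blast
  show "ready (fst (minc N time_regs \<rho>)) i" using assms good_minc[OF g] f[of NN] by (simp add: ready_def)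
  show "eta (fst (minc N time_regs \<rho>)) = eta \<rho>" using f by (auto simp: eta_num3)
qed

lemma restore:
  assumes "ready \<rho> i"
  shows "ready (\<lambda>r. case restore_regs r of None \<Rightarrow> 0 | Some s \<Rightarrow> \<rho> s) i"
  using assms by (auto simp: ready_def good_def restore_regs_def)

text \<open>Neither the clock increment nor the transition touches the backup banks, so restoring
  undoes both; only \<open>PP\<close> may differ afterwards.\<close>

lemma wp_branch:
  assumes o: "ready \<rho> i" and p: "ctrl_ok p" and bu: "backed_up \<rho>" and nl: "mval N \<rho> time_regs + 1 \<noteq> Tn"
    and k: "\<And>\<rho>' i'. ready \<rho>' i' \<Longrightarrow> (\<And>r. r \<noteq> PP \<Longrightarrow> \<rho>' r = \<rho> r) \<Longrightarrow>
      wp k \<rho>' i' (out @ tcode (num_toks (node_name (node_succ b (p, mval N \<rho> all_regs))) @ ts)) P"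
  shows "wp (action p b (\<lambda>p'. print_name p' (emit ts (Do (asgop restore_regs) k)))) (fst (minc N time_regs \<rho>)) i out P"
proof (rule wp_action[OF minc_time(1)[OF o] p], rule wp_print_name, rule wp_emit_toks, rule wp_asg)
  let ?\<rho>2 = "fst (minc N time_regs \<rho>)" and ?\<kappa> = "mval N \<rho> all_regs"
  fix \<rho>3 i3
  assume 3: "ready \<rho>3 i3" "frame ?\<rho>2 \<rho>3" "eta \<rho>3 = snd (istep b (p, eta ?\<rho>2))"
  let ?\<rho>4 = "\<lambda>r. case restore_regs r of None \<Rightarrow> 0 | Some s \<Rightarrow> \<rho>3 s"
  have g: "good \<rho>" "good \<rho>3" using o 3 by (auto simp: ready_def)
  have f3: "\<rho>3 (k,y) = \<rho> (k,y)" if "k \<notin> {KM,KT,KU}" "(k,y) \<noteq> PP" for k y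
    using 3(2)[unfolded frame_def, rule_format, of "(k,y)"] minc_time(4)[OF o, of "(k,y)"] that by simp
  have t3: "\<rho>3 (k,y) = ?\<rho>2 (k,y)" if "k \<in> {KT,KU}" for k y
    using 3(2)[unfolded frame_def, rule_format, of "(k,y)"] that by auto
  have "mval N \<rho>3 time_regs = mval N ?\<rho>2 time_regs"
    by (rule mval_cong) (use t3 all_regs_banks in auto)
  then have t: "mval N \<rho>3 time_regs = ?\<kappa> div Nn + 1" using minc_time(3)[OF o nl] mval_all_div[OF g(1)] by simp
  \<comment> \<open>The main registers after the transition and the advanced clock together spell
    the number of the successor.\<close>
  have nx: "node_succ b (p, ?\<kappa>) = (fst (istep b (p, eta ?\<rho>2)), mval N \<rho>3 all_regs)"
    using eta_dec_mval[OF g(1)] by (simp add: node_succ_def mval_all t 3(3) minc_time(5)[OF o] case_prod_unfold)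
  have nm: "bits_code (name_bits (fst (istep b (p, eta ?\<rho>2))) \<rho>3) = tcode (num_toks (node_name (node_succ b (p, ?\<kappa>))))"
    unfolding nx by (rule tcode_name[OF g(2), symmetric])
  have r4: "?\<rho>4 r = \<rho> r" if "r \<noteq> PP" for r
  proof -
    obtain k y where r: "r = (k,y)" by (cases r)
    have "\<rho> (KB,y) = \<rho> (KM,y)" "\<rho> (KC,y) = \<rho> (KT,y)" "\<rho> (KD,y) = \<rho> (KU,y)"
      using bu unfolding backed_up_def by blast+
    then show ?thesis using that f3[of _ y] unfolding r by (cases k) (auto simp: restore_regs_def)
  qed
  show "wp k ?\<rho>4 i3 ((out @ bits_code (name_bits (fst (istep b (p, eta ?\<rho>2))) \<rho>3)) @ tcode ts) P"
    unfolding nm using k[OF restore[OF 3(1)] r4] by simp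
qed

lemma wp_gate_com:
  assumes o: "ready \<rho> i" and p: "ctrl_ok p"
    and k: "\<And>\<rho>' i'. ready \<rho>' i' \<Longrightarrow> frame2 \<rho> \<rho>' \<Longrightarrow>
      wp k \<rho>' i' (out @ tcode (gate_toks (mk_gate (p, mval N \<rho> all_regs)))) P"
  shows "wp (gate_com p k) \<rho> i out P"
  unfolding gate_com_def
proof (rule wp_asg, rule wp_print_name, rule wp_emit_toks)
  let ?\<rho>1 = "\<lambda>r. case copy_regs r of None \<Rightarrow> 0 | Some s \<Rightarrow> \<rho> s" and ?\<kappa> = "mval N \<rho> all_regs"
  have o1: "ready ?\<rho>1 i" using o by (auto simp: ready_def good_def copy_regs_def)
  have g1: "good ?\<rho>1" using o1 by (simp add: ready_def)
  have f1: "?\<rho>1 (k,y) = \<rho> (k,y)" if "k \<notin> {KB,KC,KD}" for k y using that by (cases k) (auto simp: copy_regs_def)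
  have bu: "backed_up ?\<rho>1" by (simp add: backed_up_def copy_regs_def)
  have "mval N ?\<rho>1 all_regs = ?\<kappa>" "mval N ?\<rho>1 time_regs = mval N \<rho> time_regs"
    by (rule mval_all_cong, rule f1, blast)+
  note m1 = this
  have nm: "bits_code (name_bits p ?\<rho>1) = tcode (num_toks (node_name (p, ?\<kappa>)))" using tcode_name[OF g1, of p] m1(1) by simp
  have lf: "last_layer (p, ?\<kappa>) \<longleftrightarrow> mval N ?\<rho>1 time_regs + 1 = Tn"
    using mval_all_div[OF g1] m1 by (simp add: last_layer_def)
  let ?out = "(out @ bits_code (name_bits p ?\<rho>1)) @ tcode [TSep]"
  have fr: "frame2 \<rho> \<rho>'" if "\<And>r. r \<noteq> PP \<Longrightarrow> \<rho>' r = ?\<rho>1 r" for \<rho>'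
    unfolding frame2_def using that f1 by auto
  show "wp (incs B time_regs (\<lambda>ov. if ov
     then Do (asgop restore_regs) (emit [TIn, if p = CAcc then T0 else T1, TSep, TEnd] k)
     else emit [TDiv, TSep] (action p False (\<lambda>p'. print_name p' (emit [TSep]
       (Do (asgop restore_regs) (incs B time_regs (\<lambda>_. action p True (\<lambda>p'. print_name p' (emit [TSep, TEnd]
         (Do (asgop restore_regs) k))))))))))) ?\<rho>1 i ?out P"
  proof (rule wp_incs[OF g1])
    let ?\<rho>2 = "fst (minc N time_regs ?\<rho>1)"
    show "wp (if snd (minc N time_regs ?\<rho>1)
     then Do (asgop restore_regs) (emit [TIn, if p = CAcc then T0 else T1, TSep, TEnd] k)
     else emit [TDiv, TSep] (action p False (\<lambda>p'. print_name p' (emit [TSep]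
       (Do (asgop restore_regs) (incs B time_regs (\<lambda>_. action p True (\<lambda>p'. print_name p' (emit [TSep, TEnd]
         (Do (asgop restore_regs) k))))))))))  ?\<rho>2 i ?out P"
    proof (cases "mval N ?\<rho>1 time_regs + 1 = Tn")
      case True
      let ?\<rho>3 = "\<lambda>r. case restore_regs r of None \<Rightarrow> 0 | Some s \<Rightarrow> ?\<rho>2 s"
      have r3: "?\<rho>3 r = ?\<rho>1 r" for r
      proof -
        obtain k y where r: "r = (k,y)" by (cases r)
        show ?thesis unfolding r
          by (cases k) (simp_all add: restore_regs_def minc_time(4)[OF o1], simp_all add: copy_regs_def)
      qed
      have gt: "gate_toks (mk_gate (p, ?\<kappa>)) =
        num_toks (node_name (p, ?\<kappa>)) @ [TSep] @ [TIn, if p = CAcc then T0 else T1, TSep, TEnd]"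
        using True lf by (simp add: mk_gate_def gate_toks_def gname_def glabel_def gpreds_def acc_node_def num_toks_01)
      have "wp k ?\<rho>3 i (?out @ tcode [TIn, if p = CAcc then T0 else T1, TSep, TEnd]) P"
        using k[OF restore[OF minc_time(1)[OF o1]] fr[OF r3]] unfolding nm gt by simp
      then have "wp (Do (asgop restore_regs) (emit [TIn, if p = CAcc then T0 else T1, TSep, TEnd] k)) ?\<rho>2 i ?out P"
        by (intro wp_asg wp_emit_toks)
      then show ?thesis using True minc_time(2)[OF o1] by simp
    next
      case False
      have gt: "gate_toks (mk_gate (p, ?\<kappa>)) = num_toks (node_name (p, ?\<kappa>)) @ [TSep] @ [TDiv, TSep] @
         (num_toks (node_name (node_succ False (p, ?\<kappa>))) @ [TSep]) @ (num_toks (node_name (node_succ True (p, ?\<kappa>))) @ [TSep, TEnd])"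
        using False lf by (simp add: mk_gate_def gate_toks_def gname_def glabel_def gpreds_def)
      have "wp (action p False (\<lambda>p'. print_name p' (emit [TSep]
         (Do (asgop restore_regs) (incs B time_regs (\<lambda>_. action p True (\<lambda>p'. print_name p' (emit [TSep, TEnd]
         (Do (asgop restore_regs) k))))))))) ?\<rho>2 i (?out @ tcode [TDiv, TSep]) P"
      proof (rule wp_branch[OF o1 p bu False])
        fix \<rho>4 i4
        assume o4: "ready \<rho>4 i4" and f4: "\<And>r. r \<noteq> PP \<Longrightarrow> \<rho>4 r = ?\<rho>1 r"
        have bu4: "backed_up \<rho>4" using bu f4 by (auto simp: backed_up_def)
        have "mval N \<rho>4 all_regs = mval N ?\<rho>1 all_regs" "mval N \<rho>4 time_regs = mval N ?\<rho>1 time_regs"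
          by (rule mval_all_cong, rule f4, blast)+
        then have m4: "mval N \<rho>4 all_regs = ?\<kappa>" "mval N \<rho>4 time_regs + 1 \<noteq> Tn" using m1(1) False by simp_all
        let ?out4 = "(?out @ tcode [TDiv, TSep]) @ tcode (num_toks (node_name (node_succ False (p, mval N ?\<rho>1 all_regs))) @ [TSep])"
        have g4: "good \<rho>4" using o4 by (simp add: ready_def)
        show "wp (incs B time_regs (\<lambda>_. action p True (\<lambda>p'. print_name p' (emit [TSep, TEnd]
           (Do (asgop restore_regs) k))))) \<rho>4 i4 ?out4 P"
        proof (rule wp_incs[OF g4], rule wp_branch[OF o4 p bu4 m4(2)])
          fix \<rho>6 i6
          assume o6: "ready \<rho>6 i6" and f6: "\<And>r. r \<noteq> PP \<Longrightarrow> \<rho>6 r = \<rho>4 r"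
          have "\<And>r. r \<noteq> PP \<Longrightarrow> \<rho>6 r = ?\<rho>1 r" using f4 f6 by simp
          then have "frame2 \<rho> \<rho>6" by (rule fr)
          then show "wp k \<rho>6 i6 (?out4 @ tcode (num_toks (node_name (node_succ True (p, mval N \<rho>4 all_regs))) @ [TSep, TEnd])) P"
            using k[OF o6] unfolding nm gt m1 m4(1) by simp
        qed
      qed
      then have "wp (emit [TDiv, TSep] (action p False (\<lambda>p'. print_name p' (emit [TSep]
         (Do (asgop restore_regs) (incs B time_regs (\<lambda>_. action p True (\<lambda>p'. print_name p' (emit [TSep, TEnd]
         (Do (asgop restore_regs) k)))))))))) ?\<rho>2 i ?out P" by (rule wp_emit_toks)
      then show ?thesis using False minc_time(2)[OF o1] by simp
    qed
  qed
qed

lemma wp_gates: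
  assumes "ready \<rho> i" "\<And>p. p \<in> set ps \<Longrightarrow> ctrl_ok p"
    and "\<And>\<rho>' i'. ready \<rho>' i' \<Longrightarrow> frame2 \<rho> \<rho>' \<Longrightarrow>
      wp k \<rho>' i' (out @ tcode (concat (map (\<lambda>p. gate_toks (mk_gate (p, mval N \<rho> all_regs))) ps))) P"
  shows "wp (foldr gate_com ps k) \<rho> i out P"
  using assms
proof (induction ps arbitrary: \<rho> i out)
  case Nil
  then show ?case using frame2_refl by simp
next
  case (Cons p ps)
  have "wp (gate_com p (foldr gate_com ps k)) \<rho> i out P"
  proof (rule wp_gate_com[OF Cons.prems(1)])
    show "ctrl_ok p" using Cons.prems(2) by simp
    fix \<rho>1 i1 assume 1: "ready \<rho>1 i1" "frame2 \<rho> \<rho>1"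
    have m: "mval N \<rho>1 all_regs = mval N \<rho> all_regs"
      by (rule mval_all_cong) (use 1(2) in \<open>auto simp: frame2_def\<close>)
    show "wp (foldr gate_com ps k) \<rho>1 i1 (out @ tcode (gate_toks (mk_gate (p, mval N \<rho> all_regs)))) P"
    proof (rule Cons.IH[OF 1(1)])
      show "\<And>q. q \<in> set ps \<Longrightarrow> ctrl_ok q" using Cons.prems(2) by simp
      fix \<rho>2 i2 assume 2: "ready \<rho>2 i2" "frame2 \<rho>1 \<rho>2"
      show "wp k \<rho>2 i2 ((out @ tcode (gate_toks (mk_gate (p, mval N \<rho> all_regs)))) @
         tcode (concat (map (\<lambda>p. gate_toks (mk_gate (p, mval N \<rho>1 all_regs))) ps))) P"
        using Cons.prems(3)[OF 2(1) frame2_trans[OF 1(2) 2(2)]] unfolding m by simp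
    qed
  qed
  then show ?case by simp
qed

lemma exec_body:
  assumes o: "ready \<rho> i" and z: "\<rho> FL = 0" "\<rho> ZZ = 0"
  shows "\<exists>\<rho>' i'. ready \<rho>' i' \<and> \<rho>' ZZ = 0 \<and>
    (if mval N \<rho> all_regs + 1 = Nn * Tn then mval N \<rho>' all_regs = 0 \<and> \<rho>' FL \<noteq> 0
     else mval N \<rho>' all_regs = mval N \<rho> all_regs + 1 \<and> \<rho>' FL = 0) \<and>
    exec w body (tape_of B l \<rho>, i, out) (tape_of B l \<rho>', i',
      out @ tcode (concat (map (\<lambda>p. gate_toks (mk_gate (p, mval N \<rho> all_regs))) ctrls)))"
proof -
  let ?\<kappa> = "mval N \<rho> all_regs"
  let ?out = "out @ tcode (concat (map (\<lambda>p. gate_toks (mk_gate (p, ?\<kappa>))) ctrls))"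
  have "wp body \<rho> i out (\<lambda>t. \<exists>\<rho>' i'. t = (tape_of B l \<rho>', i', ?out) \<and> ready \<rho>' i' \<and> \<rho>' ZZ = 0 \<and>
    (if ?\<kappa> + 1 = Nn * Tn then mval N \<rho>' all_regs = 0 \<and> \<rho>' FL \<noteq> 0
     else mval N \<rho>' all_regs = ?\<kappa> + 1 \<and> \<rho>' FL = 0))" (is "wp _ _ _ _ ?P")
    unfolding body_def
  proof (rule wp_gates[OF o])
    show "\<And>p. p \<in> set ctrls \<Longrightarrow> ctrl_ok p" by (simp add: set_ctrls)
    fix \<rho>1 i1 assume 1: "ready \<rho>1 i1" "frame2 \<rho> \<rho>1"
    have m: "mval N \<rho>1 all_regs = ?\<kappa>" by (rule mval_all_cong) (use 1(2) in \<open>auto simp: frame2_def\<close>)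
    have z1: "\<rho>1 FL = 0" "\<rho>1 ZZ = 0" using 1(2) z by (auto simp: frame2_def)
    have g1: "good \<rho>1" using 1 by (simp add: ready_def)
    let ?\<rho>2 = "fst (minc N all_regs \<rho>1)"
    have L: "N ^ length all_regs = Nn * Tn" by (simp add: all_regs_def register_lists flip: power_add)
    have "\<And>r. r \<in> set all_regs \<Longrightarrow> \<rho>1 r < N" using g1 by (rule goodD)
    note sp = minc_spec[OF register_lists(4), of \<rho>1 N, unfolded L m, OF this]
    have KX: "(KX,y) \<notin> set all_regs" for y unfolding all_regs_def set_append all_regs_banks by simp
    have g2: "good ?\<rho>2" using good_minc[OF g1] .
    have o2: "ready ?\<rho>2 i1" using 1(1) sp KX g2 by (simp add: ready_def)
    have z2: "?\<rho>2 FL = 0" "?\<rho>2 ZZ = 0" using sp KX z1 by simp_all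
    show "wp (incs B all_regs (\<lambda>ov. if ov then Do (incop B FL) Skip else Skip)) \<rho>1 i1 ?out ?P"
    proof (rule wp_incs[OF g1])
      show "wp (if snd (minc N all_regs \<rho>1) then Do (incop B FL) Skip else Skip) ?\<rho>2 i1 ?out ?P"
      proof (cases "?\<kappa> + 1 = Nn * Tn")
        case False
        then have s: "\<not> snd (minc N all_regs \<rho>1)" "mval N ?\<rho>2 all_regs = ?\<kappa> + 1" using sp by simp_all
        have "wp Skip ?\<rho>2 i1 ?out ?P"
          by (rule wp_Skip, intro exI[of _ ?\<rho>2] exI[of _ i1]) (use False s o2 z2 in simp)
        then show ?thesis using s by simp
      next
        case True
        then have s: "snd (minc N all_regs \<rho>1)" "mval N ?\<rho>2 all_regs = 0" using sp by simp_all
        let ?\<rho>3 = "?\<rho>2(FL := 1)"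
        have wend: "1 < N" using w_less by simp
        have "good ?\<rho>3" using good_upd[OF g2 wend] .
        then have o3: "ready ?\<rho>3 i1" using o2 by (simp add: ready_def)
        have m3: "mval N ?\<rho>3 all_regs = 0" using s(2) KX by (subst mval_upd) auto
        have z3: "?\<rho>3 FL \<noteq> 0" "?\<rho>3 ZZ = 0" using z2 by simp_all
        have "wp Skip ?\<rho>3 i1 ?out ?P"
          by (rule wp_Skip, intro exI[of _ ?\<rho>3] exI[of _ i1]) (use True m3 o3 z3 in simp)
        then have "wp (Do (incop B FL) Skip) ?\<rho>2 i1 ?out ?P"
          using wend z2 by (intro wp_inc[OF g2]) simp
        then show ?thesis using s by simp
      qed
    qed
  qed
  then show ?thesis unfolding wp_def by blast
qed

lemma exec_loop:
  assumes "ready \<rho> i" "\<rho> FL = 0" "\<rho> ZZ = 0"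
  shows "\<exists>\<rho>' i'. good \<rho>' \<and> mval N \<rho>' all_regs = 0 \<and>
    exec w (While (eqop [(FL,ZZ)]) body) (tape_of B l \<rho>, i, out) (tape_of B l \<rho>', i',
      out @ tcode (concat (map gate_toks (map mk_gate (nodes (mval N \<rho> all_regs))))))"
  using assms
proof (induction "Nn * Tn - mval N \<rho> all_regs" arbitrary: \<rho> i out rule: less_induct)
  case less
  let ?\<kappa> = "mval N \<rho> all_regs"
  have g: "good \<rho>" using less.prems by (simp add: ready_def)
  have lt: "?\<kappa> < Nn * Tn" by (rule mval_all_less[OF g])
  let ?o = "concat (map (\<lambda>p. gate_toks (mk_gate (p, ?\<kappa>))) ctrls)"
  have t: "op_sem w (eqop [(FL,ZZ)]) (tape_of B l \<rho>, i, out) = (1, tape_of B l \<rho>, i, out)"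
    using op_sem_eq[OF g] less.prems by simp
  obtain \<rho>1 i1 where 1: "ready \<rho>1 i1" "\<rho>1 ZZ = 0"
    "if ?\<kappa> + 1 = Nn * Tn then mval N \<rho>1 all_regs = 0 \<and> \<rho>1 FL \<noteq> 0 else mval N \<rho>1 all_regs = ?\<kappa> + 1 \<and> \<rho>1 FL = 0"
    "exec w body (tape_of B l \<rho>, i, out) (tape_of B l \<rho>1, i1, out @ tcode ?o)"
    using exec_body[OF less.prems] by blast
  have g1: "good \<rho>1" using 1 by (simp add: ready_def)
  have nd: "concat (map gate_toks (map mk_gate (nodes ?\<kappa>))) =
     ?o @ concat (map gate_toks (map mk_gate (nodes (Suc ?\<kappa>))))"
    unfolding nodes_step[OF lt] by (simp add: comp_def)
  show ?case
  proof (cases "?\<kappa> + 1 = Nn * Tn")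
    case True
    then have e: "nodes (Suc ?\<kappa>) = []" by (simp add: nodes_def)
    have f: "op_sem w (eqop [(FL,ZZ)]) (tape_of B l \<rho>1, i1, out @ tcode ?o) = (0, tape_of B l \<rho>1, i1, out @ tcode ?o)"
      using op_sem_eq[OF g1] 1(2,3) True by simp
    have "exec w (While (eqop [(FL,ZZ)]) body) (tape_of B l \<rho>, i, out) (tape_of B l \<rho>1, i1, out @ tcode ?o)"
      by (rule exec.WhileT[OF t _ 1(4) exec.WhileF[OF f]]) simp
    then show ?thesis using g1 1(3) True unfolding nd e by auto
  next
    case False
    then have m: "mval N \<rho>1 all_regs = Suc ?\<kappa>" "\<rho>1 FL = 0" using 1(3) by simp_all
    have d: "Nn * Tn - mval N \<rho>1 all_regs < Nn * Tn - ?\<kappa>" using lt m by linarith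
    obtain \<rho>' i' where r: "good \<rho>'" "mval N \<rho>' all_regs = 0"
      "exec w (While (eqop [(FL,ZZ)]) body) (tape_of B l \<rho>1, i1, out @ tcode ?o) (tape_of B l \<rho>', i',
       (out @ tcode ?o) @ tcode (concat (map gate_toks (map mk_gate (nodes (mval N \<rho>1 all_regs))))))"
      using less.hyps[OF d 1(1) m(2) 1(2)] by blast
    have "exec w (While (eqop [(FL,ZZ)]) body) (tape_of B l \<rho>, i, out) (tape_of B l \<rho>', i',
       (out @ tcode ?o) @ tcode (concat (map gate_toks (map mk_gate (nodes (mval N \<rho>1 all_regs))))))"
      by (rule exec.WhileT[OF t _ 1(4) r(3)]) simp
    then show ?thesis using r(1,2) unfolding nd m(1) by auto
  qed
qed

theorem exec_main_com:
  assumes "ready \<rho> i" "\<rho> FL = 0" "\<rho> ZZ = 0" "mval N \<rho> all_regs = 0"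
  shows "\<exists>xs i'. length xs = l \<and> exec w main_com (tape_of B l \<rho>, i, [])
    (xs, i', encode_instance (map mk_gate (nodes 0)) (node_name (CI, 0)) 1)"
proof -
  let ?g = "tcode (concat (map gate_toks (map mk_gate (nodes 0))))"
  obtain \<rho>1 i1 where 1: "good \<rho>1" "mval N \<rho>1 all_regs = 0"
    "exec w (While (eqop [(FL,ZZ)]) body) (tape_of B l \<rho>, i, []) (tape_of B l \<rho>1, i1, ?g)"
    using exec_loop[OF assms(1-3), of "[]"] assms(4) by auto
  let ?out = "encode_instance (map mk_gate (nodes 0)) (node_name (CI, 0)) 1"
  have e: "?out = ((?g @ tcode [TOut]) @ bits_code (name_bits CI \<rho>1)) @ tcode [TOut, T1]"
    using tcode_name[OF 1(1), of CI] 1(2) by (simp add: encode_instance_def num_toks_01)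
  have "wp main_com \<rho> i [] (\<lambda>t. t = (tape_of B l \<rho>1, i1, ?out))"
    unfolding main_com_def
    by (rule wp_Seq[OF 1(3)], intro wp_emit_toks wp_print_name wp_Skip) (simp only: e append_Nil)
  then have "exec w main_com (tape_of B l \<rho>, i, []) (tape_of B l \<rho>1, i1, ?out)" unfolding wp_def by blast
  then show ?thesis using tape_of_length by blast
qed

end

section \<open>Measuring the tape\<close>

abbreviation CNT :: reg where "CNT \<equiv> (KX,VU,J0)"

text \<open>While the length of the tape is being determined, a cell with entry 2 in register \<open>CNT\<close> is padding,
  the other cells hold the bits of a binary counter.\<close>
fun cval :: "reg cell list \<Rightarrow> nat" where
  "cval [] = 0"
| "cval (x # xs) = (if x CNT = 2 then cval xs else x CNT + 2 * cval xs)"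

definition cbits :: "reg cell list \<Rightarrow> nat" where
  "cbits xs = length (filter (\<lambda>x. x CNT \<noteq> 2) xs)"

definition g_cinc :: "nat \<Rightarrow> reg cell \<Rightarrow> nat \<times> reg cell \<times> bool list" where
  "g_cinc q x = (if q = 1 \<and> x CNT = 0 then (0, x(CNT := 1), [])
     else if q = 1 \<and> x CNT = 1 then (1, x(CNT := 0), []) else (q, x, []))"

definition cincop :: "('a, reg) oper" where
  "cincop = Sweep 1 g_cinc (\<lambda>_. (None, [])) Pair"

definition isSome :: "'a option \<Rightarrow> nat" where
  "isSome a = (case a of None \<Rightarrow> 0 | Some _ \<Rightarrow> 1)"

text \<open>Whenever the counter needs a new bit, the tape grows by \<open>K\<close> cells: the bit
  and \<open>K - 1\<close> cells of padding. In this way the tape reaches a multiple of the binary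
  length without knowing it in advance.\<close>

definition count_step :: "nat \<Rightarrow> 'a prog \<Rightarrow> 'a prog" where
  "count_step K k = Switch cincop (\<lambda>v. if v = 1
     then Do (extop ((\<lambda>_. 0)(CNT := 1))) (((Do (extop ((\<lambda>_. 0)(CNT := 2)))) ^^ (K - 1)) k) else k)"

text \<open>Two steps before the loop make the count \<open>length w + 2\<close>. The cells are then
  cleared for use as registers, and a second pass over the input sets \<open>NN\<close> to
  \<open>length w + 1\<close>.\<close>

definition init_com :: "nat \<Rightarrow> nat \<Rightarrow> 'a prog \<Rightarrow> 'a prog" where
  "init_com B K k = count_step K (count_step K (Do (Inp (\<lambda>_. 0) Rgt)
     (Seq (While (Inp isSome Rgt) (count_step K Skip)) (Do (asgop (\<lambda>_. None)) (rewind (Do (Inp (\<lambda>_. 0) Rgt)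
       (Do (incop B NN) (Seq (While (Inp isSome Rgt) (Do (incop B NN) Skip)) k))))))))"

lemma okcom_init_com:
  assumes "3 \<le> B" "okcom B B k"
  shows "okcom B B (init_com B K k)"
proof -
  have B2: "2 \<le> B" using assms by simp
  have "okop B B cincop" using assms(1) by (auto simp: cincop_def g_cinc_def cells_def)
  moreover have "okop B B (extop ((\<lambda>_. 0)(CNT := v)))" if "v \<le> 2" for v
    using assms(1) that by (intro okop_basic[OF B2]) (auto simp: cells_def)
  moreover have "okop B B (extop ((\<lambda>_. 0)(CNT := 2)))" by (rule calculation) simp
  then have "okcom B B k \<Longrightarrow> okcom B B (((Do (extop ((\<lambda>_. 0)(CNT := 2)))) ^^ j) k)" for k :: "'b prog" and j
    by (induction j) auto
  moreover have "okop B B (extop ((\<lambda>_. 0)(CNT := Suc 0)))" by (rule calculation) simp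
  ultimately have c: "okcom B B k \<Longrightarrow> okcom B B (count_step K k)" for k :: "'b prog"
    unfolding count_step_def by auto
  show ?thesis unfolding init_com_def
    using assms(2) B2 by (auto intro!: c okcom_rewind simp: okop_basic[OF B2] isSome_def split: option.splits)
qed

lemma cval_less: "\<forall>x\<in>set xs. x CNT \<le> 2 \<Longrightarrow> cval xs < 2 ^ cbits xs"
proof (induction xs)
  case (Cons x xs)
  have "cval xs < 2 ^ cbits xs" using Cons by simp
  moreover have "x CNT \<le> 2" using Cons by simp
  ultimately show ?case by (auto simp: cbits_def)
qed (simp add: cbits_def)

lemma sweep_right_cinc:
  assumes "\<forall>x\<in>set xs. x CNT \<le> 2" "q < 2"
  shows "\<exists>q' xs'. sweep_right g_cinc q xs = (q', xs', []) \<and> q' < 2 \<and> cval xs' + q' * 2 ^ cbits xs = cval xs + q \<and>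
     cbits xs' = cbits xs \<and> length xs' = length xs \<and> (\<forall>x\<in>set xs'. x CNT \<le> 2)"
  using assms
proof (induction xs arbitrary: q)
  case (Cons x xs)
  obtain q1 x1 where g: "g_cinc q x = (q1, x1, [])" by (cases "g_cinc q x") (auto simp: g_cinc_def split: if_splits)
  have x: "x CNT \<le> 2" using Cons.prems by simp
  have 1: "q1 < 2" "x1 CNT \<le> 2" "x1 CNT = 2 \<longleftrightarrow> x CNT = 2" "x CNT = 2 \<Longrightarrow> q1 = q"
    "x CNT \<noteq> 2 \<Longrightarrow> x1 CNT + 2 * q1 = x CNT + q"
    using g x Cons.prems(2) by (auto simp: g_cinc_def split: if_splits)
  obtain q' xs' where r: "sweep_right g_cinc q1 xs = (q', xs', [])" "q' < 2"
    "cval xs' + q' * 2 ^ cbits xs = cval xs + q1" "cbits xs' = cbits xs" "length xs' = length xs" "\<forall>x\<in>set xs'. x CNT \<le> 2"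
    using Cons.IH[of q1] Cons.prems(1) 1(1) by auto
  have "cval (x1 # xs') + q' * 2 ^ cbits (x # xs) = cval (x # xs) + q"
  proof (cases "x CNT = 2")
    case True
    then show ?thesis using r(3) 1 by (simp add: cbits_def)
  next
    case False
    have "x1 CNT + 2 * cval xs' + q' * (2 * 2 ^ cbits xs) = x1 CNT + 2 * (cval xs' + q' * 2 ^ cbits xs)" by simp
    also have "\<dots> = x CNT + 2 * cval xs + q" unfolding r(3) using 1(5)[OF False] by simp
    finally show ?thesis using False 1(3) by (simp add: cbits_def)
  qed
  moreover have "sweep_right g_cinc q (x # xs) = (q', x1 # xs', [])" using g r(1) by simp
  moreover have "cbits (x1 # xs') = cbits (x # xs)" using r(4) 1(3) by (simp add: cbits_def)
  ultimately show ?case using r 1(2) by (intro exI[of _ q'] exI[of _ "x1 # xs'"]) auto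
qed (auto simp: cbits_def)

text \<open>The last conjunct says that a positive counter has leading bit 1; it bounds the tape
  from above.\<close>

definition counted :: "nat \<Rightarrow> nat \<Rightarrow> reg cell list \<Rightarrow> bool" where
  "counted K j xs \<longleftrightarrow> (\<forall>x\<in>set xs. x CNT \<le> 2) \<and> length xs = K * cbits xs \<and> cval xs = j \<and> 2 ^ cbits xs \<le> max 1 (2 * j)"

lemma cval_append: "cval (xs @ ys) = cval xs + 2 ^ cbits xs * cval ys"
  by (induction xs) (auto simp: cbits_def algebra_simps)

lemma exec_extend:
  assumes "exec w k (xs @ replicate j x, i, out) t"
  shows "exec w (((Do (extop x)) ^^ j) k) (xs, i, out) t"
  using assms
proof (induction j arbitrary: xs)
  case (Suc j)
  have "exec w (((Do (extop x)) ^^ j) k) (xs @ [x], i, out) t" by (rule Suc.IH) (use Suc.prems in simp)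
  then have "exec w (Do (extop x) (((Do (extop x)) ^^ j) k)) (xs, i, out) t"
    by (rule exec.Switch[rotated]) (simp add: extop_def case_prod_unfold)
  then show ?case by simp
qed simp

lemma exec_count_step:
  assumes inv: "counted K j xs" and K: "0 < K"
    and k: "\<And>xs'. counted K (j + 1) xs' \<Longrightarrow> exec w k (xs', i, out) (t xs')"
  shows "\<exists>xs'. counted K (j + 1) xs' \<and> exec w (count_step K k) (xs, i, out) (t xs')"
proof -
  have d: "\<forall>x\<in>set xs. x CNT \<le> 2" and len: "length xs = K * cbits xs" and v: "cval xs = j"
    and up: "2 ^ cbits xs \<le> max 1 (2 * j)" using inv by (auto simp: counted_def)
  have jl: "j < 2 ^ cbits xs" using cval_less[OF d] v by simp
  obtain q' xs1 where r: "sweep_right g_cinc 1 xs = (q', xs1, [])" "q' < 2"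
    "cval xs1 + q' * 2 ^ cbits xs = j + 1" "cbits xs1 = cbits xs" "length xs1 = length xs" "\<forall>x\<in>set xs1. x CNT \<le> 2"
    using sweep_right_cinc[OF d, of 1] v by auto
  have o: "op_sem w cincop (xs, i, out) = (q', xs1, i, out)" by (simp add: cincop_def r(1)[simplified])
  show ?thesis
  proof (cases "q' = 1")
    case False
    then have q: "q' = 0" using r(2) by simp
    then have v1: "cval xs1 = j + 1" using r(3) by simp
    have "2 ^ cbits xs \<le> max 1 (2 * (j + 1))" using up by auto
    then have i1: "counted K (j + 1) xs1" using r v1 len by (simp add: counted_def)
    have "exec w (count_step K k) (xs, i, out) (t xs1)"
      unfolding count_step_def by (rule exec.Switch[OF o]) (use k[OF i1] q in simp)
    then show ?thesis using i1 by blast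
  next
    case True
    then have "cval xs1 + 2 ^ cbits xs = j + 1" using r(3) by simp
    \<comment> \<open>On overflow all old bits have become 0, so the appended bit 1 alone carries
      the value.\<close>
    then have c: "cval xs1 = 0" "j + 1 = 2 ^ cbits xs" using jl by linarith+
    let ?c1 = "(\<lambda>_. 0)(CNT := 1) :: reg cell" and ?c2 = "(\<lambda>_. 0)(CNT := 2) :: reg cell"
    let ?xs = "(xs1 @ [?c1]) @ replicate (K - 1) ?c2"
    have z: "cval (replicate m ?c2) = 0" for m by (induction m) auto
    have v2: "cval ?xs = j + 1" using c r(4) z by (simp add: cval_append cbits_def)
    have b2: "cbits ?xs = cbits xs + 1" using r(4) by (simp add: cbits_def)
    have "length ?xs = K * cbits ?xs" unfolding b2 using r(5) len K by simp
    moreover have "2 ^ cbits ?xs \<le> max 1 (2 * (j + 1))" unfolding b2 c(2) by simp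
    ultimately have i2: "counted K (j + 1) ?xs" unfolding counted_def using v2 r(6) by auto
    have "exec w ((Do (extop ?c2) ^^ (K - 1)) k) (xs1 @ [?c1], i, out) (t ?xs)"
      by (rule exec_extend[OF k[OF i2]])
    then have e: "exec w (Do (extop ?c1) ((Do (extop ?c2) ^^ (K - 1)) k)) (xs1, i, out) (t ?xs)"
      by (rule exec.Switch[rotated]) (simp add: extop_def case_prod_unfold)
    have "exec w (count_step K k) (xs, i, out) (t ?xs)"
      unfolding count_step_def by (rule exec.Switch[OF o]) (use e True in simp)
    then show ?thesis using i2 by blast
  qed
qed

lemma isSome_read: "isSome (read_input w i) = (if 1 \<le> i \<and> i \<le> length w then 1 else 0)"
  by (simp add: isSome_def read_input_def)

lemma exec_count_loop:
  assumes "counted K j xs" "0 < K" "1 \<le> i" "i \<le> length w + 1"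
  shows "\<exists>xs'. counted K (j + (length w + 1 - i)) xs' \<and>
    exec w (While (Inp isSome Rgt) (count_step K Skip)) (xs, i, out) (xs', length w + 1, out)"
  using assms
proof (induction "length w + 1 - i" arbitrary: i j xs)
  case 0
  then have i: "i = length w + 1" by simp
  have "op_sem w (Inp isSome Rgt) (xs, i, out) = (0, xs, length w + 1, out)" by (simp add: isSome_read i)
  then have "exec w (While (Inp isSome Rgt) (count_step K Skip)) (xs, i, out) (xs, length w + 1, out)" by (rule exec.WhileF)
  then show ?case using 0 by (intro exI[of _ xs]) simp
next
  case (Suc m)
  then have o: "op_sem w (Inp isSome Rgt) (xs, i, out) = (1, xs, i + 1, out)" by (simp add: isSome_read)
  have "\<exists>xs1. counted K (j + 1) xs1 \<and> exec w (count_step K Skip) (xs, i + 1, out) (xs1, i + 1, out)"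
    by (rule exec_count_step[OF Suc.prems(1,2), where t = "\<lambda>xs'. (xs', i + 1, out)"]) (rule exec.Skip)
  then obtain xs1 where 1: "counted K (j + 1) xs1" "exec w (count_step K Skip) (xs, i + 1, out) (xs1, i + 1, out)" by blast
  have "m = length w + 1 - (i + 1)" "i + 1 \<le> length w + 1" using Suc.hyps(2) by auto
  then obtain xs' where 2: "counted K (j + 1 + (length w + 1 - (i + 1))) xs'"
    "exec w (While (Inp isSome Rgt) (count_step K Skip)) (xs1, i + 1, out) (xs', length w + 1, out)"
    using Suc.hyps(1)[of "i + 1" "j + 1" xs1] 1(1) Suc.prems(2) by auto
  have "exec w (While (Inp isSome Rgt) (count_step K Skip)) (xs, i, out) (xs', length w + 1, out)"
    by (rule exec.WhileT[OF o _ 1(2) 2(2)]) simp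
  moreover have "j + 1 + (length w + 1 - (i + 1)) = j + (length w + 1 - i)" using Suc.hyps(2) by simp
  ultimately show ?case using 2(1) by metis
qed

lemma (in regs) exec_measure_loop:
  assumes "1 \<le> i" "i \<le> length w + 1" "good \<rho>" "\<rho> NN + (length w + 1 - i) < N"
  shows "exec w (While (Inp isSome Rgt) (Do (incop B NN) Skip)) (tape_of B l \<rho>, i, out)
    (tape_of B l (\<rho>(NN := \<rho> NN + (length w + 1 - i))), length w + 1, out)"
  using assms
proof (induction "length w + 1 - i" arbitrary: i \<rho>)
  case 0
  then have i: "i = length w + 1" by simp
  have o: "op_sem w (Inp isSome Rgt) (tape_of B l \<rho>, i, out) = (0, tape_of B l \<rho>, length w + 1, out)" by (simp add: isSome_read i)
  have "\<rho>(NN := \<rho> NN + (length w + 1 - i)) = \<rho>" using i by auto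
  then show ?case using exec.WhileF[OF o] by simp
next
  case (Suc m)
  then have o: "op_sem w (Inp isSome Rgt) (tape_of B l \<rho>, i, out) = (1, tape_of B l \<rho>, i + 1, out)" by (simp add: isSome_read)
  let ?\<rho> = "\<rho>(NN := \<rho> NN + 1)"
  have lt: "\<rho> NN + 1 < N" using Suc.prems(4) Suc.hyps(2) by simp
  have g: "good ?\<rho>" by (rule good_upd[OF Suc.prems(3) lt])
  have "wp (Do (incop B NN) Skip) \<rho> (i + 1) out (\<lambda>t. t = (tape_of B l ?\<rho>, i + 1, out))"
    by (rule wp_inc[OF Suc.prems(3)], rule wp_Skip) (use lt in simp)
  then have 1: "exec w (Do (incop B NN) Skip) (tape_of B l \<rho>, i + 1, out) (tape_of B l ?\<rho>, i + 1, out)"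
    unfolding wp_def by blast
  have "exec w (While (Inp isSome Rgt) (Do (incop B NN) Skip)) (tape_of B l ?\<rho>, i + 1, out)
    (tape_of B l (?\<rho>(NN := ?\<rho> NN + (length w + 1 - (i + 1)))), length w + 1, out)"
    by (rule Suc.hyps(1)[OF _ _ _ g]) (use Suc.hyps(2) Suc.prems in auto)
  moreover have "?\<rho>(NN := ?\<rho> NN + (length w + 1 - (i + 1))) = \<rho>(NN := \<rho> NN + (length w + 1 - i))"
    using Suc.hyps(2) by (auto simp: fun_eq_iff)
  ultimately have 2: "exec w (While (Inp isSome Rgt) (Do (incop B NN) Skip)) (tape_of B l ?\<rho>, i + 1, out)
    (tape_of B l (\<rho>(NN := \<rho> NN + (length w + 1 - i))), length w + 1, out)" by simp
  show ?case by (rule exec.WhileT[OF o _ 1 2]) simp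
qed

text \<open>The number \<open>m\<close> of counter bits emerges only during the run, so the final
  state \<open>t m\<close> may depend on it.\<close>

lemma exec_init_com:
  assumes K: "0 < K" and B: "3 \<le> B"
    and k: "\<And>m. length w + 2 < 2 ^ m \<Longrightarrow> 2 ^ m \<le> 2 * (length w + 2) \<Longrightarrow>
      exec w k (tape_of B (K * m) ((\<lambda>_. 0)(NN := length w + 1)), length w + 1, []) (t m)"
  shows "\<exists>m. length w + 2 < 2 ^ m \<and> 2 ^ m \<le> 2 * (length w + 2) \<and>
    exec w (init_com B K k) ([], 0, []) (t m)"
proof -
  let ?n = "length w"
  define rest where "rest = (Do (Inp (\<lambda>_. 0) Rgt) (Do (incop B NN) (Seq (While (Inp isSome Rgt) (Do (incop B NN) Skip)) k)))"
  have rest: "exec w (rewind rest) (replicate (length xs) (\<lambda>_. 0), ?n + 1, []) (t (cbits xs)) \<and>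
      ?n + 2 < 2 ^ cbits xs \<and> 2 ^ cbits xs \<le> 2 * (?n + 2)"
    if inv: "counted K (?n + 2) xs" for xs
  proof -
    \<comment> \<open>The count is less than \<open>2 ^ cbits xs\<close> and, its leading bit being
      1, at least half of it.\<close>
    have m: "?n + 2 < 2 ^ cbits xs" "2 ^ cbits xs \<le> 2 * (?n + 2)" "length xs = K * cbits xs"
      using inv cval_less[of xs] by (auto simp: counted_def)
    define l where "l = K * cbits xs"
    interpret regs B l "B ^ l" w by unfold_locales (use B in auto)
    have "(2::nat) ^ cbits xs \<le> B ^ cbits xs" using B by (intro power_mono) auto
    also have "\<dots> \<le> B ^ l" unfolding l_def using B K by (intro power_increasing) auto
    finally have N: "?n + 2 < B ^ l" using m by simp
    have g0: "good (\<lambda>_::reg. 0)" using N_pos by (simp add: good_def)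
    let ?\<rho> = "(\<lambda>_::reg. 0::nat)(NN := 1)"
    have g: "good ?\<rho>" by (rule good_upd[OF g0]) (use N in simp)
    have e: "?\<rho>(NN := ?\<rho> NN + (?n + 1 - 1)) = (\<lambda>_. 0)(NN := ?n + 1)" by (auto simp: fun_eq_iff)
    have w: "exec w (While (Inp isSome Rgt) (Do (incop B NN) Skip)) (tape_of B l ?\<rho>, 1, [])
       (tape_of B l ((\<lambda>_. 0)(NN := ?n + 1)), ?n + 1, [])"
      using exec_measure_loop[of 1 ?\<rho> "[]"] g N unfolding e by simp
    have fin: "exec w k (tape_of B l ((\<lambda>_. 0)(NN := ?n + 1)), ?n + 1, []) (t (cbits xs))"
      unfolding l_def by (rule k[OF m(1,2)])
    have "exec w (Seq (While (Inp isSome Rgt) (Do (incop B NN) Skip)) k) (tape_of B l ?\<rho>, 1, []) (t (cbits xs))"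
      by (rule exec.Seq[OF w fin])
    then have "wp (Seq (While (Inp isSome Rgt) (Do (incop B NN) Skip)) k) ?\<rho> 1 [] (\<lambda>s. s = t (cbits xs))"
      unfolding wp_def by blast
    then have "wp (Do (incop B NN) (Seq (While (Inp isSome Rgt) (Do (incop B NN) Skip)) k)) (\<lambda>_. 0) 1 [] (\<lambda>s. s = t (cbits xs))"
      by (intro wp_inc[OF g0]) (use N in simp)
    then have "wp rest (\<lambda>_. 0) 0 [] (\<lambda>s. s = t (cbits xs))"
      unfolding rest_def by (intro wp_inp) simp
    then have "exec w rest (tape_of B l (\<lambda>_. 0), 0, []) (t (cbits xs))" unfolding wp_def by blast
    then have "exec w (rewind rest) (tape_of B l (\<lambda>_. 0), ?n + 1, []) (t (cbits xs))"
      by (intro exec_rewind) auto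
    then show ?thesis using m unfolding tape_of_0 l_def by simp
  qed
  have zero: "sweep_right (g_asg (\<lambda>_. None)) q xs = (q, replicate (length xs) (\<lambda>_. 0), [])" for q and xs :: "reg cell list"
    by (induction xs) (auto simp: g_asg_def)
  let ?L = "Seq (While (Inp isSome Rgt) (count_step K Skip)) (Do (asgop (\<lambda>_. None)) (rewind rest))"
  have loop: "\<exists>m. ?n + 2 < 2 ^ m \<and> 2 ^ m \<le> 2 * (?n + 2) \<and> exec w (Do (Inp (\<lambda>_. 0) Rgt) ?L) (xs, 0, []) (t m)"
    if inv: "counted K 2 xs" for xs
  proof -
    obtain xs' where 1: "counted K (?n + 2) xs'"
      "exec w (While (Inp isSome Rgt) (count_step K Skip)) (xs, 1, []) (xs', ?n + 1, [])"
      using exec_count_loop[OF inv K, of 1 w "[]"] by (auto simp: add.commute)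
    have a: "exec w (Do (asgop (\<lambda>_. None)) (rewind rest)) (xs', ?n + 1, []) (t (cbits xs'))"
      by (rule exec.Switch[where v = 0 and ?s1.0 = "(replicate (length xs') (\<lambda>_. 0), ?n + 1, [])"])
        (use rest[OF 1(1)] in \<open>simp_all add: asgop_def zero\<close>)
    have "exec w ?L (xs, 1, []) (t (cbits xs'))" by (rule exec.Seq[OF 1(2) a])
    then have "exec w (Do (Inp (\<lambda>_. 0) Rgt) ?L) (xs, 0, []) (t (cbits xs'))"
      by (rule exec.Switch[rotated]) simp
    then show ?thesis using rest[OF 1(1)] by blast
  qed
  \<comment> \<open>The number of bits becomes a function of the tape, as
    \<open>exec_count_step\<close> expects the final state to be one.\<close>
  then obtain mm where mm: "\<And>xs. counted K 2 xs \<Longrightarrow> ?n + 2 < 2 ^ mm xs \<and> 2 ^ mm xs \<le> 2 * (?n + 2) \<and>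
     exec w (Do (Inp (\<lambda>_. 0) Rgt) ?L) (xs, 0, []) (t (mm xs))" by metis
  have i0: "counted K 0 []" by (simp add: counted_def cbits_def)
  have "\<exists>xs2. counted K 2 xs2 \<and> exec w (count_step K (Do (Inp (\<lambda>_. 0) Rgt) ?L)) (xs1, 0, []) (t (mm xs2))"
    if "counted K 1 xs1" for xs1
    using exec_count_step[OF that K, of w "Do (Inp (\<lambda>_. 0) Rgt) ?L" 0 "[]" "\<lambda>xs. t (mm xs)"] mm
    by (simp add: numeral_2_eq_2)
  then obtain m2 where m2: "\<And>xs1. counted K 1 xs1 \<Longrightarrow> counted K 2 (m2 xs1) \<and>
      exec w (count_step K (Do (Inp (\<lambda>_. 0) Rgt) ?L)) (xs1, 0, []) (t (mm (m2 xs1)))" by metis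
  obtain xs1 where "counted K 1 xs1"
    "exec w (count_step K (count_step K (Do (Inp (\<lambda>_. 0) Rgt) ?L))) ([], 0, []) (t (mm (m2 xs1)))"
    using exec_count_step[OF i0 K, of w "count_step K (Do (Inp (\<lambda>_. 0) Rgt) ?L)" 0 "[]" "\<lambda>xs. t (mm (m2 xs))"] m2
    by auto
  then have "exec w (init_com B K k) ([], 0, []) (t (mm (m2 xs1)))" "counted K 2 (m2 xs1)"
    using m2 unfolding init_com_def rest_def by auto
  then show ?thesis using mm by blast
qed

text \<open>The head of \<open>M\<close> stays at positions up to \<open>kk * m\<close>, whence
  \<open>Z = kk * m + 1\<close>. The factor \<open>kk + 2\<close> ensures \<open>Z < l\<close>, even
  for \<open>kk = 0\<close>, as \<open>m\<close> is positive.\<close>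

lemma (in ntm) exec_reduction:
  assumes B3: "3 \<le> B" "2 * length ctrls < B" and ls: "log_space_bounded M kk"
  shows "\<exists>xs i out. exec w (init_com B (kk + 2) main_com) ([], 0, []) (xs, i, out) \<and>
     real (length xs) + 1 \<le> real (2 * (kk + 2) + 1) * log 2 (real (length w) + 2) \<and>
     (out \<in> MC {ODiv} \<longleftrightarrow> accepts M w)"
proof -
  let ?n = "length w" and ?K = "kk + 2"
  have main: "\<exists>xs i out. length xs = ?K * m \<and>
      exec w main_com (tape_of B (?K * m) ((\<lambda>_. 0)(NN := ?n + 1)), ?n + 1, []) (xs, i, out) \<and>
      (out \<in> MC {ODiv} \<longleftrightarrow> accepts M w)"
    if m: "?n + 2 < 2 ^ m" for m
  proof -
    have m0: "0 < m" using m by (cases m) auto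
    have "(2::nat) ^ m \<le> B ^ m" using B3 by (intro power_mono) auto
    also have "\<dots> \<le> B ^ (?K * m)" using B3 by (intro power_increasing) auto
    finally have N: "?n + 2 < B ^ (?K * m)" using m by linarith
    have lg: "log 2 (real ?n + 2) \<le> real m"
    proof -
      have "real ?n + 2 = real (?n + 2)" by simp
      also have "\<dots> \<le> 2 ^ m" using m by (metis less_imp_le of_nat_le_iff of_nat_numeral of_nat_power)
      finally show ?thesis by (simp add: log_le_iff powr_realpow)
    qed
    have bnd: "c_wpos c < kk * m + 1" if "reachable M w c" for c
    proof -
      have "real (c_wpos c) \<le> real kk * log 2 (real ?n + 2)" using ls that unfolding log_space_bounded_def by blast
      also have "\<dots> \<le> real kk * real m" using lg by (intro mult_left_mono) auto
      finally have "real (c_wpos c) \<le> real (kk * m)" by simp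
      then show ?thesis by linarith
    qed
    interpret ntm_run M Q \<Gamma> B mk chs "?K * m" "B ^ (?K * m)" w "kk * m + 1"
      by unfold_locales (use B3 N m0 bnd in auto)
    let ?\<rho> = "(\<lambda>_::reg. 0::nat)(NN := ?n + 1)"
    have "good (\<lambda>_::reg. 0::nat)" unfolding good_def using N_pos by blast
    then have "good ?\<rho>" by (rule good_upd) (use N in simp)
    then have o: "ready ?\<rho> (?n + 1)" unfolding ready_def by (intro conjI) simp_all
    have "mval (B ^ (?K * m)) (\<lambda>_::reg. 0) rs = 0" for rs by (induction rs) auto
    moreover have "NN \<notin> set all_regs" unfolding all_regs_def set_append all_regs_banks by simp
    ultimately have z: "mval (B ^ (?K * m)) ?\<rho> all_regs = 0" by (metis mval_upd)
    obtain xs i where x: "length xs = ?K * m" "exec w main_com (tape_of B (?K * m) ?\<rho>, ?n + 1, [])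
       (xs, i, encode_instance (map mk_gate (nodes 0)) (node_name (CI, 0)) 1)"
      using exec_main_com[OF o _ _ z] by auto
    have "encode_instance (map mk_gate (nodes 0)) (node_name (CI, 0)) 1 \<in> MC {ODiv} \<longleftrightarrow> accepts M w"
    proof
      assume "encode_instance (map mk_gate (nodes 0)) (node_name (CI, 0)) 1 \<in> MC {ODiv}"
      then obtain gs out b where "encode_instance (map mk_gate (nodes 0)) (node_name (CI, 0)) 1 = encode_instance gs out b"
        "b \<in> sem gs out" unfolding MC_def by blast
      then have "1 \<in> sem (map mk_gate (nodes 0)) (node_name (CI, 0))" using encode_instance_inject by metis
      then show "accepts M w" using circuit_correct(2)[OF B3(2)] by simp
    next
      assume "accepts M w"
      then show "encode_instance (map mk_gate (nodes 0)) (node_name (CI, 0)) 1 \<in> MC {ODiv}"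
        unfolding MC_def using circuit_correct[OF B3(2)] by blast
    qed
    then show ?thesis using x by blast
  qed
  let ?P = "\<lambda>m t. ?n + 2 < 2 ^ m \<longrightarrow> length (fst t) = ?K * m \<and>
      exec w main_com (tape_of B (?K * m) ((\<lambda>_. 0)(NN := ?n + 1)), ?n + 1, []) t \<and>
      (snd (snd t) \<in> MC {ODiv} \<longleftrightarrow> accepts M w)"
  have "\<forall>m. \<exists>t. ?P m t"
  proof
    fix m
    show "\<exists>t. ?P m t"
    proof (cases "?n + 2 < 2 ^ m")
      case True
      from main[OF this] obtain xs i out where "length xs = ?K * m"
        "exec w main_com (tape_of B (?K * m) ((\<lambda>_. 0)(NN := ?n + 1)), ?n + 1, []) (xs, i, out)"
        "out \<in> MC {ODiv} \<longleftrightarrow> accepts M w" by blast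
      then show ?thesis by (intro exI[of _ "(xs, i, out)"]) simp
    qed blast
  qed
  \<comment> \<open>Final states for all \<open>m\<close> at once, as \<open>exec_init_com\<close>
    requires; for small \<open>m\<close> the value of \<open>t\<close> is arbitrary.\<close>
  then obtain t where "\<forall>m. ?P m (t m)" by (rule choice[THEN exE])
  then have t: "length (fst (t m)) = ?K * m \<and>
      exec w main_com (tape_of B (?K * m) ((\<lambda>_. 0)(NN := ?n + 1)), ?n + 1, []) (t m) \<and>
      (snd (snd (t m)) \<in> MC {ODiv} \<longleftrightarrow> accepts M w)" if "?n + 2 < 2 ^ m" for m using that by blast
  obtain m where m: "?n + 2 < 2 ^ m" "2 ^ m \<le> 2 * (?n + 2)" "exec w (init_com B ?K main_com) ([], 0, []) (t m)"
    using exec_init_com[of ?K B w main_com t] B3 t by auto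
  let ?L = "log 2 (real ?n + 2)"
  have "2 powr real m \<le> 2 * (real ?n + 2)"
  proof -
    have "real (2 ^ m) \<le> real (2 * (?n + 2))" using m(2) by (simp only: of_nat_le_iff)
    then show ?thesis by (simp add: powr_realpow)
  qed
  then have "real m \<le> log 2 (2 * (real ?n + 2))" by (simp add: le_log_iff)
  also have "\<dots> = 1 + ?L" by (subst log_mult) auto
  finally have mL: "real m \<le> 1 + ?L" .
  \<comment> \<open>The summand 2 inside the logarithm makes it at least 1, so additive constants
    can be absorbed into the factor.\<close>
  have L1: "1 \<le> ?L" by (simp add: le_log_iff)
  have "real (?K * m) + 1 \<le> real ?K * (1 + ?L) + 1"
    unfolding of_nat_mult by (intro add_right_mono mult_left_mono mL) simp
  also have "\<dots> \<le> real ?K * (?L + ?L) + ?L" using L1 by (intro add_mono mult_left_mono) auto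
  also have "\<dots> = real (2 * ?K + 1) * ?L" by (simp add: algebra_simps)
  finally have "real (length (fst (t m))) + 1 \<le> real (2 * ?K + 1) * ?L" using t[OF m(1)] by simp
  then show ?thesis using m(3) t[OF m(1)] by (intro exI[of _ "fst (t m)"] exI[of _ "fst (snd (t m))"] exI[of _ "snd (snd (t m))"]) simp
qed

theorem theorem10:
  fixes L :: "'a::finite list set"
  assumes "L \<in> NL"
  shows "logspace_reducible L (MC {ODiv})"
proof -
  obtain M :: "('a, unit) tm" and kk where wf: "wf_tm M" and ls: "log_space_bounded M kk"
    and L: "\<And>w. w \<in> L \<longleftrightarrow> accepts M w" using assms unfolding NL_def by blast
  from wf obtain Q \<Gamma> where wf': "finite Q \<and> finite \<Gamma> \<and> tm_start M \<in> Q \<and> 0 \<in> \<Gamma> \<and>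
     (\<forall>q\<in>Q. \<forall>a s. s \<in> \<Gamma> \<longrightarrow> finite (tm_delta M q a s) \<and>
        (\<forall>(q', s', di, dw, ot) \<in> tm_delta M q a s. q' \<in> Q \<and> s' \<in> \<Gamma>))"
    unfolding wf_tm_def by (elim exE)
  then have fin: "finite Q" "finite \<Gamma>" and st: "tm_start M \<in> Q" "0 \<in> \<Gamma>" by simp_all
  have cl: "finite (tm_delta M q a s) \<and> (\<forall>(q', s', di, dw, ot) \<in> tm_delta M q a s. q' \<in> Q \<and> s' \<in> \<Gamma>)"
    if "q \<in> Q" "s \<in> \<Gamma>" for q a s using wf' that by simp
  \<comment> \<open>The set of all transitions is finite because the input alphabet is.\<close>
  define T where "T = (\<Union>q\<in>Q. \<Union>a\<in>UNIV. \<Union>s\<in>\<Gamma>. tm_delta M q a s)"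
  have "finite T" unfolding T_def using fin cl by auto
  then obtain chs where chs: "set chs = T" using finite_list by blast
  \<comment> \<open>Positive, and larger than every tape symbol.\<close>
  define mk where "mk = Suc (Max \<Gamma>)"
  \<comment> \<open>States, symbols, the marker and the padding entry 2 must be digits, and the
    clock bound needs \<open>2 * length ctrls < B\<close>. There is no circularity: the control
    states depend on \<open>chs\<close> alone.\<close>
  define B where "B = Suc (Max (insert 3 (insert mk (insert (2 * length (ntm.ctrls chs)) (Q \<union> \<Gamma>)))))"
  have B: "x < B" if "x \<in> insert 3 (insert mk (insert (2 * length (ntm.ctrls chs)) (Q \<union> \<Gamma>)))" for x
    unfolding B_def using Max_ge[OF _ that] fin by (simp add: less_Suc_eq_le)
  have T: "q' \<in> Q \<and> s' \<in> \<Gamma>" if "(q',s',di,dw,ot) \<in> T" for q' s' di dw ot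
    using that cl unfolding T_def by fastforce
  interpret ntm M Q \<Gamma> B mk chs
  proof
    show "mk \<notin> \<Gamma>" unfolding mk_def using Max_ge[OF fin(2)] not_less_eq_eq by blast
    fix q a s q' s' di dw ot
    assume "q \<in> Q" "s \<in> \<Gamma>" "(q',s',di,dw,ot) \<in> tm_delta M q a s"
    then have "(q',s',di,dw,ot) \<in> T" unfolding T_def by blast
    then show "q' \<in> Q \<and> s' \<in> \<Gamma> \<and> (q',s',di,dw,ot) \<in> set chs" using T chs by blast
  qed (use st T chs B in \<open>auto simp: mk_def\<close>)
  have B3: "3 \<le> B" "2 * length ctrls < B" using B[of 3] B[of "2 * length ctrls"] by auto
  let ?P = "\<lambda>w out. (\<exists>xs i. exec w (init_com B (kk + 2) main_com) ([], 0, []) (xs, i, out) \<and>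
     real (length xs) + 1 \<le> real (2 * (kk + 2) + 1) * log 2 (real (length w) + 2)) \<and>
     (out \<in> MC {ODiv} \<longleftrightarrow> accepts M w)"
  have "\<forall>w. \<exists>out. ?P w out" using exec_reduction[OF B3 ls] by blast
  then obtain f where f: "\<forall>w. ?P w (f w)" by (rule choice[THEN exE])
  have "logspace_computable f"
  proof (rule logspace_computable_by_com)
    show "okcom B B (init_com B (kk + 2) main_com)"
      using okcom_init_com[OF B3(1)] okcom_main_com B3 by simp
  qed (use f in blast)
  then show ?thesis unfolding logspace_reducible_def using L f by blast
qed

end
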